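(* Let $\mathcal{G} : \mathcal{P}_2(\mathbb{R}^d) \to (-\infty,+\infty]$ be proper, lower semicontinuous (with respect to $W_2$), and convex along generalized geodesics, with $\operatorname{arg\,min} \mathcal{G} \neq \emptyset$. Let $\{\epsilon_n\}_{n\ge0}\subset \mathbb{R}_{\geq 0}$ with $\sum_{n=0}^{\infty} \epsilon_n < \infty$ and let $\{\tau_n\}_{n\ge0} \subset \mathbb{R}_{> 0}$ with $\sum_{i=0}^{\infty}\tau_i= \infty$. Define $\sigma_n:= \sum_{i=0}^{n-1}\tau_i$ for $n\in\mathbb{N}$. Let $\{\mu_n\}_{n\ge0}\subset\mathcal{P}_2(\mathbb{R}^d)$ be a sequence satisfying $$W_2(\mu_{n+1},J_{\tau_n}(\mu_n))\leq \epsilon_n \quad \text{for all } n \in \mathbb{N}.$$ 1. It holds that $$\mathcal{G}(\bar \beta_n)-\inf \mathcal{G} = O\left(\frac{1}{\sigma_n}\right) \quad \text{as } n\to \infty,$$ where $\bar \beta_n := J_{\tau_{j_n}}(\mu_{j_n})$ with $j_n \in \operatorname{arg\,min}_{i=0,\dots,n-1}\mathcal{G}(J_{\tau_i}(\mu_i))$ (the best iterate). 2. If $\sum_{n=1}^{\infty}\frac{\sigma_n}{\tau_n}\epsilon_{n-1}^2 < \infty$, then $$\mathcal{G}(J_{\tau_n}(\mu_n))-\inf \mathcal{G} = O\left(\frac{1}{\sigma_n}\right) \quad \text{as } n\to \infty,$$ and $\{\mu_n\}_n$ converges with respect to the topology $\tau_{w,2}$ to some $\mu^*\in \operatorname{arg\,min}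 \mathcal{G}$. In particular $W_p(\mu_n,\mu^* )\to 0$ for all $p\in[1,2)$.
   Context: $\mathbb{N}$ includes $0$. $\mathcal{P}_2(\mathbb{R}^d)$ is the set of Borel probability measures on $\mathbb{R}^d$ with finite second moment. For $p\in[1,2]$, $W_p$ is the $p$-Wasserstein distance for the Euclidean cost, $W_p^p(\mu,\nu)=\inf_{\gamma\in\Gamma(\mu,\nu)}\int\|x-y\|^p\,d\gamma$, with $\Gamma(\mu,\nu)$ the set of couplings; $\Gamma_{\rm opt}(\mu,\nu)$ is the set of optimal couplings for $p=2$. A generalized geodesic between $\mu_0,\mu_1\in\mathcal{P}_2(\mathbb{R}^d)$ with base $\nu\in\mathcal{P}_2(\mathbb{R}^d)$ is a curve $\mu_t=((1-t)\pi^2+t\pi^3)_{\#}\gamma$, $t\in[0,1]$, where $\gamma$ is a probability measure on $(\mathbb{R}^d)^3$ with marginals $\nu,\mu_0,\mu_1$ such that $\pi^{1,2}_{\#}\gamma\in\Gamma_{\rm opt}(\nu,\mu_0)$ and $\pi^{1,3}_{\#}\gamma\in\Gamma_{\rm opt}(\nu,\mu_1)$ ($\pi^i$, $\pi^{i,j}$ are the coordinate projections). A proper function $\mathcal{G}$ is convex along generalized geodesics if for every $\mu_0,\mu_1,\nu\in\mathcal{P}_2(\mathbb{R}^d)$ there is a generalized geodesic $(\mu_s)_{s\in[0,1]}$ between $\mu_0$ and $\mu_1$ with base $\nu$ such that $\mathcal{G}(\mu_s)\le(1-s)\mathcal{G}(\mu_0)+s\,\mathcal{G}(\mu_1)$ for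 all $s\in[0,1]$. For $\tau>0$, $J_\tau(\mu)$ is the minimizer of $\nu\mapsto \mathcal{G}(\nu)+\frac{1}{2\tau}W_2^2(\nu,\mu)$ over $\mathcal{P}_2(\mathbb{R}^d)$; under the assumptions above it exists and is unique for every $\mu\in\mathcal{P}_2(\mathbb{R}^d)$. Topology $\tau_{w,2}$: let $C_2^w(\mathbb{R}^d)$ be the space of continuous $f:\mathbb{R}^d\to\mathbb{R}$ with $\lim_{\|x\|\to\infty} f(x)/(1+\|x\|^2)=0$, normed by $\sup_x |f(x)|/(1+\|x\|^2)$. Its dual is the space of signed measures with finite second moment, and $\tau_{w,2}$ is the weak-$*$ topology restricted to $\mathcal{P}_2(\mathbb{R}^d)$; thus $\mu_n\to\mu$ in $\tau_{w,2}$ iff $\int f\,d\mu_n\to\int f\,d\mu$ for all $f\in C_2^w(\mathbb{R}^d)$. *)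

theory Defs
  imports "HOL-Probability.Probability" "HOL-Library.Landau_Symbols"
begin

definition P2 :: "'a::euclidean_space measure set" where
  "P2 = {\<mu>. sets \<mu> = sets borel \<and> prob_space \<mu> \<and> integrable \<mu> (\<lambda>x. (norm x)\<^sup>2)}"

definition couplings :: "'a::euclidean_space measure \<Rightarrow> 'a measure \<Rightarrow> ('a \<times> 'a) measure set" where
  "couplings \<mu> \<nu> = {\<gamma>. sets \<gamma> = sets borel \<and> prob_space \<gamma> \<and>
     distr \<gamma> borel fst = \<mu> \<and> distr \<gamma> borel snd = \<nu>}"

definition transport_cost :: "real \<Rightarrow> ('a::euclidean_space \<times> 'a) measure \<Rightarrow> ennreal" where
  "transport_cost p \<gamma> = (\<integral>\<^sup>+ (x, y). ennreal (norm (x - y) powr p) \<partial>\<gamma>)"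

text \<open>For \<open>\<mu>, \<nu> \<in> P2\<close> and \<open>p \<in> [1,2]\<close> the infimum is finite, so \<open>enn2real\<close> loses nothing;
  the value carries no information outside that range (\<open>enn2real \<infinity> = 0\<close>).\<close>

definition W :: "real \<Rightarrow> 'a::euclidean_space measure \<Rightarrow> 'a measure \<Rightarrow> real" where
  "W p \<mu> \<nu> = enn2real (INF \<gamma> \<in> couplings \<mu> \<nu>. transport_cost p \<gamma>) powr (1 / p)"

definition opt_couplings :: "'a::euclidean_space measure \<Rightarrow> 'a measure \<Rightarrow> ('a \<times> 'a) measure set" where
  "opt_couplings \<mu> \<nu> = {\<gamma> \<in> couplings \<mu> \<nu>.
     transport_cost 2 \<gamma> = (INF \<gamma>' \<in> couplings \<mu> \<nu>. transport_cost 2 \<gamma>')}"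

text \<open>The first coordinate of the three-plan carries the base \<open>\<nu>\<close>; the three marginal
  conditions are contained in the two coupling conditions.\<close>

definition generalized_geodesic ::
  "'a::euclidean_space measure \<Rightarrow> 'a measure \<Rightarrow> 'a measure \<Rightarrow> (real \<Rightarrow> 'a measure) \<Rightarrow> bool" where
  "generalized_geodesic \<nu> \<mu>0 \<mu>1 c \<longleftrightarrow>
     (\<exists>\<gamma> :: ('a \<times> 'a \<times> 'a) measure. sets \<gamma> = sets borel \<and> prob_space \<gamma> \<and>
        distr \<gamma> borel (\<lambda>(x, y, z). (x, y)) \<in> opt_couplings \<nu> \<mu>0 \<and>
        distr \<gamma> borel (\<lambda>(x, y, z). (x, z)) \<in> opt_couplings \<nu> \<mu>1 \<and>
        (\<forall>t\<in>{0..1}. c t = distr \<gamma> borel (\<lambda>(x, y, z). (1 - t) *\<^sub>R y + t *\<^sub>R z)))"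

text \<open>Functionals \<open>P2 \<Rightarrow> (-\<infinity>, \<infinity>]\<close> are represented by total functions into \<open>ereal\<close>; only the
  values on \<open>P2\<close> matter.\<close>

definition proper_P2 :: "('a::euclidean_space measure \<Rightarrow> ereal) \<Rightarrow> bool" where
  "proper_P2 G \<longleftrightarrow> (\<forall>\<mu>\<in>P2. G \<mu> \<noteq> -\<infinity>) \<and> (\<exists>\<mu>\<in>P2. G \<mu> \<noteq> \<infinity>)"

definition lsc_W2 :: "('a::euclidean_space measure \<Rightarrow> ereal) \<Rightarrow> bool" where
  "lsc_W2 G \<longleftrightarrow> (\<forall>\<mu>\<in>P2. \<forall>a < G \<mu>. \<exists>\<delta>>0. \<forall>\<nu>\<in>P2. W 2 \<nu> \<mu> < \<delta> \<longrightarrow> a < G \<nu>)"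

definition convex_along_generalized_geodesics ::
  "('a::euclidean_space measure \<Rightarrow> ereal) \<Rightarrow> bool" where
  "convex_along_generalized_geodesics G \<longleftrightarrow>
     (\<forall>\<mu>0\<in>P2. \<forall>\<mu>1\<in>P2. \<forall>\<nu>\<in>P2. \<exists>c. generalized_geodesic \<nu> \<mu>0 \<mu>1 c \<and>
        (\<forall>s\<in>{0..1}. G (c s) \<le> ereal (1 - s) * G \<mu>0 + ereal s * G \<mu>1))"

definition argmin_P2 :: "('a::euclidean_space measure \<Rightarrow> ereal) \<Rightarrow> 'a measure set" where
  "argmin_P2 G = {\<mu>. is_arg_min G (\<lambda>\<nu>. \<nu> \<in> P2) \<mu>}"

definition prox :: "('a::euclidean_space measure \<Rightarrow> ereal) \<Rightarrow> real \<Rightarrow> 'a measure \<Rightarrow> 'a measure" where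
  "prox G \<tau> \<mu> = (THE \<nu>. \<nu> \<in> argmin_P2 (\<lambda>\<nu>. G \<nu> + ereal (1 / (2 * \<tau>) * (W 2 \<nu> \<mu>)\<^sup>2)))"

definition C2w :: "('a::euclidean_space \<Rightarrow> real) set" where
  "C2w = {f. continuous_on UNIV f \<and> ((\<lambda>x. f x / (1 + (norm x)\<^sup>2)) \<longlongrightarrow> 0) at_infinity}"

text \<open>The weak-* topology of the dual of \<open>C2w\<close>, restricted to \<open>P2\<close>: the initial topology of
  the evaluations \<open>\<mu> \<mapsto> \<integral>f d\<mu>\<close> with \<open>f\<close> ranging over \<open>C2w\<close>.\<close>

definition tau_w2 :: "'a::euclidean_space measure topology" where
  "tau_w2 = pullback_topology P2 (\<lambda>\<mu>. \<lambda>f\<in>C2w. integral\<^sup>L \<mu> f)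
     (product_topology (\<lambda>_. euclideanreal) C2w)"

lemma limitin_tau_w2_iff:
  fixes \<mu> :: "nat \<Rightarrow> 'a::euclidean_space measure"
  assumes "\<And>n. \<mu> n \<in> P2"
  shows "limitin tau_w2 \<mu> \<nu> sequentially \<longleftrightarrow>
    \<nu> \<in> P2 \<and> (\<forall>f\<in>C2w. (\<lambda>n. integral\<^sup>L (\<mu> n) f) \<longlonglongrightarrow> integral\<^sup>L \<nu> f)"
proof -
  let ?e = "\<lambda>\<mu> :: 'a measure. \<lambda>f\<in>C2w. integral\<^sup>L \<mu> f"
  let ?T = "product_topology (\<lambda>_. euclideanreal) (C2w :: ('a \<Rightarrow> real) set)"
  have "limitin tau_w2 \<mu> \<nu> sequentially \<longleftrightarrow> \<nu> \<in> P2 \<and> limitin ?T (\<lambda>n. ?e (\<mu> n)) (?e \<nu>) sequentially"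
  proof
    assume L: "limitin tau_w2 \<mu> \<nu> sequentially"
    then have P: "\<nu> \<in> P2"
      by (auto dest: limitin_topspace simp: tau_w2_def topspace_pullback_topology)
    moreover have "limitin ?T (\<lambda>n. ?e (\<mu> n)) (?e \<nu>) sequentially"
      unfolding limitin_def
    proof (intro conjI allI impI)
      show "?e \<nu> \<in> topspace ?T" by simp
      fix U assume U: "openin ?T U \<and> ?e \<nu> \<in> U"
      then have "openin tau_w2 (?e -` U \<inter> P2)"
        unfolding tau_w2_def openin_pullback_topology by blast
      moreover have "\<nu> \<in> ?e -` U \<inter> P2" using U P by blast
      ultimately have "\<forall>\<^sub>F n in sequentially. \<mu> n \<in> ?e -` U \<inter> P2"
        using L unfolding limitin_def by blast
      then show "\<forall>\<^sub>F n in sequentially. ?e (\<mu> n) \<in> U"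
        by (rule eventually_mono) blast
    qed
    ultimately show "\<nu> \<in> P2 \<and> limitin ?T (\<lambda>n. ?e (\<mu> n)) (?e \<nu>) sequentially" by blast
  next
    assume R: "\<nu> \<in> P2 \<and> limitin ?T (\<lambda>n. ?e (\<mu> n)) (?e \<nu>) sequentially"
    show "limitin tau_w2 \<mu> \<nu> sequentially"
      unfolding limitin_def
    proof (intro conjI allI impI)
      show "\<nu> \<in> topspace tau_w2"
        using R by (simp add: tau_w2_def topspace_pullback_topology)
      fix V assume V: "openin tau_w2 V \<and> \<nu> \<in> V"
      then obtain U where U: "openin ?T U" "V = ?e -` U \<inter> P2"
        unfolding tau_w2_def openin_pullback_topology by blast
      then have "\<forall>\<^sub>F n in sequentially. ?e (\<mu> n) \<in> U"
        using R V unfolding limitin_def by blast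
      then show "\<forall>\<^sub>F n in sequentially. \<mu> n \<in> V"
        by (rule eventually_mono) (use U assms in blast)
    qed
  qed
  also have "\<dots> \<longleftrightarrow> \<nu> \<in> P2 \<and> (\<forall>f\<in>C2w. (\<lambda>n. integral\<^sup>L (\<mu> n) f) \<longlonglongrightarrow> integral\<^sup>L \<nu> f)"
    by (simp add: limitin_componentwise)
  finally show ?thesis .
qed

text \<open>Finiteness is required separately because \<open>real_of_ereal \<infinity> = 0\<close>.\<close>

definition ereal_bigo :: "(nat \<Rightarrow> ereal) \<Rightarrow> (nat \<Rightarrow> real) \<Rightarrow> bool" where
  "ereal_bigo f g \<longleftrightarrow>
     (\<forall>\<^sub>F n in sequentially. \<bar>f n\<bar> \<noteq> \<infinity>) \<and> (\<lambda>n. real_of_ereal (f n)) \<in> O(g)"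

end

(* The proof follows the Hilbert space argument. Comparing J(mu) with the points of a generalized
   geodesic based at mu gives the variational inequality
     W(J mu, nu)^2 <= W(mu, nu)^2 - W(J mu, mu)^2 - 2 tau (G(J mu) - G(nu)),
   whose sum along the iteration (nu a minimizer) yields both rates, while nu = J(mu_n) shows that
   the values are almost decreasing. The distances from mu_n to any minimizer converge, and Opial's
   property of W_2 then leaves room for one cluster point only.
   The triangle inequality for W_2 needs no gluing lemma: the three-plan behind a generalized
   geodesic already joins two optimal plans. Narrow compactness in R^d is reduced to Helly's and
   Skorokhod's theorems on the line by a Borel coding of R^d. *)

theory Submission
  imports Defs
begin

text \<open>Along a narrowly convergent subsequence second moments may escape to infinity, so the
  W_2 distance to a cluster point need not tend to 0, and G is lower semicontinuous only for W_2.
  What does pass to the limit is an integral of inner products against a partner whose law is fixed.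
  This is why differences of squared distances are used: the uncontrolled moment of
  \<open>\<mu> n\<close> cancels in them. Limits are taken on samples. A convergent subsequence is a
  family of random variables on one probability space that converges almost surely, so that most
  limit statements reduce to Fatou's lemma, with a small multiple of the squared norm added where
  the integrand has no sign. Applied to plans on the product space, the same representation provides
  limits of optimal plans. Convexity along generalized geodesics has a second role: such geodesics
  contain optimal plans. The existence of these plans, the metric properties of W_2 and, through
  minimizing sequences that are Cauchy, the resolvents are all drawn from it.\<close>

section \<open>Almost surely convergent representations of subsequences\<close>

text \<open>Base 4 with the digits 0 and 1 separates codes with different first digits, so that the
  digits are continuous functions of the code.\<close>

definition bin_code :: "(nat \<Rightarrow> bool) \<Rightarrow> real" where
  "bin_code b = (\<Sum>k. of_bool (b k) * (1/4) ^ k)"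

lemma summable_bin_code: "summable (\<lambda>k. of_bool (b k) * (1/4::real) ^ k)"
  by (rule summable_comparison_test'[of "\<lambda>k. (1/4::real)^k" 0]) (auto intro: summable_geometric)

lemma bin_code_nonneg: "0 \<le> bin_code b"
  unfolding bin_code_def by (rule suminf_nonneg[OF summable_bin_code]) auto

lemma bin_code_le: "bin_code b \<le> 4/3"
proof -
  have "bin_code b \<le> (\<Sum>k. (1/4::real)^k)"
    unfolding bin_code_def
    by (rule suminf_le[OF _ summable_bin_code]) (auto intro: summable_geometric)
  also have "\<dots> = 4/3" by (subst suminf_geometric) auto
  finally show ?thesis .
qed

text \<open>Stripping the leading digit and multiplying by 4 maps codes to codes. This
  self-similarity reduces every statement about a later digit to one about the first.\<close>

lemma bin_code_shift: "bin_code b = of_bool (b 0) + bin_code (\<lambda>k. b (Suc k)) / 4"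
proof -
  define f where "f k = of_bool (b k) * (1/4::real) ^ k" for k
  have f: "summable f" unfolding f_def by (rule summable_bin_code)
  have "bin_code b = f 0 + (\<Sum>k. f (Suc k))"
    unfolding bin_code_def f_def[symmetric] suminf_split_head[OF f] by simp
  also have "(\<lambda>k. f (Suc k)) = (\<lambda>k. (1/4) * (of_bool (b (Suc k)) * (1/4) ^ k))"
    unfolding f_def by (rule ext) (simp only: power_Suc mult.left_commute)
  also have "(\<Sum>k. (1/4) * (of_bool (b (Suc k)) * (1/4::real) ^ k)) = (1/4) * bin_code (\<lambda>k. b (Suc k))"
    unfolding bin_code_def by (rule suminf_mult[OF summable_bin_code])
  also have "f 0 = of_bool (b 0)" unfolding f_def by simp
  finally show ?thesis by simp
qed

text \<open>The digits after the first contribute at most (4/3)/4 = 1/3. Codes therefore lie in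
  [0, 1/3] or in [1, 4/3], according to the first digit.\<close>

lemma bin_code_ge_1_iff: "1 \<le> bin_code b \<longleftrightarrow> b 0"
  using bin_code_shift[of b] bin_code_nonneg[of "\<lambda>k. b (Suc k)"] bin_code_le[of "\<lambda>k. b (Suc k)"]
  by (cases "b 0") auto

text \<open>Iterates of the expanding map that strips the leading digit. It acts on all reals, not
  only on codes, so that each digit is a Borel function of a real variable.\<close>

primrec bin_rest :: "real \<Rightarrow> nat \<Rightarrow> real" where
  "bin_rest t 0 = t"
| "bin_rest t (Suc k) = 4 * (bin_rest t k - of_bool (1 \<le> bin_rest t k))"

lemma bin_rest_code: "bin_rest (bin_code b) k = bin_code (\<lambda>i. b (i + k))"
proof (induction k)
  case (Suc k)
  have "bin_code (\<lambda>i. b (i + k)) = of_bool (b k) + bin_code (\<lambda>i. b (i + Suc k)) / 4"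
    using bin_code_shift[of "\<lambda>i. b (i + k)"] by simp
  moreover have "1 \<le> bin_code (\<lambda>i. b (i + k)) \<longleftrightarrow> b k"
    using bin_code_ge_1_iff[of "\<lambda>i. b (i + k)"] by simp
  ultimately show ?case by (simp add: Suc.IH)
qed simp

lemma bin_digit_code: "1 \<le> bin_rest (bin_code b) k \<longleftrightarrow> b k"
  by (simp add: bin_rest_code bin_code_ge_1_iff)

lemma borel_measurable_bin_rest [measurable]: "(\<lambda>t. bin_rest t k) \<in> borel_measurable borel"
  by (induction k) (simp_all, measurable)

lemma borel_measurable_bin_code:
  assumes "\<And>k. Measurable.pred M (\<lambda>x. b x k)"
  shows "(\<lambda>x. bin_code (b x)) \<in> borel_measurable M"
  unfolding bin_code_def
proof (rule borel_measurable_suminf)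
  fix k
  have "(\<lambda>x. if b x k then (1/4) ^ k else (0::real)) \<in> borel_measurable M"
    by (rule measurable_If) (use assms[of k] in \<open>auto simp: pred_def\<close>)
  then show "(\<lambda>x. of_bool (b x k) * (1/4::real) ^ k) \<in> borel_measurable M"
    by (rule measurable_cong[THEN iffD1, rotated]) simp
qed

text \<open>The limit y is not presumed to be a code. Since no code lies strictly between 1/3 and 1,
  a convergent sequence of codes eventually stays on one side of this gap; 1/2 is an arbitrary
  threshold inside it.\<close>

lemma bin_code_convergent_first_digit:
  assumes "(\<lambda>n. bin_code (b n)) \<longlonglongrightarrow> y"
  obtains c where "\<forall>\<^sub>F n in sequentially. b n 0 = c"
proof (cases "y < 1")
  case True
  then have "\<forall>\<^sub>F n in sequentially. bin_code (b n) < 1"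
    using assms order_tendstoD(2) by blast
  then have "\<forall>\<^sub>F n in sequentially. b n 0 = False"
    by (rule eventually_mono) (simp add: bin_code_ge_1_iff[symmetric])
  then show ?thesis by (rule that)
next
  case False
  then have "\<forall>\<^sub>F n in sequentially. bin_code (b n) > 1/2"
    using assms order_tendstoD(1)[of _ y sequentially "1/2"] by auto
  then have "\<forall>\<^sub>F n in sequentially. b n 0 = True"
  proof (rule eventually_mono)
    fix n assume "1/2 < bin_code (b n)"
    then show "b n 0 = True"
      using bin_code_shift[of "b n"] bin_code_le[of "\<lambda>k. b n (Suc k)"] by (cases "b n 0") auto
  qed
  then show ?thesis by (rule that)
qed

text \<open>Once the first digit has stabilized, the rescaled remainders are again convergent codes;
  hence the induction runs over all sequences and limits.\<close>

lemma bin_code_convergent_digits: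
  assumes "(\<lambda>n. bin_code (b n)) \<longlonglongrightarrow> y"
  shows "\<exists>c. \<forall>\<^sub>F n in sequentially. b n k = c"
  using assms
proof (induction k arbitrary: b y)
  case (0 b y)
  then show ?case using bin_code_convergent_first_digit by blast
next
  case (Suc k b y)
  obtain c where c: "\<forall>\<^sub>F n in sequentially. b n 0 = c"
    using bin_code_convergent_first_digit[OF Suc.prems] by blast
  have "\<forall>\<^sub>F n in sequentially. 4 * (bin_code (b n) - of_bool c) = bin_code (\<lambda>k. b n (Suc k))"
    using c
  proof (rule eventually_mono)
    fix n assume "b n 0 = c"
    then show "4 * (bin_code (b n) - of_bool c) = bin_code (\<lambda>k. b n (Suc k))"
      using bin_code_shift[of "b n"] by simp
  qed
  moreover have "(\<lambda>n. 4 * (bin_code (b n) - of_bool c)) \<longlonglongrightarrow> 4 * (y - of_bool c)"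
    by (intro tendsto_intros Suc.prems)
  ultimately have "(\<lambda>n. bin_code (\<lambda>k. b n (Suc k))) \<longlonglongrightarrow> 4 * (y - of_bool c)"
    by (rule Lim_transform_eventually[rotated])
  then show ?case by (rule Suc.IH)
qed

section \<open>Coding points of R^d by rational half spaces\<close>

lemma Sup_of_lower_rationals: "(SUP q\<in>\<rat>. if y \<le> q then -\<infinity> else ereal q) = ereal y"
proof (rule SUP_eqI)
  fix z assume z: "\<And>q. q \<in> \<rat> \<Longrightarrow> (if y \<le> q then -\<infinity> else ereal q) \<le> z"
  show "ereal y \<le> z"
  proof (rule dense_le)
    fix w assume "w < ereal y"
    then obtain q where "w < ereal (of_rat q)" "ereal (of_rat q) < ereal y"
      using ereal_dense3 by blast
    then show "w \<le> z" using z[of "of_rat q"] by auto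
  qed
qed auto

text \<open>The code of \<open>x\<close> records which of the countably many half spaces \<open>x \<bullet> i \<le> q\<close> contain \<open>x\<close>.\<close>

definition space_idx :: "'a::euclidean_space \<Rightarrow> real \<Rightarrow> nat" where
  "space_idx i q = to_nat_on ((Basis :: 'a set) \<times> \<rat>) (i, q)"

definition space_bits :: "'a::euclidean_space \<Rightarrow> nat \<Rightarrow> bool" where
  "space_bits x k = (case from_nat_into ((Basis :: 'a set) \<times> \<rat>) k of (i, q) \<Rightarrow> x \<bullet> i \<le> q)"

text \<open>A coordinate is the supremum of the rationals below it, so it can be read off the digits
  by a countable supremum, which is Borel. Taken in \<open>ereal\<close>, the supremum gives the
  other rationals the neutral value -\<infinity> and exists for every real t; where it is infinite,
  off the codes, \<open>real_of_ereal\<close> returns 0.\<close>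

definition space_decode :: "real \<Rightarrow> 'a::euclidean_space" where
  "space_decode t = (\<Sum>i\<in>Basis. real_of_ereal
     (SUP q\<in>\<rat>. if 1 \<le> bin_rest t (space_idx i q) then -\<infinity> else ereal q) *\<^sub>R i)"

lemma space_bits_idx: 
  assumes "i \<in> Basis" "q \<in> \<rat>"
  shows "space_bits x (space_idx i q) \<longleftrightarrow> x \<bullet> i \<le> q"
proof -
  have "countable ((Basis :: 'a set) \<times> (\<rat> :: real set))" 
    by (simp add: countable_rat countable_finite)
  then show ?thesis using assms unfolding space_bits_def space_idx_def by simp
qed

lemma space_decode_code: "space_decode (bin_code (space_bits x)) = x"
proof -
  have "space_decode (bin_code (space_bits x)) = (\<Sum>i\<in>Basis. (x \<bullet> i) *\<^sub>R i)"
    unfolding space_decode_def bin_digit_code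
  proof (rule sum.cong)
    fix i :: 'a assume i: "i \<in> Basis"
    have "(SUP q\<in>\<rat>. if space_bits x (space_idx i q) then -\<infinity> else ereal q) = ereal (x \<bullet> i)"
      using Sup_of_lower_rationals[of "x \<bullet> i"] space_bits_idx[OF i] by (simp cong: SUP_cong)
    then show "real_of_ereal (SUP q\<in>\<rat>. if space_bits x (space_idx i q) then -\<infinity> else ereal q) *\<^sub>R i
        = (x \<bullet> i) *\<^sub>R i" by simp
  qed simp
  then show ?thesis by (simp add: euclidean_representation)
qed

lemma borel_measurable_space_decode [measurable]: "space_decode \<in> borel_measurable borel"
proof -
  have "(\<lambda>t. SUP q\<in>\<rat>. if 1 \<le> bin_rest t (space_idx i q) then -\<infinity> else ereal q)
      \<in> borel_measurable borel" for i :: 'a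
    by (rule borel_measurable_SUP) (auto simp: countable_rat)
  then show ?thesis unfolding space_decode_def[abs_def] by measurable
qed

lemma borel_measurable_bin_code_space_bits [measurable]:
  "(\<lambda>x :: 'a::euclidean_space. bin_code (space_bits x)) \<in> borel_measurable borel"
  by (rule borel_measurable_bin_code) (simp add: space_bits_def split: prod.split)

text \<open>Convergence of the codes makes the truth value of each
  \<open>x n \<bullet> i \<le> q\<close> eventually constant, and the limit p of a bounded
  subsequence decides this constant when q differs from \<open>p \<bullet> i\<close>. Rationals on
  both sides of \<open>p \<bullet> i\<close> then trap the whole sequence. The bounded subsequence
  rules out an escape to infinity; t itself may differ from the code of p, because the code is
  discontinuous.\<close>

lemma space_code_convergent:
  fixes x :: "nat \<Rightarrow> 'a::euclidean_space"
  assumes conv: "(\<lambda>n. bin_code (space_bits (x n))) \<longlonglongrightarrow> t"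
    and r: "strict_mono (r :: nat \<Rightarrow> nat)" and bdd: "bounded (range (x \<circ> r))"
  shows "convergent x"
proof -
  obtain p s where s: "strict_mono s" and p: "(x \<circ> r \<circ> s) \<longlonglongrightarrow> p"
    using bounded_imp_convergent_subsequence[OF bdd] by blast
  have rs: "strict_mono (r \<circ> s)" using r s by (rule strict_mono_o)
  \<comment> \<open>A digit that is eventually constant has on the whole sequence the value seen
    along the subsequence.\<close>
  have bits: "\<forall>\<^sub>F n in sequentially. P (x n \<bullet> i \<le> q)"
    if i: "i \<in> Basis" and q: "q \<in> \<rat>" and P: "\<forall>\<^sub>F n in sequentially. P (x (r (s n)) \<bullet> i \<le> q)" 
    for P :: "bool \<Rightarrow> bool" and i :: 'a and q
  proof -
    obtain c where c: "\<forall>\<^sub>F n in sequentially. (x n \<bullet> i \<le> q) = c"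
      using bin_code_convergent_digits[OF conv, of "space_idx i q"] 
      by (auto simp: space_bits_idx[OF i q])
    have "\<forall>\<^sub>F n in sequentially. (x (r (s n)) \<bullet> i \<le> q) = c"
      using eventually_subseq[OF rs c] by simp
    then have "\<forall>\<^sub>F n::nat in sequentially. P c" using P by eventually_elim auto
    then have "P c" by simp
    with c show ?thesis by (auto elim: eventually_mono)
  qed
  have "(\<lambda>n. x n \<bullet> i) \<longlonglongrightarrow> p \<bullet> i" if i: "i \<in> Basis" for i :: 'a
  proof (rule order_tendstoI)
    have pi: "(\<lambda>n. x (r (s n)) \<bullet> i) \<longlonglongrightarrow> p \<bullet> i" 
      using p by (intro tendsto_intros) (simp add: o_def)
    show "\<forall>\<^sub>F n in sequentially. a < x n \<bullet> i" if "a < p \<bullet> i" for a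
    proof -
      obtain q where q: "q \<in> \<rat>" "a < q" "q < p \<bullet> i" using Rats_dense_in_real[of a "p \<bullet> i"] \<open>a < p \<bullet> i\<close> by blast
      have "\<forall>\<^sub>F n in sequentially. \<not> x n \<bullet> i \<le> q"
        using order_tendstoD(1)[OF pi q(3)] by (intro bits[OF i q(1)]) (auto elim: eventually_mono)
      then show ?thesis by eventually_elim (use q in auto)
    qed
    show "\<forall>\<^sub>F n in sequentially. x n \<bullet> i < a" if "p \<bullet> i < a" for a
    proof -
      obtain q where q: "q \<in> \<rat>" "p \<bullet> i < q" "q < a" using Rats_dense_in_real[of "p \<bullet> i" a] \<open>p \<bullet> i < a\<close> by blast
      have "\<forall>\<^sub>F n in sequentially. x n \<bullet> i \<le> q"
        using order_tendstoD(2)[OF pi q(2)] 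
        by (intro bits[OF i q(1), of "\<lambda>b. b"]) (auto elim: eventually_mono)
      then show ?thesis by eventually_elim (use q in auto)
    qed
  qed
  then have "x \<longlonglongrightarrow> p"
    by (rule tendsto_componentwise_iff[THEN iffD2, OF ballI])
  then show ?thesis by (auto simp: convergent_def)
qed

section \<open>Representations by random variables and narrow compactness\<close>

lemma liminf_finite_bounded_subseq:
  fixes x :: "nat \<Rightarrow> 'a::real_normed_vector"
  assumes "liminf (\<lambda>n. ennreal ((norm (x n))\<^sup>2)) < \<infinity>"
  shows "\<exists>r :: nat \<Rightarrow> nat. strict_mono r \<and> bounded (range (x \<circ> r))"
proof -
  obtain c where c: "liminf (\<lambda>n. ennreal ((norm (x n))\<^sup>2)) < ennreal c"
  proof -
    obtain c where c: "liminf (\<lambda>n. ennreal ((norm (x n))\<^sup>2)) < c" "c < \<infinity>"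
      using dense[OF assms] by blast
    from c(2) have "ennreal (enn2real c) = c" by (intro ennreal_enn2real) (simp only: infinity_ennreal_def)
    with c(1) show ?thesis by (intro that[of "enn2real c"]) (simp only:)
  qed
  have "\<not> (\<forall>\<^sub>F n in sequentially. ennreal c \<le> ennreal ((norm (x n))\<^sup>2))"
    using c Liminf_bounded[of "ennreal c" "\<lambda>n. ennreal ((norm (x n))\<^sup>2)" sequentially] by (auto simp: not_le[symmetric])
  then obtain r :: "nat \<Rightarrow> nat" where r: "strict_mono r"
    "\<And>n. \<not> ennreal c \<le> ennreal ((norm (x (r n)))\<^sup>2)"
    using not_eventually_sequentiallyD[of "\<lambda>n. ennreal c \<le> ennreal ((norm (x n))\<^sup>2)"] by auto
  have "bounded (range (x \<circ> r))"
    unfolding bounded_iff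
  proof (intro exI ballI)
    fix y assume "y \<in> range (x \<circ> r)"
    then obtain n where n: "y = x (r n)" by auto
    have "(norm y)\<^sup>2 \<le> c"
      using r(2)[of n] n ennreal_leI[of c "(norm y)\<^sup>2"] by (cases "(norm y)\<^sup>2 \<le> c") auto
    then show "norm y \<le> sqrt c" by (rule real_le_rsqrt)
  qed
  with r(1) show ?thesis by (intro exI[of _ r] conjI)
qed

text \<open>Skorokhod's form of narrow convergence: the laws are realized by almost surely
  convergent variables on one probability space. Subsequences and continuous images keep this form,
  and limits of integrals become statements about samples.\<close>

definition as_conv_rep ::
  "'b measure \<Rightarrow> (nat \<Rightarrow> 'b \<Rightarrow> 'a::euclidean_space) \<Rightarrow> ('b \<Rightarrow> 'a) \<Rightarrow> (nat \<Rightarrow> 'a measure) \<Rightarrow> 'a measure \<Rightarrow> bool"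
where
  "as_conv_rep \<Omega> X Y \<mu> \<nu> \<longleftrightarrow> prob_space \<Omega> \<and> (\<forall>n. X n \<in> borel_measurable \<Omega>) \<and> Y \<in> borel_measurable \<Omega> \<and>
     (\<forall>n. distr \<Omega> borel (X n) = \<mu> n) \<and> distr \<Omega> borel Y = \<nu> \<and> (AE \<omega> in \<Omega>. (\<lambda>n. X n \<omega>) \<longlonglongrightarrow> Y \<omega>)"

lemma real_subseq_representation:
  fixes \<nu> :: "nat \<Rightarrow> real measure"
  assumes dist: "\<And>n. real_distribution (\<nu> n)" and supp: "\<And>n. measure (\<nu> n) {a<..b} = 1" and "a < b"
  shows "\<exists>r \<Omega> Y Z M. strict_mono r \<and> as_conv_rep (\<Omega> :: real measure) Y Z (\<lambda>n. \<nu> (r n)) M"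
proof -
  have "tight \<nu>"
    unfolding tight_def
  proof (intro conjI allI impI)
    fix \<epsilon> :: real assume "0 < \<epsilon>"
    then have "a < b \<and> (\<forall>n. 1 - \<epsilon> < measure (\<nu> n) {a<..b})"
      using \<open>a < b\<close> by (simp add: supp)
    then show "\<exists>a b. a < b \<and> (\<forall>n. 1 - \<epsilon> < measure (\<nu> n) {a<..b})" by blast
  qed (rule dist)
  then obtain r M where r: "strict_mono r" and M: "real_distribution M"
    and conv: "weak_conv_m (\<nu> \<circ> id \<circ> r) M"
    using tight_imp_convergent_subsubsequence[of \<nu> id] strict_mono_id by blast
  obtain \<Omega> :: "real measure" and Y Z where *: "prob_space \<Omega>" "\<forall>n. Y n \<in> borel_measurable \<Omega>"
      "\<forall>n. distr \<Omega> borel (Y n) = \<nu> (r n)" "Z \<in> borel_measurable \<Omega>" "distr \<Omega> borel Z = M"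
      "\<forall>\<omega>\<in>space \<Omega>. (\<lambda>n. Y n \<omega>) \<longlonglongrightarrow> Z \<omega>"
    using Skorohod[of "\<nu> \<circ> id \<circ> r" M] dist M conv
    unfolding measurable_lborel1 o_def id_def by blast
  then have "as_conv_rep \<Omega> Y Z (\<lambda>n. \<nu> (r n)) M"
    unfolding as_conv_rep_def using AE_I2 by blast
  with r show ?thesis by blast
qed

text \<open>Prokhorov's and Skorokhod's theorems at once: the laws are transported to the line by the
  code, and Fatou's lemma provides a bounded subsequence of almost every sequence of samples.\<close>

lemma bounded_moment_subseq_representation:
  fixes \<mu> :: "nat \<Rightarrow> 'a::euclidean_space measure"
  assumes sets: "\<And>n. sets (\<mu> n) = sets borel" and prob: "\<And>n. prob_space (\<mu> n)"
    and bound: "\<And>n. (\<integral>\<^sup>+x. ennreal ((norm x)\<^sup>2) \<partial>\<mu> n) \<le> ennreal C"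
  shows "\<exists>r \<Omega> X Y \<nu>. strict_mono r \<and> as_conv_rep (\<Omega> :: real measure) X Y (\<lambda>n. \<mu> (r n)) \<nu>"
proof -
  define s where "s x = bin_code (space_bits x)" for x :: 'a
  have s_meas [measurable]: "s \<in> borel_measurable borel"
    unfolding s_def by measurable
  have [measurable_cong]: "sets (\<mu> n) = sets borel" for n by (rule sets)
  have "real_distribution (distr (\<mu> n) borel s)" for n
    using prob_space.real_distribution_distr[OF prob] by simp
  \<comment> \<open>The interval is open on the left and a code can be 0, so its left end has to be
    negative.\<close>
  moreover have "measure (distr (\<mu> n) borel s) {-1<..2} = 1" for n
  proof -
    have "s -` {-1<..2} \<inter> space (\<mu> n) = space (\<mu> n)"
    proof -
      have "-1 < s x \<and> s x \<le> 2" for x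
        using bin_code_nonneg[of "space_bits x"] bin_code_le[of "space_bits x"] by (simp add: s_def)
      then show ?thesis by auto
    qed
    then show ?thesis by (simp add: measure_distr prob_space.prob_space[OF prob])
  qed
  ultimately obtain r \<Omega> Y Z M where r: "strict_mono r"
    and rep: "as_conv_rep (\<Omega> :: real measure) Y Z (\<lambda>n. distr (\<mu> (r n)) borel s) M"
    using real_subseq_representation[of "\<lambda>n. distr (\<mu> n) borel s" "-1" 2] by auto
  interpret prob_space \<Omega> using rep by (simp add: as_conv_rep_def)
  have [measurable]: "Y n \<in> borel_measurable \<Omega>" for n
    using rep by (simp add: as_conv_rep_def)
  have dY: "distr \<Omega> borel (Y n) = distr (\<mu> (r n)) borel s" for n
    using rep by (simp add: as_conv_rep_def)
  define X :: "nat \<Rightarrow> real \<Rightarrow> 'a" where "X n \<omega> = space_decode (Y n \<omega>)" for n \<omega>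
  have X_meas [measurable]: "X n \<in> borel_measurable \<Omega>" for n
    unfolding X_def by measurable
  have decode: "space_decode (s x) = x" for x :: 'a
    by (simp add: s_def space_decode_code)
  have dX: "distr \<Omega> borel (X n) = \<mu> (r n)" for n
  proof -
    have "distr \<Omega> borel (X n) = distr (distr \<Omega> borel (Y n)) borel space_decode"
      by (subst distr_distr) (auto simp: X_def[abs_def] o_def)
    also have "\<dots> = distr (\<mu> (r n)) borel (\<lambda>x. x)"
      unfolding dY by (subst distr_distr) (auto simp: o_def decode)
    also have "\<dots> = \<mu> (r n)" by (intro distr_id2) (simp add: sets)
    finally show ?thesis .
  qed
  \<comment> \<open>\<open>Y n\<close> has the law of a code, so almost surely it lies in the range
    of s, where decoding and encoding again changes nothing. The convergence of \<open>Y n\<close>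
    is thereby one of the codes of the samples \<open>X n\<close>.\<close>
  have "AE \<omega> in \<Omega>. s (X n \<omega>) = Y n \<omega>" for n
  proof -
    have "AE t in distr (\<mu> (r n)) borel s. s (space_decode t) = t"
      by (subst AE_distr_iff) (auto simp: decode)
    then have "AE t in distr \<Omega> borel (Y n). s (space_decode t) = t" unfolding dY .
    then show ?thesis by (subst (asm) AE_distr_iff) (auto simp: X_def)
  qed
  then have codes: "AE \<omega> in \<Omega>. \<forall>n. s (X n \<omega>) = Y n \<omega>" by (simp add: AE_all_countable)
  have moment: "(\<integral>\<^sup>+\<omega>. ennreal ((norm (X n \<omega>))\<^sup>2) \<partial>\<Omega>) = (\<integral>\<^sup>+x. ennreal ((norm x)\<^sup>2) \<partial>\<mu> (r n))" for n
    by (subst dX[symmetric], subst nn_integral_distr) auto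
  have "(\<integral>\<^sup>+\<omega>. liminf (\<lambda>n. ennreal ((norm (X n \<omega>))\<^sup>2)) \<partial>\<Omega>)
      \<le> liminf (\<lambda>n. \<integral>\<^sup>+\<omega>. ennreal ((norm (X n \<omega>))\<^sup>2) \<partial>\<Omega>)"
    by (rule nn_integral_liminf) simp
  also have "\<dots> \<le> liminf (\<lambda>n::nat. ennreal C)"
    unfolding moment by (intro Liminf_mono always_eventually allI bound)
  also have "\<dots> < \<infinity>" by (simp add: Liminf_const)
  finally have "AE \<omega> in \<Omega>. liminf (\<lambda>n. ennreal ((norm (X n \<omega>))\<^sup>2)) \<noteq> \<infinity>"
    by (intro nn_integral_noteq_infinite) auto
  moreover have "AE \<omega> in \<Omega>. (\<lambda>n. Y n \<omega>) \<longlonglongrightarrow> Z \<omega>"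
    using rep by (simp add: as_conv_rep_def)
  ultimately have "AE \<omega> in \<Omega>. convergent (\<lambda>n. X n \<omega>)"
    using codes
  proof eventually_elim
    case (elim \<omega>)
    obtain r' :: "nat \<Rightarrow> nat" where r': "strict_mono r'" "bounded (range ((\<lambda>n. X n \<omega>) \<circ> r'))"
      using liminf_finite_bounded_subseq[of "\<lambda>n. X n \<omega>"] elim(1) 
      by (auto simp: less_top[symmetric])
    have "(\<lambda>n. bin_code (space_bits (X n \<omega>))) \<longlonglongrightarrow> Z \<omega>" using elim by (simp add: s_def)
    then show ?case using r' by (rule space_code_convergent)
  qed
  then have "AE \<omega> in \<Omega>. (\<lambda>n. X n \<omega>) \<longlonglongrightarrow> lim (\<lambda>n. X n \<omega>)"
    by eventually_elim (simp add: convergent_LIMSEQ_iff)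
  then have "as_conv_rep \<Omega> X (\<lambda>\<omega>. lim (\<lambda>n. X n \<omega>)) (\<lambda>n. \<mu> (r n)) (distr \<Omega> borel (\<lambda>\<omega>. lim (\<lambda>n. X n \<omega>)))"
    unfolding as_conv_rep_def using dX prob_space_axioms by simp
  with r show ?thesis by blast
qed

section \<open>Uniqueness and stability of represented limits\<close>

lemma prob_eqI_continuous_integrals:
  fixes M N :: "'a::metric_space measure"
  assumes sets: "sets M = sets borel" "sets N = sets borel" and prob: "prob_space M" "prob_space N"
    and eq: "\<And>f :: 'a \<Rightarrow> real. continuous_on UNIV f \<Longrightarrow> (\<And>x. f x \<in> {0..1}) \<Longrightarrow> integral\<^sup>L M f = integral\<^sup>L N f"
  shows "M = N"
proof (rule measure_eqI_generator_eq[where E = "Collect closed" and \<Omega> = UNIV and A = "\<lambda>_. UNIV"])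
  interpret M: prob_space M by fact
  interpret N: prob_space N by fact
  have [measurable_cong]: "sets M = sets borel" "sets N = sets borel" by (fact sets)+
  fix F :: "'a set" assume "F \<in> Collect closed"
  then have F: "closed F" by simp
  show "emeasure M F = emeasure N F"
  proof (cases "F = {}")
    case False
    \<comment> \<open>Closed sets generate the Borel sets and are stable under intersection. The
      continuous functions \<open>f k\<close> decrease to the indicator of F, because a point
      outside F has positive distance to it. The empty set is treated apart since
      \<open>infdist x {} = 0\<close> would make \<open>f k\<close> constantly 1.\<close>
    define f where "f k x = max 0 (1 - real k * infdist x F)" for k x
    have f_cont: "continuous_on UNIV (f k)" for k
      unfolding f_def by (intro continuous_intros)
    have f_meas [measurable]: "f k \<in> borel_measurable borel" for k
      using f_cont by (rule borel_measurable_continuous_onI)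
    have f_01: "f k x \<in> {0..1}" for k x
      by (auto simp: f_def infdist_nonneg)
    have lim: "(\<lambda>k. f k x) \<longlonglongrightarrow> indicator F x" for x
    proof (cases "x \<in> F")
      case True
      then show ?thesis by (simp add: f_def)
    next
      case x: False
      then have pos: "0 < infdist x F"
        using F False in_closed_iff_infdist_zero[of F x] infdist_nonneg[of x F] by auto
      obtain m where "1 / infdist x F < real m" using reals_Archimedean2 by blast
      then have m: "1 < real m * infdist x F" using pos by (simp add: field_simps)
      have "\<forall>\<^sub>F k in sequentially. f k x = indicator F x"
        using eventually_ge_at_top[of m]
      proof (rule eventually_mono)
        fix k assume "m \<le> k"
        then have "real m * infdist x F \<le> real k * infdist x F" using pos by (intro mult_right_mono) auto
        with m x show "f k x = indicator F x" by (simp add: f_def)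
      qed
      then show ?thesis by (rule tendsto_eventually)
    qed
    have F_meas [measurable]: "F \<in> sets borel" using F by simp
    have conv: "(\<lambda>k. integral\<^sup>L K (f k)) \<longlonglongrightarrow> measure K F" if K: "prob_space K" "sets K = sets borel" for K
    proof -
      interpret K: prob_space K by fact
      have [measurable_cong]: "sets K = sets borel" by fact
      have "(\<lambda>k. integral\<^sup>L K (f k)) \<longlonglongrightarrow> (\<integral>x. indicator F x \<partial>K)"
        by (rule integral_dominated_convergence[where w = "\<lambda>_. 1"]) (use f_01 lim in \<open>auto intro!: AE_I2\<close>)
      then show ?thesis using sets_eq_imp_space_eq[OF K(2)] by simp
    qed
    have "measure M F = measure N F"
      using conv[OF prob(1) sets(1)] conv[OF prob(2) sets(2)] 
      unfolding eq[OF f_cont f_01] by (rule LIMSEQ_unique)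
    then show ?thesis by (simp add: M.emeasure_eq_measure N.emeasure_eq_measure)
  qed simp
next
  show "emeasure M UNIV \<noteq> \<infinity>"
    using finite_measure.emeasure_finite[OF prob_space.finite_measure[OF prob(1)]] by simp
qed (auto simp: sets borel_eq_closed Int_stable_def)

lemma as_conv_rep_integral_tendsto:
  fixes f :: "'a::euclidean_space \<Rightarrow> real"
  assumes rep: "as_conv_rep \<Omega> X Y \<mu> \<nu>" and f: "continuous_on UNIV f" "\<And>x. \<bar>f x\<bar> \<le> B"
  shows "(\<lambda>n. integral\<^sup>L (\<mu> n) f) \<longlonglongrightarrow> integral\<^sup>L \<nu> f"
proof -
  interpret prob_space \<Omega> using rep by (simp add: as_conv_rep_def)
  have [measurable]: "X n \<in> borel_measurable \<Omega>" "Y \<in> borel_measurable \<Omega>" for n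
    using rep by (simp_all add: as_conv_rep_def)
  have [measurable]: "f \<in> borel_measurable borel" 
    using f(1) by (rule borel_measurable_continuous_onI)
  have eq: "\<mu> n = distr \<Omega> borel (X n)" "\<nu> = distr \<Omega> borel Y" for n
    using rep by (simp_all add: as_conv_rep_def)
  have "AE \<omega> in \<Omega>. (\<lambda>n. X n \<omega>) \<longlonglongrightarrow> Y \<omega>" using rep by (simp add: as_conv_rep_def)
  then have "AE \<omega> in \<Omega>. (\<lambda>n. f (X n \<omega>)) \<longlonglongrightarrow> f (Y \<omega>)"
    by (rule AE_mp) (use f(1) in \<open>auto intro!: AE_I2 continuous_on_tendsto_compose[of UNIV f]\<close>)
  then have "(\<lambda>n. \<integral>\<omega>. f (X n \<omega>) \<partial>\<Omega>) \<longlonglongrightarrow> (\<integral>\<omega>. f (Y \<omega>) \<partial>\<Omega>)"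
    by (intro integral_dominated_convergence[where w = "\<lambda>_. B"]) (use f(2) in auto)
  then show ?thesis by (simp add: eq integral_distr)
qed

text \<open>The two representations may live on different sample spaces, since integrals of bounded
  continuous functions see only the laws. This identifies the marginals of limits of plans.\<close>

lemma as_conv_rep_limit_unique:
  fixes \<nu> \<nu>' :: "'a::euclidean_space measure"
  assumes 1: "as_conv_rep \<Omega> X Y \<mu> \<nu>" and 2: "as_conv_rep \<Omega>' X' Y' \<mu> \<nu>'"
  shows "\<nu> = \<nu>'"
proof (rule prob_eqI_continuous_integrals)
  show "prob_space \<nu>" "sets \<nu> = sets borel"
    using 1 prob_space.prob_space_distr[of \<Omega> Y borel] sets_distr[of \<Omega> borel Y] by (simp_all add: as_conv_rep_def)
  show "prob_space \<nu>'" "sets \<nu>' = sets borel"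
    using 2 prob_space.prob_space_distr[of \<Omega>' Y' borel] sets_distr[of \<Omega>' borel Y'] by (simp_all add: as_conv_rep_def)
  fix f :: "'a \<Rightarrow> real" assume f: "continuous_on UNIV f" "\<And>x. f x \<in> {0..1}"
  have "\<bar>f x\<bar> \<le> 1" for x using f(2)[of x] by auto
  then show "integral\<^sup>L \<nu> f = integral\<^sup>L \<nu>' f"
    using LIMSEQ_unique[OF as_conv_rep_integral_tendsto[OF 1 f(1)] as_conv_rep_integral_tendsto[OF 2 f(1)]]
    by blast
qed

lemma as_conv_rep_subseq:
  assumes "as_conv_rep \<Omega> X Y \<mu> \<nu>" and r: "strict_mono r"
  shows "as_conv_rep \<Omega> (\<lambda>n. X (r n)) Y (\<lambda>n. \<mu> (r n)) \<nu>"
proof -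
  have "AE \<omega> in \<Omega>. (\<lambda>n. X n \<omega>) \<longlonglongrightarrow> Y \<omega>" using assms by (simp add: as_conv_rep_def)
  then have "AE \<omega> in \<Omega>. (\<lambda>n. X (r n) \<omega>) \<longlonglongrightarrow> Y \<omega>"
  proof eventually_elim
    case (elim \<omega>)
    show ?case using LIMSEQ_subseq_LIMSEQ[OF elim r] by (simp add: o_def)
  qed
  with assms(1) show ?thesis by (simp add: as_conv_rep_def)
qed

lemma as_conv_rep_const:
  assumes "prob_space \<nu>" "sets \<nu> = sets borel"
  shows "as_conv_rep \<nu> (\<lambda>_ x. x) (\<lambda>x. x) (\<lambda>_. \<nu>) \<nu>"
proof -
  have "(\<lambda>x. x) \<in> measurable \<nu> borel" by (simp add: measurable_ident_sets assms)
  moreover have "distr \<nu> borel (\<lambda>x. x) = \<nu>" using assms(2) by (intro distr_id2) simp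
  ultimately show ?thesis unfolding as_conv_rep_def using assms(1) by simp
qed

lemma as_conv_rep_continuous_image:
  fixes g :: "'a::euclidean_space \<Rightarrow> 'b::euclidean_space"
  assumes rep: "as_conv_rep \<Omega> X Y \<mu> \<nu>" and g: "continuous_on UNIV g"
  shows "as_conv_rep \<Omega> (\<lambda>n \<omega>. g (X n \<omega>)) (\<lambda>\<omega>. g (Y \<omega>)) (\<lambda>n. distr (\<mu> n) borel g) (distr \<nu> borel g)"
proof -
  have [measurable]: "X n \<in> borel_measurable \<Omega>" "Y \<in> borel_measurable \<Omega>" for n
    using rep by (simp_all add: as_conv_rep_def)
  have [measurable]: "g \<in> borel_measurable borel" 
    using g by (rule borel_measurable_continuous_onI)
  have eq: "\<mu> n = distr \<Omega> borel (X n)" "\<nu> = distr \<Omega> borel Y" for n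
    using rep by (simp_all add: as_conv_rep_def)
  have "AE \<omega> in \<Omega>. (\<lambda>n. X n \<omega>) \<longlonglongrightarrow> Y \<omega>" using rep by (simp add: as_conv_rep_def)
  then have "AE \<omega> in \<Omega>. (\<lambda>n. g (X n \<omega>)) \<longlonglongrightarrow> g (Y \<omega>)"
    by (rule AE_mp) (use g in \<open>auto intro!: AE_I2 continuous_on_tendsto_compose[of UNIV g]\<close>)
  moreover have "prob_space \<Omega>" using rep by (simp add: as_conv_rep_def)
  ultimately show ?thesis
    unfolding as_conv_rep_def by (simp add: eq distr_distr o_def)
qed

section \<open>Fatou's lemma as an eventual lower bound\<close>

lemma fatou_eventually:
  fixes u :: "nat \<Rightarrow> 'b \<Rightarrow> real"
  assumes int: "\<And>n. integrable M (u n)" "integrable M v"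
    and nonneg: "\<And>n. AE x in M. 0 \<le> u n x" and lim: "AE x in M. (\<lambda>n. u n x) \<longlonglongrightarrow> v x" and "0 < e"
  shows "\<forall>\<^sub>F n in sequentially. integral\<^sup>L M v - e < integral\<^sup>L M (u n)"
\<comment> \<open>A negative bound is trivial and is split off because \<open>ennreal\<close>
  truncates it to 0, where the strict inequality of the other case could fail.\<close>
proof (cases "integral\<^sup>L M v - e < 0")
  case True
  have "0 \<le> integral\<^sup>L M (u n)" for n using nonneg by (rule integral_nonneg_AE)
  with True show ?thesis by (intro always_eventually allI) (rule less_le_trans)
next
  case False
  have [measurable]: "u n \<in> borel_measurable M" for n using int(1) by (rule borel_measurable_integrable)
  have all: "AE x in M. \<forall>n. 0 \<le> u n x" using nonneg by (simp add: AE_all_countable)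
  have v: "AE x in M. 0 \<le> v x"
    using all lim by eventually_elim (auto intro: LIMSEQ_le_const)
  have eqn: "(\<integral>\<^sup>+x. ennreal (u n x) \<partial>M) = ennreal (integral\<^sup>L M (u n))" for n
    by (rule nn_integral_eq_integral[OF int(1) nonneg])
  have "ennreal (integral\<^sup>L M v) = (\<integral>\<^sup>+x. ennreal (v x) \<partial>M)"
    by (rule nn_integral_eq_integral[OF int(2) v, symmetric])
  also have "\<dots> = (\<integral>\<^sup>+x. liminf (\<lambda>n. ennreal (u n x)) \<partial>M)"
  proof (rule nn_integral_cong_AE)
    show "AE x in M. ennreal (v x) = liminf (\<lambda>n. ennreal (u n x))"
      using lim
    proof eventually_elim
      case (elim x)
      show ?case by (rule lim_imp_Liminf[OF sequentially_bot tendsto_ennrealI[OF elim], symmetric])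
    qed
  qed
  also have "\<dots> \<le> liminf (\<lambda>n. \<integral>\<^sup>+x. ennreal (u n x) \<partial>M)" by (rule nn_integral_liminf) simp
  finally have "ennreal (integral\<^sup>L M v) \<le> liminf (\<lambda>n. ennreal (integral\<^sup>L M (u n)))"
    unfolding eqn .
  moreover have "ennreal (integral\<^sup>L M v - e) < ennreal (integral\<^sup>L M v)"
    using False \<open>0 < e\<close> by (intro ennreal_lessI) auto
  ultimately have "\<forall>\<^sub>F n in sequentially. ennreal (integral\<^sup>L M v - e) < ennreal (integral\<^sup>L M (u n))"
    unfolding le_Liminf_iff by blast
  then show ?thesis using False by (auto elim!: eventually_mono simp: ennreal_less_iff)
qed

text \<open>In the applications \<open>h n\<close> is a small multiple of a squared norm plus a constant, and the
  deficit \<open>\<eta>\<close> comes from the mass of that square that escapes in the limit.\<close>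

lemma fatou_eventually_dominated:
  fixes u :: "nat \<Rightarrow> 'b \<Rightarrow> real"
  assumes int: "\<And>n. integrable M (u n)" "integrable M v"
    and lim: "AE x in M. (\<lambda>n. u n x) \<longlonglongrightarrow> v x"
    and dom: "\<And>\<eta>. 0 < \<eta> \<Longrightarrow> \<exists>h k. (\<forall>n. integrable M (h n)) \<and> integrable M k \<and>
      (AE x in M. (\<lambda>n. h n x) \<longlonglongrightarrow> k x) \<and> (\<forall>n. AE x in M. 0 \<le> u n x + h n x) \<and>
      (\<forall>n. integral\<^sup>L M (h n) \<le> integral\<^sup>L M k + \<eta>)"
    and "0 < e"
  shows "\<forall>\<^sub>F n in sequentially. integral\<^sup>L M v - e < integral\<^sup>L M (u n)"
proof -
  \<comment> \<open>One half of e pays for the deficit of h, the other half for Fatou's lemma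
    applied to u + h.\<close>
  obtain h k where h: "\<And>n. integrable M (h n)" "integrable M k" "AE x in M. (\<lambda>n. h n x) \<longlonglongrightarrow> k x"
      "\<And>n. AE x in M. 0 \<le> u n x + h n x" "\<And>n. integral\<^sup>L M (h n) \<le> integral\<^sup>L M k + e / 2"
    using dom[of "e/2"] \<open>0 < e\<close> by auto
  have "AE x in M. (\<lambda>n. u n x + h n x) \<longlonglongrightarrow> v x + k x"
    using lim h(3) by eventually_elim (rule tendsto_add)
  then have "\<forall>\<^sub>F n in sequentially. (\<integral>x. v x + k x \<partial>M) - e / 2 < (\<integral>x. u n x + h n x \<partial>M)"
    using int h(1,2,4) \<open>0 < e\<close> by (intro fatou_eventually) auto
  then show ?thesis
  proof (rule eventually_mono)
    fix n assume "(\<integral>x. v x + k x \<partial>M) - e / 2 < (\<integral>x. u n x + h n x \<partial>M)"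
    then show "integral\<^sup>L M v - e < integral\<^sup>L M (u n)"
      using int h(1,2) h(5)[of n] by simp
  qed
qed

section \<open>The quadratic Wasserstein distance\<close>

lemma norm_diff_sq_le: "(norm (x - y))\<^sup>2 \<le> 2 * (norm x)\<^sup>2 + 2 * (norm (y::'a::real_inner))\<^sup>2"
proof -
  have "0 \<le> (norm (x + y))\<^sup>2" by simp
  then show ?thesis
    by (simp add: power2_norm_eq_inner inner_simps inner_commute)
qed

text \<open>Young's inequality with a free weight. A small l puts little weight on the factor whose
  second moments may fail to converge.\<close>

lemma abs_inner_le_sq: "0 < l \<Longrightarrow> \<bar>x \<bullet> y\<bar> \<le> l * (norm x)\<^sup>2 + (norm (y::'a::real_inner))\<^sup>2 / (4 * l)"
proof -
  assume l: "0 < l"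
  have "\<bar>x \<bullet> y\<bar> \<le> norm x * norm y" by (rule Cauchy_Schwarz_ineq2)
  also have "norm x * norm y \<le> l * (norm x)\<^sup>2 + (norm y)\<^sup>2 / (4 * l)"
  proof -
    have "0 \<le> (2 * l * norm x - norm y)\<^sup>2 / (4 * l)" using l by simp
    also have "\<dots> = l * (norm x)\<^sup>2 + (norm y)\<^sup>2 / (4 * l) - norm x * norm y"
      using l by (simp add: field_simps power2_eq_square)
    finally show ?thesis by simp
  qed
  finally show ?thesis .
qed

lemma integrable_norm_diff_sq:
  fixes X Y :: "'b \<Rightarrow> 'a::euclidean_space"
  assumes [measurable]: "X \<in> borel_measurable M" "Y \<in> borel_measurable M"
    and "integrable M (\<lambda>w. (norm (X w))\<^sup>2)" "integrable M (\<lambda>w. (norm (Y w))\<^sup>2)"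
  shows "integrable M (\<lambda>w. (norm (X w - Y w))\<^sup>2)"
proof (rule Bochner_Integration.integrable_bound)
  show "integrable M (\<lambda>w. 2 * (norm (X w))\<^sup>2 + 2 * (norm (Y w))\<^sup>2)" using assms by simp
  show "AE w in M. norm ((norm (X w - Y w))\<^sup>2) \<le> norm (2 * (norm (X w))\<^sup>2 + 2 * (norm (Y w))\<^sup>2)"
    using norm_diff_sq_le by (intro AE_I2) simp
qed simp

lemma integrable_inner_sq:
  fixes X Y :: "'b \<Rightarrow> 'a::euclidean_space"
  assumes [measurable]: "X \<in> borel_measurable M" "Y \<in> borel_measurable M"
    and "integrable M (\<lambda>w. (norm (X w))\<^sup>2)" "integrable M (\<lambda>w. (norm (Y w))\<^sup>2)"
  shows "integrable M (\<lambda>w. X w \<bullet> Y w)"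
proof (rule Bochner_Integration.integrable_bound)
  show "integrable M (\<lambda>w. 1 * (norm (X w))\<^sup>2 + (norm (Y w))\<^sup>2 / (4 * 1))" using assms by simp
  show "AE w in M. norm (X w \<bullet> Y w) \<le> norm (1 * (norm (X w))\<^sup>2 + (norm (Y w))\<^sup>2 / (4 * 1))"
  proof (rule AE_I2)
    fix w
    show "norm (X w \<bullet> Y w) \<le> norm (1 * (norm (X w))\<^sup>2 + (norm (Y w))\<^sup>2 / (4 * 1))"
      using abs_inner_le_sq[of 1 "X w" "Y w"] by simp
  qed
qed simp

definition moment2 :: "'a::euclidean_space measure \<Rightarrow> real" where
  "moment2 \<mu> = (\<integral>x. (norm x)\<^sup>2 \<partial>\<mu>)"

lemma P2_D:
  assumes "\<mu> \<in> P2"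
  shows "prob_space \<mu>" "sets \<mu> = sets borel" "integrable \<mu> (\<lambda>x. (norm x)\<^sup>2)"
  using assms by (auto simp: P2_def)

lemma P2_distr_iff:
  assumes "prob_space \<Omega>" and X [measurable]: "X \<in> borel_measurable \<Omega>"
  shows "distr \<Omega> borel X \<in> P2 \<longleftrightarrow> integrable \<Omega> (\<lambda>w. (norm (X w))\<^sup>2)"
proof -
  have "prob_space (distr \<Omega> borel X)" using assms by (intro prob_space.prob_space_distr)
  then show ?thesis by (simp add: P2_def integrable_distr_eq)
qed

lemma moment2_distr:
  assumes [measurable]: "X \<in> borel_measurable \<Omega>"
  shows "moment2 (distr \<Omega> borel X) = (\<integral>w. (norm (X w))\<^sup>2 \<partial>\<Omega>)"
  by (simp add: moment2_def integral_distr)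

lemma moment2_nonneg: "0 \<le> moment2 \<mu>"
  by (simp add: moment2_def)

lemma nn_integral_moment2:
  assumes "\<mu> \<in> P2" shows "(\<integral>\<^sup>+x. ennreal ((norm x)\<^sup>2) \<partial>\<mu>) = ennreal (moment2 \<mu>)"
  unfolding moment2_def by (intro nn_integral_eq_integral P2_D(3)[OF assms]) simp

lemma W_nonneg: "0 \<le> W p \<mu> \<nu>"
  by (simp add: W_def)

text \<open>The law of the pair (X, Y) is a coupling, so a joint realization on any probability
  space bounds the distance from above.\<close>

lemma W_powr_le:
  fixes X Y :: "'b \<Rightarrow> 'a::euclidean_space"
  assumes "prob_space \<Omega>" and [measurable]: "X \<in> borel_measurable \<Omega>" "Y \<in> borel_measurable \<Omega>"
    and d: "distr \<Omega> borel X = \<mu>" "distr \<Omega> borel Y = \<nu>"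
    and int: "integrable \<Omega> (\<lambda>w. norm (X w - Y w) powr p)" and "0 < p"
  shows "W p \<mu> \<nu> powr p \<le> (\<integral>w. norm (X w - Y w) powr p \<partial>\<Omega>)"
proof -
  interpret prob_space \<Omega> by fact
  define \<gamma> where "\<gamma> = distr \<Omega> borel (\<lambda>w. (X w, Y w))"
  have [measurable]: "(fst :: 'a \<times> 'a \<Rightarrow> 'a) \<in> borel_measurable borel" "(snd :: 'a \<times> 'a \<Rightarrow> 'a) \<in> borel_measurable borel"
    by (intro borel_measurable_continuous_onI continuous_intros)+
  have m [measurable]: "(\<lambda>w. (X w, Y w)) \<in> borel_measurable \<Omega>"
    by (rule borel_measurable_Pair) measurable
  have "\<gamma> \<in> couplings \<mu> \<nu>"
    unfolding couplings_def \<gamma>_def using d by (auto simp: distr_distr o_def intro!: prob_space_distr)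
  then have "(INF \<gamma>\<in>couplings \<mu> \<nu>. transport_cost p \<gamma>) \<le> transport_cost p \<gamma>"
    by (rule INF_lower)
  also have "transport_cost p \<gamma> = (\<integral>\<^sup>+w. ennreal (norm (X w - Y w) powr p) \<partial>\<Omega>)"
    unfolding transport_cost_def \<gamma>_def by (subst nn_integral_distr) (simp_all add: case_prod_beta)
  also have "\<dots> = ennreal (\<integral>w. norm (X w - Y w) powr p \<partial>\<Omega>)"
    by (intro nn_integral_eq_integral int) simp
  finally have "enn2real (INF \<gamma>\<in>couplings \<mu> \<nu>. transport_cost p \<gamma>) \<le> (\<integral>w. norm (X w - Y w) powr p \<partial>\<Omega>)"
    by (intro enn2real_leI) (simp add: integral_nonneg_AE)
  then show ?thesis unfolding W_def powr_powr using \<open>0 < p\<close> by (simp add: integral_nonneg_AE)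
qed

lemma W2_sq_le:
  fixes X Y :: "'b \<Rightarrow> 'a::euclidean_space"
  assumes "prob_space \<Omega>" "X \<in> borel_measurable \<Omega>" "Y \<in> borel_measurable \<Omega>"
    and "distr \<Omega> borel X = \<mu>" "distr \<Omega> borel Y = \<nu>"
    and "integrable \<Omega> (\<lambda>w. (norm (X w - Y w))\<^sup>2)"
  shows "(W 2 \<mu> \<nu>)\<^sup>2 \<le> (\<integral>w. (norm (X w - Y w))\<^sup>2 \<partial>\<Omega>)"
  using W_powr_le[OF assms(1-5), of 2] assms(6) by (simp add: powr_numeral W_nonneg)

lemma opt_couplings_integral:
  assumes \<gamma>: "\<gamma> \<in> opt_couplings \<mu> \<nu>" and "\<mu> \<in> P2" "\<nu> \<in> P2"
  shows "(\<integral>z. (norm (fst z - snd z))\<^sup>2 \<partial>\<gamma>) = (W 2 \<mu> \<nu>)\<^sup>2"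
proof -
  have c: "sets \<gamma> = sets borel" "prob_space \<gamma>" "distr \<gamma> borel fst = \<mu>" "distr \<gamma> borel snd = \<nu>"
    using \<gamma> by (auto simp: opt_couplings_def couplings_def)
  have [measurable_cong]: "sets \<gamma> = sets borel" by fact
  have [measurable]: "fst \<in> borel_measurable (borel :: ('a \<times> 'a) measure)" "snd \<in> borel_measurable (borel :: ('a \<times> 'a) measure)"
    by (intro borel_measurable_continuous_onI continuous_intros)+
  have "integrable \<gamma> (\<lambda>z. (norm (fst z))\<^sup>2)" "integrable \<gamma> (\<lambda>z. (norm (snd z))\<^sup>2)"
    using P2_distr_iff[OF c(2), of fst] P2_distr_iff[OF c(2), of snd] c assms(2,3) by simp_all
  then have int: "integrable \<gamma> (\<lambda>z. (norm (fst z - snd z))\<^sup>2)"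
    by (intro integrable_norm_diff_sq) simp_all
  have "(INF \<gamma>'\<in>couplings \<mu> \<nu>. transport_cost 2 \<gamma>') = transport_cost 2 \<gamma>"
    using \<gamma> by (simp add: opt_couplings_def)
  also have "transport_cost 2 \<gamma> = (\<integral>\<^sup>+z. ennreal ((norm (fst z - snd z))\<^sup>2) \<partial>\<gamma>)"
    unfolding transport_cost_def by (simp add: case_prod_unfold powr_numeral)
  also have "\<dots> = ennreal (\<integral>z. (norm (fst z - snd z))\<^sup>2 \<partial>\<gamma>)"
    by (intro nn_integral_eq_integral int) simp
  finally show ?thesis by (simp add: W_def powr_half_sqrt)
qed

text \<open>Minkowski's inequality from Young's inequality with the weight b/a, since (1 + b/a) a^2
  + (1 + a/b) b^2 = (a + b)^2. The strictly larger a' and b' avoid a division by zero when a norm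
  vanishes, and a limit from the right removes them.\<close>

lemma L2_triangle:
  fixes U V :: "'b \<Rightarrow> 'a::euclidean_space"
  assumes [measurable]: "U \<in> borel_measurable M" "V \<in> borel_measurable M"
    and int: "integrable M (\<lambda>w. (norm (U w))\<^sup>2)" "integrable M (\<lambda>w. (norm (V w))\<^sup>2)"
    and ab: "(\<integral>w. (norm (U w))\<^sup>2 \<partial>M) = a\<^sup>2" "(\<integral>w. (norm (V w))\<^sup>2 \<partial>M) = b\<^sup>2" "0 \<le> a" "0 \<le> b"
  shows "(\<integral>w. (norm (U w - V w))\<^sup>2 \<partial>M) \<le> (a + b)\<^sup>2"
proof -
  have bound: "(\<integral>w. (norm (U w - V w))\<^sup>2 \<partial>M) \<le> (a' + b')\<^sup>2" if a': "a < a'" and b': "b < b'" for a' b'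
  proof -
    have pos: "0 < a'" "0 < b'" using ab a' b' by auto
    have "(norm (U w - V w))\<^sup>2 \<le> (1 + b'/a') * (norm (U w))\<^sup>2 + (1 + a'/b') * (norm (V w))\<^sup>2" for w
    proof -
      have *: "D \<le> (N + P) + (M + Q)" if "- I \<le> R" "2 * R = P + Q" "D = N + M - 2 * I" for D N M P Q I R :: real
        using that by linarith
      show ?thesis
        unfolding distrib_right mult_1
      proof (rule *)
        show "- (U w \<bullet> V w) \<le> (b'/(2*a')) * (norm (U w))\<^sup>2 + (norm (V w))\<^sup>2 / (4 * (b'/(2*a')))"
          using abs_inner_le_sq[of "b'/(2*a')" "U w" "V w"] pos by simp
        show "2 * ((b'/(2*a')) * (norm (U w))\<^sup>2 + (norm (V w))\<^sup>2 / (4 * (b'/(2*a'))))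
            = b'/a' * (norm (U w))\<^sup>2 + a'/b' * (norm (V w))\<^sup>2"
          using pos by (simp add: field_simps)
        show "(norm (U w - V w))\<^sup>2 = (norm (U w))\<^sup>2 + (norm (V w))\<^sup>2 - 2 * (U w \<bullet> V w)"
          by (simp add: power2_norm_eq_inner inner_simps inner_commute)
      qed
    qed
    then have "(\<integral>w. (norm (U w - V w))\<^sup>2 \<partial>M)
        \<le> (\<integral>w. (1 + b'/a') * (norm (U w))\<^sup>2 + (1 + a'/b') * (norm (V w))\<^sup>2 \<partial>M)"
      using int by (intro integral_mono integrable_norm_diff_sq) auto
    also have "\<dots> = (1 + b'/a') * a\<^sup>2 + (1 + a'/b') * b\<^sup>2" using int ab by simp
    also have "\<dots> \<le> (1 + b'/a') * a'\<^sup>2 + (1 + a'/b') * b'\<^sup>2"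
      using pos a' b' ab by (intro add_mono mult_left_mono power_mono) auto
    also have "\<dots> = (a' + b')\<^sup>2" using pos by (simp add: field_simps power2_eq_square)
    finally show ?thesis .
  qed
  have "((\<lambda>d. (a + d + (b + d))\<^sup>2) \<longlongrightarrow> (a + 0 + (b + 0))\<^sup>2) (at_right 0)"
    by (intro tendsto_intros)
  moreover have "\<forall>\<^sub>F d in at_right 0. (\<integral>w. (norm (U w - V w))\<^sup>2 \<partial>M) \<le> (a + d + (b + d))\<^sup>2"
    using eventually_at_right_less[of 0] by (rule eventually_mono) (intro bound, auto)
  ultimately have "(\<integral>w. (norm (U w - V w))\<^sup>2 \<partial>M) \<le> (a + 0 + (b + 0))\<^sup>2"
    by (intro tendsto_lowerbound[where F = "at_right (0::real)"]) auto
  then show ?thesis by simp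
qed

text \<open>Restates the geodesic by three random variables on one space. The pairs (X, Y) and (X,
  Z) are optimal; (Y, Z) is merely some coupling of the end points.\<close>

lemma convex_three_plan:
  fixes G :: "'a::euclidean_space measure \<Rightarrow> ereal"
  assumes conv: "convex_along_generalized_geodesics G"
    and P: "\<mu>0 \<in> P2" "\<mu>1 \<in> P2" "\<nu> \<in> P2"
  obtains \<Gamma> :: "('a \<times> 'a \<times> 'a) measure" and X Y Z where
    "prob_space \<Gamma>" "X \<in> borel_measurable \<Gamma>" "Y \<in> borel_measurable \<Gamma>" "Z \<in> borel_measurable \<Gamma>"
    "distr \<Gamma> borel X = \<nu>" "distr \<Gamma> borel Y = \<mu>0" "distr \<Gamma> borel Z = \<mu>1"
    "integrable \<Gamma> (\<lambda>w. (norm (X w))\<^sup>2)" "integrable \<Gamma> (\<lambda>w. (norm (Y w))\<^sup>2)" "integrable \<Gamma> (\<lambda>w. (norm (Z w))\<^sup>2)"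
    "(\<integral>w. (norm (X w - Y w))\<^sup>2 \<partial>\<Gamma>) = (W 2 \<nu> \<mu>0)\<^sup>2" "(\<integral>w. (norm (X w - Z w))\<^sup>2 \<partial>\<Gamma>) = (W 2 \<nu> \<mu>1)\<^sup>2"
    "\<And>t. t \<in> {0..1} \<Longrightarrow> G (distr \<Gamma> borel (\<lambda>w. (1 - t) *\<^sub>R Y w + t *\<^sub>R Z w)) \<le> ereal (1 - t) * G \<mu>0 + ereal t * G \<mu>1"
proof -
  obtain c where c: "generalized_geodesic \<nu> \<mu>0 \<mu>1 c"
    "\<And>s. s \<in> {0..1} \<Longrightarrow> G (c s) \<le> ereal (1 - s) * G \<mu>0 + ereal s * G \<mu>1"
    using conv P unfolding convex_along_generalized_geodesics_def by blast
  obtain \<Gamma> :: "('a \<times> 'a \<times> 'a) measure" where \<Gamma>: "sets \<Gamma> = sets borel" "prob_space \<Gamma>"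
      "distr \<Gamma> borel (\<lambda>(x, y, z). (x, y)) \<in> opt_couplings \<nu> \<mu>0"
      "distr \<Gamma> borel (\<lambda>(x, y, z). (x, z)) \<in> opt_couplings \<nu> \<mu>1"
      "\<And>t. t \<in> {0..1} \<Longrightarrow> c t = distr \<Gamma> borel (\<lambda>(x, y, z). (1 - t) *\<^sub>R y + t *\<^sub>R z)"
    using c(1) unfolding generalized_geodesic_def by blast
  define X Y Z :: "'a \<times> 'a \<times> 'a \<Rightarrow> 'a" where "X = fst" "Y = fst \<circ> snd" "Z = snd \<circ> snd"
  have [measurable_cong]: "sets \<Gamma> = sets borel" by fact
  have "continuous_on UNIV X" "continuous_on UNIV Y" "continuous_on UNIV Z"
    unfolding X_Y_Z_def o_def by (intro continuous_intros)+
  then have [measurable]: "X \<in> borel_measurable borel" "Y \<in> borel_measurable borel" "Z \<in> borel_measurable borel"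
    by (auto intro: borel_measurable_continuous_onI)
  have [measurable]: "fst \<in> borel_measurable (borel :: ('a \<times> 'a) measure)" "snd \<in> borel_measurable (borel :: ('a \<times> 'a) measure)"
    by (intro borel_measurable_continuous_onI continuous_intros)+
  have pair [measurable]: "(\<lambda>w. (X w, Y w)) \<in> borel_measurable borel" "(\<lambda>w. (X w, Z w)) \<in> borel_measurable borel"
    by (rule borel_measurable_Pair; measurable)+
  have XY: "(\<lambda>(x, y, z). (x, y)) = (\<lambda>w. (X w, Y w))" and XZ: "(\<lambda>(x, y, z). (x, z)) = (\<lambda>w. (X w, Z w))"
    and YZ: "(\<lambda>(x, y, z). (1 - t) *\<^sub>R y + t *\<^sub>R z) = (\<lambda>w. (1 - t) *\<^sub>R Y w + t *\<^sub>R Z w)" for t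
    by (auto simp: X_Y_Z_def)
  have marg: "distr \<Gamma> borel X = \<nu>" "distr \<Gamma> borel Y = \<mu>0" "distr \<Gamma> borel Z = \<mu>1"
    using \<Gamma>(3,4) unfolding XY XZ opt_couplings_def couplings_def by (auto simp: distr_distr o_def)
  have sq: "integrable \<Gamma> (\<lambda>w. (norm (X w))\<^sup>2)" "integrable \<Gamma> (\<lambda>w. (norm (Y w))\<^sup>2)" "integrable \<Gamma> (\<lambda>w. (norm (Z w))\<^sup>2)"
    using P2_distr_iff[OF \<Gamma>(2), of X] P2_distr_iff[OF \<Gamma>(2), of Y] P2_distr_iff[OF \<Gamma>(2), of Z] P marg by simp_all
  have "(\<integral>w. (norm (X w - Y w))\<^sup>2 \<partial>\<Gamma>) = (W 2 \<nu> \<mu>0)\<^sup>2"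
    using opt_couplings_integral[OF \<Gamma>(3) P(3,1)] unfolding XY by (subst (asm) integral_distr) simp_all
  moreover have "(\<integral>w. (norm (X w - Z w))\<^sup>2 \<partial>\<Gamma>) = (W 2 \<nu> \<mu>1)\<^sup>2"
    using opt_couplings_integral[OF \<Gamma>(4) P(3,2)] unfolding XZ by (subst (asm) integral_distr) simp_all
  moreover have "G (distr \<Gamma> borel (\<lambda>w. (1 - t) *\<^sub>R Y w + t *\<^sub>R Z w)) \<le> ereal (1 - t) * G \<mu>0 + ereal t * G \<mu>1"
    if "t \<in> {0..1}" for t
    using c(2)[OF that] \<Gamma>(5)[OF that] unfolding YZ by simp
  ultimately show ?thesis
    using that[of \<Gamma> X Y Z] \<Gamma>(2) marg sq by simp
qed

section \<open>Second moments and inner products along representations\<close>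

lemma as_conv_rep_D:
  assumes "as_conv_rep \<Omega> X Y \<mu> \<nu>"
  shows "prob_space \<Omega>" "\<And>n. X n \<in> borel_measurable \<Omega>" "Y \<in> borel_measurable \<Omega>"
    "\<And>n. distr \<Omega> borel (X n) = \<mu> n" "distr \<Omega> borel Y = \<nu>" "AE \<omega> in \<Omega>. (\<lambda>n. X n \<omega>) \<longlonglongrightarrow> Y \<omega>"
  using assms by (auto simp: as_conv_rep_def)

lemma as_conv_rep_integrable_sq:
  assumes rep: "as_conv_rep \<Omega> X Y \<mu> \<nu>"
  shows "\<mu> n \<in> P2 \<Longrightarrow> integrable \<Omega> (\<lambda>w. (norm (X n w))\<^sup>2)" "\<nu> \<in> P2 \<Longrightarrow> integrable \<Omega> (\<lambda>w. (norm (Y w))\<^sup>2)"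
  using P2_distr_iff[OF as_conv_rep_D(1,2)[OF rep], of n] P2_distr_iff[OF as_conv_rep_D(1,3)[OF rep]]
  by (simp_all add: as_conv_rep_D(4,5)[OF rep])

lemma as_conv_rep_moment2:
  assumes rep: "as_conv_rep \<Omega> X Y \<mu> \<nu>"
  shows "(\<integral>w. (norm (X n w))\<^sup>2 \<partial>\<Omega>) = moment2 (\<mu> n)" "(\<integral>w. (norm (Y w))\<^sup>2 \<partial>\<Omega>) = moment2 \<nu>"
  using moment2_distr[OF as_conv_rep_D(2)[OF rep], of n] moment2_distr[OF as_conv_rep_D(3)[OF rep]]
  by (simp_all add: as_conv_rep_D(4,5)[OF rep])

text \<open>By Fatou's lemma the second moment can only drop in the limit; part of it may escape to
  infinity.\<close>

lemma as_conv_rep_limit_P2: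
  assumes rep: "as_conv_rep \<Omega> X Y \<mu> \<nu>" and P: "\<And>n. \<mu> n \<in> P2" and C: "\<And>n. moment2 (\<mu> n) \<le> C"
  shows "\<nu> \<in> P2"
proof -
  note [measurable] = as_conv_rep_D(2,3)[OF rep]
  have int: "(\<integral>\<^sup>+w. ennreal ((norm (X n w))\<^sup>2) \<partial>\<Omega>) \<le> ennreal C" for n
  proof -
    have "(\<integral>\<^sup>+w. ennreal ((norm (X n w))\<^sup>2) \<partial>\<Omega>) = ennreal (moment2 (\<mu> n))"
      unfolding as_conv_rep_moment2[OF rep, symmetric]
      by (intro nn_integral_eq_integral as_conv_rep_integrable_sq[OF rep] P) simp
    then show ?thesis using C[of n] by (simp add: ennreal_leI)
  qed
  have "(\<integral>\<^sup>+w. ennreal ((norm (Y w))\<^sup>2) \<partial>\<Omega>) = (\<integral>\<^sup>+w. liminf (\<lambda>n. ennreal ((norm (X n w))\<^sup>2)) \<partial>\<Omega>)"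
  proof (rule nn_integral_cong_AE)
    show "AE w in \<Omega>. ennreal ((norm (Y w))\<^sup>2) = liminf (\<lambda>n. ennreal ((norm (X n w))\<^sup>2))"
      using as_conv_rep_D(6)[OF rep]
    proof eventually_elim
      case (elim w)
      then have "(\<lambda>n. ennreal ((norm (X n w))\<^sup>2)) \<longlonglongrightarrow> ennreal ((norm (Y w))\<^sup>2)"
        by (intro tendsto_ennrealI tendsto_intros)
      then show ?case by (rule lim_imp_Liminf[OF sequentially_bot, symmetric])
    qed
  qed
  also have "\<dots> \<le> liminf (\<lambda>n. \<integral>\<^sup>+w. ennreal ((norm (X n w))\<^sup>2) \<partial>\<Omega>)" by (rule nn_integral_liminf) simp
  also have "\<dots> \<le> liminf (\<lambda>n::nat. ennreal C)" by (intro Liminf_mono always_eventually allI int)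
  also have "\<dots> < \<infinity>" by (simp add: Liminf_const)
  finally have "integrable \<Omega> (\<lambda>w. (norm (Y w))\<^sup>2)" by (intro integrableI_nonneg) auto
  then show ?thesis
    using P2_distr_iff[OF as_conv_rep_D(1,3)[OF rep]] by (simp add: as_conv_rep_D(5)[OF rep])
qed

lemma P2_bounded_subseq:
  fixes \<mu> :: "nat \<Rightarrow> 'a::euclidean_space measure"
  assumes P: "\<And>n. \<mu> n \<in> P2" and C: "\<And>n. moment2 (\<mu> n) \<le> C"
  obtains r \<nu> and \<Omega> :: "real measure" and X Y
  where "strict_mono r" "as_conv_rep \<Omega> X Y (\<lambda>n. \<mu> (r n)) \<nu>" "\<nu> \<in> P2"
proof -
  have "(\<integral>\<^sup>+x. ennreal ((norm x)\<^sup>2) \<partial>\<mu> n) \<le> ennreal C" for n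
    using C[of n] by (simp add: nn_integral_moment2[OF P] ennreal_leI)
  then obtain r \<Omega> X Y \<nu> where r: "strict_mono r" "as_conv_rep (\<Omega> :: real measure) X Y (\<lambda>n. \<mu> (r n)) \<nu>"
    using bounded_moment_subseq_representation[of \<mu> C] P2_D[OF P] by blast
  then show ?thesis using as_conv_rep_limit_P2[OF r(2) P C] that by blast
qed

text \<open>The second moments of \<open>B n\<close> do not depend on \<open>n\<close>, which makes the products uniformly integrable.\<close>

lemma as_conv_rep_inner_lower:
  assumes A: "as_conv_rep \<Omega> A A' \<mu> \<nu>" and B: "as_conv_rep \<Omega> B B' (\<lambda>_. \<rho>) \<rho>"
    and P: "\<And>n. \<mu> n \<in> P2" "\<nu> \<in> P2" "\<rho> \<in> P2" and C: "\<And>n. moment2 (\<mu> n) \<le> C"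
    and s: "\<bar>s\<bar> = (1::real)" and "0 < e"
  shows "\<forall>\<^sub>F n in sequentially. s * (\<integral>w. A' w \<bullet> B' w \<partial>\<Omega>) - e < s * (\<integral>w. A n w \<bullet> B n w \<partial>\<Omega>)"
proof -
  note m [measurable] = as_conv_rep_D(2,3)[OF A] as_conv_rep_D(2,3)[OF B]
  note sq = as_conv_rep_integrable_sq[OF A] as_conv_rep_integrable_sq[OF B]
  note mom = as_conv_rep_moment2[OF A] as_conv_rep_moment2[OF B]
  have int: "integrable \<Omega> (\<lambda>w. A n w \<bullet> B n w)" "integrable \<Omega> (\<lambda>w. A' w \<bullet> B' w)" for n
    by (intro integrable_inner_sq m sq P)+
  have "\<forall>\<^sub>F n in sequentially. (\<integral>w. s * (A' w \<bullet> B' w) \<partial>\<Omega>) - e < (\<integral>w. s * (A n w \<bullet> B n w) \<partial>\<Omega>)"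
  proof (rule fatou_eventually_dominated)
    show "AE w in \<Omega>. (\<lambda>n. s * (A n w \<bullet> B n w)) \<longlonglongrightarrow> s * (A' w \<bullet> B' w)"
      using as_conv_rep_D(6)[OF A] as_conv_rep_D(6)[OF B] by eventually_elim (intro tendsto_intros)
    fix \<eta> :: real assume "0 < \<eta>"
    \<comment> \<open>With this weight the moments of \<open>A n\<close>, which are at most C, cost
      at most \<eta>. The large weight 1/(4l) falls on B, whose moment is the same along the
      sequence and in the limit, so that it cancels between h and k.\<close>
    define l where "l = \<eta> / (\<bar>C\<bar> + 1)"
    have l: "0 < l" using \<open>0 < \<eta>\<close> by (simp add: l_def)
    have lC: "l * c \<le> \<eta>" if "c \<le> C" for c
    proof -
      have "l * c \<le> l * (\<bar>C\<bar> + 1)" using l that by (intro mult_left_mono) auto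
      then show ?thesis by (simp add: l_def)
    qed
    show "\<exists>h k. (\<forall>n. integrable \<Omega> (h n)) \<and> integrable \<Omega> k \<and>
      (AE w in \<Omega>. (\<lambda>n. h n w) \<longlonglongrightarrow> k w) \<and> (\<forall>n. AE w in \<Omega>. 0 \<le> s * (A n w \<bullet> B n w) + h n w) \<and>
      (\<forall>n. integral\<^sup>L \<Omega> (h n) \<le> integral\<^sup>L \<Omega> k + \<eta>)"
    proof (intro exI conjI allI)
      let ?h = "\<lambda>n w. l * (norm (A n w))\<^sup>2 + (norm (B n w))\<^sup>2 / (4 * l)"
      let ?k = "\<lambda>w. l * (norm (A' w))\<^sup>2 + (norm (B' w))\<^sup>2 / (4 * l)"
      show "integrable \<Omega> (?h n)" "integrable \<Omega> ?k" for n
        using sq P by simp_all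
      show "AE w in \<Omega>. (\<lambda>n. ?h n w) \<longlonglongrightarrow> ?k w"
        using as_conv_rep_D(6)[OF A] as_conv_rep_D(6)[OF B] 
        by eventually_elim (intro tendsto_intros, use l in auto)
      show "AE w in \<Omega>. 0 \<le> s * (A n w \<bullet> B n w) + ?h n w" for n
      proof (rule AE_I2)
        fix w
        have "\<bar>s * (A n w \<bullet> B n w)\<bar> \<le> ?h n w"
          using abs_inner_le_sq[OF l, of "A n w" "B n w"] s by (simp add: abs_mult)
        then show "0 \<le> s * (A n w \<bullet> B n w) + ?h n w" by linarith
      qed
      show "integral\<^sup>L \<Omega> (?h n) \<le> integral\<^sup>L \<Omega> ?k + \<eta>" for n
      proof -
        have "integral\<^sup>L \<Omega> (?h n) = l * moment2 (\<mu> n) + moment2 \<rho> / (4 * l)"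
          using sq P by (simp add: mom)
        moreover have "integral\<^sup>L \<Omega> ?k = l * moment2 \<nu> + moment2 \<rho> / (4 * l)"
          using sq P by (simp add: mom)
        moreover have "0 \<le> l * moment2 \<nu>" using l moment2_nonneg[of \<nu>] by simp
        ultimately show ?thesis using lC[OF C[of n]] by linarith
      qed
    qed
  qed (use int \<open>0 < e\<close> in auto)
  then show ?thesis by simp
qed

lemma integral_norm_diff_sq:
  fixes X Y :: "'b \<Rightarrow> 'a::euclidean_space"
  assumes m: "X \<in> borel_measurable M" "Y \<in> borel_measurable M"
    and sq: "integrable M (\<lambda>w. (norm (X w))\<^sup>2)" "integrable M (\<lambda>w. (norm (Y w))\<^sup>2)"
  shows "(\<integral>w. (norm (X w - Y w))\<^sup>2 \<partial>M)
    = (\<integral>w. (norm (X w))\<^sup>2 \<partial>M) + (\<integral>w. (norm (Y w))\<^sup>2 \<partial>M) - 2 * (\<integral>w. X w \<bullet> Y w \<partial>M)"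
proof -
  have "(\<integral>w. (norm (X w - Y w))\<^sup>2 \<partial>M) = (\<integral>w. (norm (X w))\<^sup>2 + (norm (Y w))\<^sup>2 - 2 * (X w \<bullet> Y w) \<partial>M)"
    by (rule Bochner_Integration.integral_cong) (simp_all add: power2_norm_eq_inner inner_simps inner_commute)
  then show ?thesis using sq integrable_inner_sq[OF m sq] by simp
qed

section \<open>Metric properties of W_2 and limits of optimal plans\<close>

locale convex_functional =
  fixes G :: "'a::euclidean_space measure \<Rightarrow> ereal"
  assumes proper: "proper_P2 G" and lsc: "lsc_W2 G"
    and convex: "convex_along_generalized_geodesics G" and argmin: "argmin_P2 G \<noteq> {}"
begin

lemmas three_plan = convex_three_plan[OF convex]

text \<open>A generalized geodesic with base \<mu> and both end points equal to \<nu> contains an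
  optimal plan.\<close>

lemma optimal_plan:
  fixes \<mu> \<nu> :: "'a measure"
  assumes P: "\<mu> \<in> P2" "\<nu> \<in> P2"
  obtains \<Gamma> :: "('a \<times> 'a \<times> 'a) measure" and X Y where
    "prob_space \<Gamma>" "X \<in> borel_measurable \<Gamma>" "Y \<in> borel_measurable \<Gamma>"
    "distr \<Gamma> borel X = \<mu>" "distr \<Gamma> borel Y = \<nu>"
    "integrable \<Gamma> (\<lambda>w. (norm (X w))\<^sup>2)" "integrable \<Gamma> (\<lambda>w. (norm (Y w))\<^sup>2)"
    "(\<integral>w. (norm (X w - Y w))\<^sup>2 \<partial>\<Gamma>) = (W 2 \<mu> \<nu>)\<^sup>2"
  by (rule three_plan[OF P(2) P(2) P(1)]) (rule that)

lemma W2_triangle_base: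
  fixes \<mu> \<nu> \<rho> :: "'a measure"
  assumes P: "\<mu> \<in> P2" "\<nu> \<in> P2" "\<rho> \<in> P2"
  shows "W 2 \<mu> \<nu> \<le> W 2 \<rho> \<mu> + W 2 \<rho> \<nu>"
proof -
  obtain \<Gamma> :: "('a \<times> 'a \<times> 'a) measure" and X Y Z where \<Gamma>: "prob_space \<Gamma>" and m [measurable]: "X \<in> borel_measurable \<Gamma>" "Y \<in> borel_measurable \<Gamma>" "Z \<in> borel_measurable \<Gamma>"
    and d: "distr \<Gamma> borel Y = \<mu>" "distr \<Gamma> borel Z = \<nu>"
    and sq: "integrable \<Gamma> (\<lambda>w. (norm (X w))\<^sup>2)" "integrable \<Gamma> (\<lambda>w. (norm (Y w))\<^sup>2)" "integrable \<Gamma> (\<lambda>w. (norm (Z w))\<^sup>2)"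
    and i: "(\<integral>w. (norm (X w - Y w))\<^sup>2 \<partial>\<Gamma>) = (W 2 \<rho> \<mu>)\<^sup>2" "(\<integral>w. (norm (X w - Z w))\<^sup>2 \<partial>\<Gamma>) = (W 2 \<rho> \<nu>)\<^sup>2"
    using three_plan[OF P] .
  have "(W 2 \<mu> \<nu>)\<^sup>2 \<le> (\<integral>w. (norm (Y w - Z w))\<^sup>2 \<partial>\<Gamma>)"
    by (intro W2_sq_le[OF \<Gamma> m(2,3) d] integrable_norm_diff_sq m sq)
  also have "\<dots> = (\<integral>w. (norm ((X w - Z w) - (X w - Y w)))\<^sup>2 \<partial>\<Gamma>)" by simp
  also have "\<dots> \<le> (W 2 \<rho> \<nu> + W 2 \<rho> \<mu>)\<^sup>2"
    by (intro L2_triangle integrable_norm_diff_sq m sq i W_nonneg borel_measurable_diff)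
  finally show ?thesis
    using power2_le_imp_le[OF _ add_nonneg_nonneg[OF W_nonneg W_nonneg]] by (simp add: add.commute)
qed

lemma W2_self: "\<mu> \<in> P2 \<Longrightarrow> W 2 \<mu> (\<mu> :: 'a measure) = 0"
  using W2_sq_le[of \<mu> "\<lambda>x. x" "\<lambda>x. x" \<mu> \<mu>] P2_D[of \<mu>]
  by (simp add: measurable_ident_sets distr_id2)

text \<open>In the triangle inequality with base \<rho> the base stands first in both distances.
  Choosing it to be an end point reverses the arguments, because the other distance is then
  0.\<close>

lemma W2_sym:
  fixes \<mu> \<nu> :: "'a measure"
  assumes "\<mu> \<in> P2" "\<nu> \<in> P2"
  shows "W 2 \<mu> \<nu> = W 2 \<nu> \<mu>"
  using W2_triangle_base[of \<mu> \<nu> \<nu>] W2_triangle_base[of \<nu> \<mu> \<mu>] W2_self assms by simp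

lemma W2_triangle:
  fixes \<mu> \<nu> \<rho> :: "'a measure"
  assumes "\<mu> \<in> P2" "\<nu> \<in> P2" "\<rho> \<in> P2"
  shows "W 2 \<mu> \<nu> \<le> W 2 \<mu> \<rho> + W 2 \<rho> \<nu>"
  using W2_triangle_base[OF assms] W2_sym[OF assms(1,3)] by simp

lemma W2_eq_0:
  fixes \<mu> \<nu> :: "'a measure"
  assumes P: "\<mu> \<in> P2" "\<nu> \<in> P2" and 0: "W 2 \<mu> \<nu> = 0"
  shows "\<mu> = \<nu>"
proof -
  obtain \<Gamma> :: "('a \<times> 'a \<times> 'a) measure" and X Y where \<Gamma>: "prob_space \<Gamma>" and m [measurable]: "X \<in> borel_measurable \<Gamma>" "Y \<in> borel_measurable \<Gamma>"
    and d: "distr \<Gamma> borel X = \<mu>" "distr \<Gamma> borel Y = \<nu>"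
    and sq: "integrable \<Gamma> (\<lambda>w. (norm (X w))\<^sup>2)" "integrable \<Gamma> (\<lambda>w. (norm (Y w))\<^sup>2)"
    and i: "(\<integral>w. (norm (X w - Y w))\<^sup>2 \<partial>\<Gamma>) = (W 2 \<mu> \<nu>)\<^sup>2"
    using optimal_plan[OF P] .
  have "AE w in \<Gamma>. (norm (X w - Y w))\<^sup>2 = 0"
    using i 0 integral_nonneg_eq_0_iff_AE[OF integrable_norm_diff_sq[OF m sq]] by simp
  then have "AE w in \<Gamma>. X w = Y w" by (rule eventually_mono) simp
  then have "distr \<Gamma> borel X = distr \<Gamma> borel Y" by (intro distr_cong_AE) auto
  then show ?thesis using d by simp
qed

lemma moment2_le:
  fixes \<mu> \<nu> :: "'a measure"
  assumes P: "\<mu> \<in> P2" "\<nu> \<in> P2"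
  shows "moment2 \<mu> \<le> 2 * (W 2 \<mu> \<nu>)\<^sup>2 + 2 * moment2 \<nu>"
proof -
  obtain \<Gamma> :: "('a \<times> 'a \<times> 'a) measure" and X Y where \<Gamma>: "prob_space \<Gamma>" and m [measurable]: "X \<in> borel_measurable \<Gamma>" "Y \<in> borel_measurable \<Gamma>"
    and d: "distr \<Gamma> borel X = \<mu>" "distr \<Gamma> borel Y = \<nu>"
    and sq: "integrable \<Gamma> (\<lambda>w. (norm (X w))\<^sup>2)" "integrable \<Gamma> (\<lambda>w. (norm (Y w))\<^sup>2)"
    and i: "(\<integral>w. (norm (X w - Y w))\<^sup>2 \<partial>\<Gamma>) = (W 2 \<mu> \<nu>)\<^sup>2"
    using optimal_plan[OF P] .
  have dsq: "integrable \<Gamma> (\<lambda>w. (norm (X w - Y w))\<^sup>2)" by (intro integrable_norm_diff_sq m sq)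
  have "(norm (X w))\<^sup>2 \<le> 2 * (norm (X w - Y w))\<^sup>2 + 2 * (norm (Y w))\<^sup>2" for w
    using norm_diff_sq_le[of "X w - Y w" "- Y w"] by simp
  then have "(\<integral>w. (norm (X w))\<^sup>2 \<partial>\<Gamma>) \<le> (\<integral>w. 2 * (norm (X w - Y w))\<^sup>2 + 2 * (norm (Y w))\<^sup>2 \<partial>\<Gamma>)"
    using sq dsq by (intro integral_mono) auto
  then show ?thesis using sq dsq i moment2_distr[OF m(1)] moment2_distr[OF m(2)] by (simp add: d)
qed

text \<open>Compactness is applied to the optimal plans themselves, as measures on the product
  space. The projections are continuous, so the marginals converge, and uniqueness of limits makes
  the limit a plan between \<nu> and \<rho>. Its optimality is not asserted: it serves as a
  competitor for \<open>W 2 \<nu> \<rho>\<close>.\<close>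

lemma optimal_plans_limit:
  fixes \<mu> :: "nat \<Rightarrow> 'a measure" and \<nu> \<rho> :: "'a measure"
  assumes P: "\<And>n. \<mu> n \<in> P2" "\<rho> \<in> P2" and C: "\<And>n. moment2 (\<mu> n) \<le> C"
    and rep: "as_conv_rep \<Omega>0 X Y \<mu> \<nu>"
  obtains r and \<Omega> :: "real measure" and A A' B B' where "strict_mono r"
    "as_conv_rep \<Omega> A A' (\<lambda>n. \<mu> (r n)) \<nu>" "as_conv_rep \<Omega> B B' (\<lambda>_. \<rho>) \<rho>"
    "\<And>n. (\<integral>w. (norm (A n w - B n w))\<^sup>2 \<partial>\<Omega>) = (W 2 (\<mu> (r n)) \<rho>)\<^sup>2"
proof -
  have [measurable]: "(fst :: 'a \<times> 'a \<Rightarrow> 'a) \<in> borel_measurable borel" "(snd :: 'a \<times> 'a \<Rightarrow> 'a) \<in> borel_measurable borel"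
    by (intro borel_measurable_continuous_onI continuous_intros)+
  have "\<exists>\<gamma> :: ('a \<times> 'a) measure. \<gamma> \<in> P2 \<and> distr \<gamma> borel fst = \<mu> n \<and> distr \<gamma> borel snd = \<rho> \<and>
      (\<integral>z. (norm (fst z - snd z))\<^sup>2 \<partial>\<gamma>) = (W 2 (\<mu> n) \<rho>)\<^sup>2 \<and> moment2 \<gamma> \<le> C + moment2 \<rho>" for n
  proof -
    obtain \<Gamma> :: "('a \<times> 'a \<times> 'a) measure" and X Y where \<Gamma>: "prob_space \<Gamma>" and m [measurable]: "X \<in> borel_measurable \<Gamma>" "Y \<in> borel_measurable \<Gamma>"
      and d: "distr \<Gamma> borel X = \<mu> n" "distr \<Gamma> borel Y = \<rho>"
      and sq: "integrable \<Gamma> (\<lambda>w. (norm (X w))\<^sup>2)" "integrable \<Gamma> (\<lambda>w. (norm (Y w))\<^sup>2)"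
      and i: "(\<integral>w. (norm (X w - Y w))\<^sup>2 \<partial>\<Gamma>) = (W 2 (\<mu> n) \<rho>)\<^sup>2"
      using optimal_plan[OF P] .
    have p [measurable]: "(\<lambda>w. (X w, Y w)) \<in> borel_measurable \<Gamma>"
      by (rule borel_measurable_Pair) measurable
    let ?\<gamma> = "distr \<Gamma> borel (\<lambda>w. (X w, Y w))"
    have norm: "(norm (X w, Y w))\<^sup>2 = (norm (X w))\<^sup>2 + (norm (Y w))\<^sup>2" for w
      by (simp add: norm_Pair)
    have "?\<gamma> \<in> P2" using sq by (subst P2_distr_iff[OF \<Gamma> p]) (simp add: norm)
    moreover have "distr ?\<gamma> borel fst = \<mu> n" "distr ?\<gamma> borel snd = \<rho>"
      using d by (simp_all add: distr_distr o_def)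
    moreover have "(\<integral>z. (norm (fst z - snd z))\<^sup>2 \<partial>?\<gamma>) = (W 2 (\<mu> n) \<rho>)\<^sup>2"
      using i by (simp add: integral_distr)
    moreover have "moment2 ?\<gamma> \<le> C + moment2 \<rho>"
      using moment2_distr[OF p] moment2_distr[OF m(1)] moment2_distr[OF m(2)] sq C[of n] by (simp add: norm d)
    ultimately show ?thesis by blast
  qed
  then have "\<exists>\<gamma> :: nat \<Rightarrow> ('a \<times> 'a) measure. \<forall>n. \<gamma> n \<in> P2 \<and> distr (\<gamma> n) borel fst = \<mu> n \<and> distr (\<gamma> n) borel snd = \<rho> \<and>
      (\<integral>z. (norm (fst z - snd z))\<^sup>2 \<partial>\<gamma> n) = (W 2 (\<mu> n) \<rho>)\<^sup>2 \<and> moment2 (\<gamma> n) \<le> C + moment2 \<rho>"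
    by (intro choice allI)
  then obtain \<gamma> :: "nat \<Rightarrow> ('a \<times> 'a) measure" where \<gamma>: "\<And>n. \<gamma> n \<in> P2" "\<And>n. distr (\<gamma> n) borel fst = \<mu> n"
      "\<And>n. distr (\<gamma> n) borel snd = \<rho>" "\<And>n. (\<integral>z. (norm (fst z - snd z))\<^sup>2 \<partial>\<gamma> n) = (W 2 (\<mu> n) \<rho>)\<^sup>2"
      "\<And>n. moment2 (\<gamma> n) \<le> C + moment2 \<rho>"
    by blast
  obtain r \<gamma>' and \<Omega> :: "real measure" and Z Z' where r: "strict_mono r"
    and Z: "as_conv_rep \<Omega> Z Z' (\<lambda>n. \<gamma> (r n)) \<gamma>'" "\<gamma>' \<in> P2"
    using P2_bounded_subseq[OF \<gamma>(1,5)] .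
  have 1: "as_conv_rep \<Omega> (\<lambda>n w. fst (Z n w)) (\<lambda>w. fst (Z' w)) (\<lambda>n. \<mu> (r n)) (distr \<gamma>' borel fst)"
    using as_conv_rep_continuous_image[OF Z(1), of fst] by (simp add: \<gamma> continuous_on_fst)
  have 2: "as_conv_rep \<Omega> (\<lambda>n w. snd (Z n w)) (\<lambda>w. snd (Z' w)) (\<lambda>n. \<rho>) (distr \<gamma>' borel snd)"
    using as_conv_rep_continuous_image[OF Z(1), of snd] by (simp add: \<gamma> continuous_on_snd)
  have fst: "distr \<gamma>' borel fst = \<nu>"
    by (rule as_conv_rep_limit_unique[OF 1 as_conv_rep_subseq[OF rep r]])
  have "as_conv_rep \<rho> (\<lambda>_ x. x) (\<lambda>x. x) (\<lambda>_. \<rho>) \<rho>"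
    by (intro as_conv_rep_const P2_D P)
  then have snd: "distr \<gamma>' borel snd = \<rho>"
    by (rule as_conv_rep_limit_unique[OF 2])
  have dist: "(\<integral>w. (norm (fst (Z n w) - snd (Z n w)))\<^sup>2 \<partial>\<Omega>) = (W 2 (\<mu> (r n)) \<rho>)\<^sup>2" for n
  proof -
    note [measurable] = as_conv_rep_D(2)[OF Z(1), of n]
    have "(\<integral>z. (norm (fst z - snd z))\<^sup>2 \<partial>distr \<Omega> borel (Z n)) = (W 2 (\<mu> (r n)) \<rho>)\<^sup>2"
      using \<gamma>(4)[of "r n"] by (simp only: as_conv_rep_D(4)[OF Z(1)])
    then show ?thesis by (subst (asm) integral_distr) measurable
  qed
  show ?thesis by (rule that[OF r 1[unfolded fst] 2[unfolded snd] dist])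
qed

text \<open>Fatou's lemma bounds the cost of the limit plan. A constant bound c is the form in which
  a Cauchy sequence supplies its distances.\<close>

lemma W2_lower_semicontinuous:
  fixes \<mu> :: "nat \<Rightarrow> 'a measure" and \<nu> \<rho> :: "'a measure"
  assumes P: "\<And>n. \<mu> n \<in> P2" "\<rho> \<in> P2" and C: "\<And>n. moment2 (\<mu> n) \<le> C"
    and rep: "as_conv_rep \<Omega>0 X Y \<mu> \<nu>" and c: "\<And>n. W 2 (\<mu> n) \<rho> \<le> c"
  shows "W 2 \<nu> \<rho> \<le> c"
proof -
  have c0: "0 \<le> c" using W_nonneg c order_trans by blast
  have \<nu>: "\<nu> \<in> P2" using as_conv_rep_limit_P2[OF rep P(1) C] .
  obtain r and \<Omega> :: "real measure" and A A' B B' where r: "strict_mono r"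
    and A: "as_conv_rep \<Omega> A A' (\<lambda>n. \<mu> (r n)) \<nu>" and B: "as_conv_rep \<Omega> B B' (\<lambda>_. \<rho>) \<rho>"
    and i: "\<And>n. (\<integral>w. (norm (A n w - B n w))\<^sup>2 \<partial>\<Omega>) = (W 2 (\<mu> (r n)) \<rho>)\<^sup>2"
    by (rule optimal_plans_limit[OF P C rep]) (rule that)
  note m = as_conv_rep_D(2,3)[OF A] as_conv_rep_D(2,3)[OF B]
  note sq = as_conv_rep_integrable_sq[OF A] as_conv_rep_integrable_sq[OF B]
  have int: "integrable \<Omega> (\<lambda>w. (norm (A n w - B n w))\<^sup>2)" "integrable \<Omega> (\<lambda>w. (norm (A' w - B' w))\<^sup>2)" for n
    by (intro integrable_norm_diff_sq m sq P \<nu>)+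
  have "(W 2 \<nu> \<rho>)\<^sup>2 \<le> (\<integral>w. (norm (A' w - B' w))\<^sup>2 \<partial>\<Omega>)"
    using as_conv_rep_D(1,3,5)[OF A] as_conv_rep_D(1,3,5)[OF B] int(2) by (intro W2_sq_le)
  also have "\<dots> \<le> c\<^sup>2"
  proof (rule field_le_epsilon)
    fix e :: real assume "0 < e"
    have "AE w in \<Omega>. (\<lambda>n. (norm (A n w - B n w))\<^sup>2) \<longlonglongrightarrow> (norm (A' w - B' w))\<^sup>2"
      using as_conv_rep_D(6)[OF A] as_conv_rep_D(6)[OF B] by eventually_elim (intro tendsto_intros)
    then have "\<forall>\<^sub>F n in sequentially. (\<integral>w. (norm (A' w - B' w))\<^sup>2 \<partial>\<Omega>) - e < (\<integral>w. (norm (A n w - B n w))\<^sup>2 \<partial>\<Omega>)"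
      using int \<open>0 < e\<close> by (intro fatou_eventually) auto
    then obtain n where "(\<integral>w. (norm (A' w - B' w))\<^sup>2 \<partial>\<Omega>) - e < (\<integral>w. (norm (A n w - B n w))\<^sup>2 \<partial>\<Omega>)"
      using eventually_happens'[OF sequentially_bot] by blast
    moreover have "(W 2 (\<mu> (r n)) \<rho>)\<^sup>2 \<le> c\<^sup>2" using c W_nonneg by (intro power_mono)
    ultimately show "(\<integral>w. (norm (A' w - B' w))\<^sup>2 \<partial>\<Omega>) \<le> c\<^sup>2 + e" unfolding i by linarith
  qed
  finally show ?thesis using c0 by (rule power2_le_imp_le)
qed

text \<open>As for weak convergence in a Hilbert space, the moment of \<open>\<mu> n\<close> cancels
  in the difference of squares and only inner products remain. The distance to \<rho> is an equality
  through optimal plans, while the distance to \<nu> is bounded above by the coupling of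
  \<open>X n\<close> with Y; the minus sign makes both go in the right direction. In the limit X and
  Y coincide and their inner product becomes the moment of \<nu>.\<close>

lemma W2_opial:
  fixes \<mu> :: "nat \<Rightarrow> 'a measure" and \<nu> \<rho> :: "'a measure"
  assumes P: "\<And>n. \<mu> n \<in> P2" "\<rho> \<in> P2" and C: "\<And>n. moment2 (\<mu> n) \<le> C"
    and rep: "as_conv_rep \<Omega>0 X Y \<mu> \<nu>"
    and a: "\<And>n. (W 2 (\<mu> n) \<rho>)\<^sup>2 - (W 2 (\<mu> n) \<nu>)\<^sup>2 \<le> a n" "a \<longlonglongrightarrow> L"
  shows "(W 2 \<nu> \<rho>)\<^sup>2 \<le> L"
proof -
  have \<nu>: "\<nu> \<in> P2" using as_conv_rep_limit_P2[OF rep P(1) C] .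
  obtain r and \<Omega> :: "real measure" and A A' B B' where r: "strict_mono r"
    and A: "as_conv_rep \<Omega> A A' (\<lambda>n. \<mu> (r n)) \<nu>" and B: "as_conv_rep \<Omega> B B' (\<lambda>_. \<rho>) \<rho>"
    and i: "\<And>n. (\<integral>w. (norm (A n w - B n w))\<^sup>2 \<partial>\<Omega>) = (W 2 (\<mu> (r n)) \<rho>)\<^sup>2"
    by (rule optimal_plans_limit[OF P C rep]) (rule that)
  note X = as_conv_rep_subseq[OF rep r]
  have Y: "as_conv_rep \<Omega>0 (\<lambda>_. Y) Y (\<lambda>_. \<nu>) \<nu>" using rep by (simp add: as_conv_rep_def)
  note m = as_conv_rep_D(2,3)[OF A] as_conv_rep_D(2,3)[OF B] as_conv_rep_D(2,3)[OF X]
  note sq = as_conv_rep_integrable_sq[OF A] as_conv_rep_integrable_sq[OF B] as_conv_rep_integrable_sq[OF X]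
  note mom = as_conv_rep_moment2[OF A] as_conv_rep_moment2[OF B] as_conv_rep_moment2[OF X]
  have Wr: "(W 2 (\<mu> (r n)) \<rho>)\<^sup>2 = moment2 (\<mu> (r n)) + moment2 \<rho> - 2 * (\<integral>w. A n w \<bullet> B n w \<partial>\<Omega>)" for n
    unfolding i[symmetric] by (subst integral_norm_diff_sq) (simp_all add: m sq P mom)
  have Wn: "(W 2 (\<mu> (r n)) \<nu>)\<^sup>2 \<le> moment2 (\<mu> (r n)) + moment2 \<nu> - 2 * (\<integral>w. X (r n) w \<bullet> Y w \<partial>\<Omega>0)" for n
  proof -
    have "(W 2 (\<mu> (r n)) \<nu>)\<^sup>2 \<le> (\<integral>w. (norm (X (r n) w - Y w))\<^sup>2 \<partial>\<Omega>0)"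
      using as_conv_rep_D[OF X] by (intro W2_sq_le integrable_norm_diff_sq m sq P \<nu>)
    then show ?thesis by (subst (asm) integral_norm_diff_sq) (simp_all add: m sq P \<nu> mom)
  qed
  have YY: "(\<integral>w. Y w \<bullet> Y w \<partial>\<Omega>0) = moment2 \<nu>" using mom(6) by (simp add: power2_norm_eq_inner)
  have "(W 2 \<nu> \<rho>)\<^sup>2 \<le> (\<integral>w. (norm (A' w - B' w))\<^sup>2 \<partial>\<Omega>)"
    using as_conv_rep_D(1,3,5)[OF A] as_conv_rep_D(1,3,5)[OF B]
    by (intro W2_sq_le integrable_norm_diff_sq m sq P \<nu>)
  also have "\<dots> = moment2 \<nu> + moment2 \<rho> - 2 * (\<integral>w. A' w \<bullet> B' w \<partial>\<Omega>)"
    by (subst integral_norm_diff_sq) (simp_all add: m sq P \<nu> mom)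
  also have "\<dots> \<le> L"
  proof (rule field_le_epsilon)
    fix e :: real assume "0 < e"
    \<comment> \<open>Fifths of e: one for a, and two for each inner product because these enter
      with the factor 2.\<close>
    have ar: "(\<lambda>n. a (r n)) \<longlonglongrightarrow> L" using LIMSEQ_subseq_LIMSEQ[OF a(2) r] by (simp add: o_def)
    have "\<forall>\<^sub>F n in sequentially. a (r n) < L + e / 5"
      using order_tendstoD(2)[OF ar, of "L + e/5"] \<open>0 < e\<close> by simp
    moreover have "\<forall>\<^sub>F n in sequentially. 1 * (\<integral>w. Y w \<bullet> Y w \<partial>\<Omega>0) - e / 5 < 1 * (\<integral>w. X (r n) w \<bullet> Y w \<partial>\<Omega>0)"
      using \<open>0 < e\<close> by (intro as_conv_rep_inner_lower[OF X Y P(1) \<nu> \<nu> C]) auto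
    moreover have "\<forall>\<^sub>F n in sequentially. -1 * (\<integral>w. A' w \<bullet> B' w \<partial>\<Omega>) - e / 5 < -1 * (\<integral>w. A n w \<bullet> B n w \<partial>\<Omega>)"
      using \<open>0 < e\<close> by (intro as_conv_rep_inner_lower[OF A B P(1) \<nu> P(2) C]) auto
    ultimately have "\<forall>\<^sub>F n in sequentially. moment2 \<nu> + moment2 \<rho> - 2 * (\<integral>w. A' w \<bullet> B' w \<partial>\<Omega>) \<le> L + e"
    proof eventually_elim
      case (elim n)
      then show ?case using a(1)[of "r n"] Wr[of n] Wn[of n] YY by linarith
    qed
    then show "moment2 \<nu> + moment2 \<rho> - 2 * (\<integral>w. A' w \<bullet> B' w \<partial>\<Omega>) \<le> L + e"
      using eventually_happens'[OF sequentially_bot] by blast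
  qed
  finally show ?thesis .
qed

end

section \<open>Resolvents\<close>

lemma argmin_P2_iff: "m \<in> argmin_P2 H \<longleftrightarrow> m \<in> P2 \<and> (\<forall>\<nu>\<in>P2. H m \<le> H \<nu>)"
  by (auto simp: argmin_P2_def is_arg_min_def not_less)

text \<open>The exact strong convexity of the squared norm. Its last term is the source of the
  uniform convexity of the proximal objective.\<close>

lemma norm_convex_combination_diff_sq:
  fixes x y z :: "'a::real_inner"
  shows "(norm ((1 - t) *\<^sub>R y + t *\<^sub>R z - x))\<^sup>2
    = (1 - t) * (norm (x - y))\<^sup>2 + t * (norm (x - z))\<^sup>2 - t * (1 - t) * (norm (y - z))\<^sup>2"
  unfolding power2_norm_eq_inner
  by (simp add: inner_simps inner_commute) (simp add: algebra_simps power2_eq_square)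

context convex_functional
begin

text \<open>A real number, because the infimum is attained and G is proper; this allows ordinary
  arithmetic with the values.\<close>

definition Gmin :: real where
  "Gmin = real_of_ereal (INF \<nu>\<in>P2. G \<nu>)"

lemma G_not_MInf: "\<nu> \<in> P2 \<Longrightarrow> G \<nu> \<noteq> -\<infinity>"
  using proper by (auto simp: proper_P2_def)

lemma argmin_INF: 
  assumes "m \<in> argmin_P2 G"
  shows "(INF \<nu>\<in>P2. G \<nu>) = G m"
  using assms unfolding argmin_P2_iff by (intro antisym INF_lower INF_greatest) auto

lemma INF_G: "(INF \<nu>\<in>P2. G \<nu>) = ereal Gmin"
proof -
  obtain m where m: "m \<in> argmin_P2 G" using argmin by blast
  obtain \<nu> where \<nu>: "\<nu> \<in> P2" "G \<nu> \<noteq> \<infinity>" using proper by (auto simp: proper_P2_def)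
  have "m \<in> P2" "G m \<le> G \<nu>" using m \<nu> by (auto simp: argmin_P2_iff)
  then have "G m \<noteq> \<infinity>" "G m \<noteq> -\<infinity>" using \<nu> G_not_MInf by auto
  then show ?thesis unfolding Gmin_def argmin_INF[OF m] by (cases "G m") auto
qed

lemma Gmin_le: "\<nu> \<in> P2 \<Longrightarrow> ereal Gmin \<le> G \<nu>"
  unfolding INF_G[symmetric] by (rule INF_lower)

lemma argmin_G: "m \<in> argmin_P2 G \<longleftrightarrow> m \<in> P2 \<and> G m = ereal Gmin"
  using argmin_INF INF_G Gmin_le by (auto simp: argmin_P2_iff)

text \<open>The pointwise identity is integrated over the three-plan. The coupling (Y, Z) need not
  be optimal, but its cost carries a minus sign, so replacing it by the smaller squared distance of
  the end points keeps the inequality.\<close>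

lemma geodesic_point:
  fixes \<mu>0 \<mu>1 \<nu> :: "'a measure"
  assumes P: "\<mu>0 \<in> P2" "\<mu>1 \<in> P2" "\<nu> \<in> P2" and g: "G \<mu>0 = ereal g0" "G \<mu>1 = ereal g1" and t: "t \<in> {0..1}"
  obtains \<sigma> where "\<sigma> \<in> P2" "G \<sigma> \<le> ereal ((1 - t) * g0 + t * g1)"
    "(W 2 \<sigma> \<nu>)\<^sup>2 \<le> (1 - t) * (W 2 \<nu> \<mu>0)\<^sup>2 + t * (W 2 \<nu> \<mu>1)\<^sup>2 - t * (1 - t) * (W 2 \<mu>0 \<mu>1)\<^sup>2"
proof -
  obtain \<Gamma> :: "('a \<times> 'a \<times> 'a) measure" and X Y Z where \<Gamma>: "prob_space \<Gamma>" and m [measurable]: "X \<in> borel_measurable \<Gamma>" "Y \<in> borel_measurable \<Gamma>" "Z \<in> borel_measurable \<Gamma>"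
    and d: "distr \<Gamma> borel X = \<nu>" "distr \<Gamma> borel Y = \<mu>0" "distr \<Gamma> borel Z = \<mu>1"
    and sq: "integrable \<Gamma> (\<lambda>w. (norm (X w))\<^sup>2)" "integrable \<Gamma> (\<lambda>w. (norm (Y w))\<^sup>2)" "integrable \<Gamma> (\<lambda>w. (norm (Z w))\<^sup>2)"
    and i: "(\<integral>w. (norm (X w - Y w))\<^sup>2 \<partial>\<Gamma>) = (W 2 \<nu> \<mu>0)\<^sup>2" "(\<integral>w. (norm (X w - Z w))\<^sup>2 \<partial>\<Gamma>) = (W 2 \<nu> \<mu>1)\<^sup>2"
    and G: "\<And>t. t \<in> {0..1} \<Longrightarrow> G (distr \<Gamma> borel (\<lambda>w. (1 - t) *\<^sub>R Y w + t *\<^sub>R Z w)) \<le> ereal (1 - t) * G \<mu>0 + ereal t * G \<mu>1"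
    by (rule three_plan[OF P]) (rule that)
  let ?S = "\<lambda>w. (1 - t) *\<^sub>R Y w + t *\<^sub>R Z w"
  have S: "?S \<in> borel_measurable \<Gamma>" by measurable
  have diff: "integrable \<Gamma> (\<lambda>w. (norm (X w - Y w))\<^sup>2)" "integrable \<Gamma> (\<lambda>w. (norm (X w - Z w))\<^sup>2)" "integrable \<Gamma> (\<lambda>w. (norm (Y w - Z w))\<^sup>2)"
    by (intro integrable_norm_diff_sq m sq)+
  have SX: "integrable \<Gamma> (\<lambda>w. (norm (?S w - X w))\<^sup>2)"
    unfolding norm_convex_combination_diff_sq using diff by simp
  \<comment> \<open>With 0 in place of the base point the same identity expresses the squared norm
    of \<open>?S\<close>.\<close>
  have "integrable \<Gamma> (\<lambda>w. (norm (?S w - 0))\<^sup>2)"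
    unfolding norm_convex_combination_diff_sq using sq diff by simp
  then have "distr \<Gamma> borel ?S \<in> P2" using P2_distr_iff[OF \<Gamma> S] by simp
  moreover have "G (distr \<Gamma> borel ?S) \<le> ereal ((1 - t) * g0 + t * g1)"
    using G[OF t] by (simp add: g)
  moreover have "(W 2 (distr \<Gamma> borel ?S) \<nu>)\<^sup>2 \<le> (1 - t) * (W 2 \<nu> \<mu>0)\<^sup>2 + t * (W 2 \<nu> \<mu>1)\<^sup>2 - t * (1 - t) * (W 2 \<mu>0 \<mu>1)\<^sup>2"
  proof -
    have "(W 2 (distr \<Gamma> borel ?S) \<nu>)\<^sup>2 \<le> (\<integral>w. (norm (?S w - X w))\<^sup>2 \<partial>\<Gamma>)"
      by (rule W2_sq_le[OF \<Gamma> S m(1) refl d(1) SX])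
    also have "\<dots> = (1 - t) * (W 2 \<nu> \<mu>0)\<^sup>2 + t * (W 2 \<nu> \<mu>1)\<^sup>2 - t * (1 - t) * (\<integral>w. (norm (Y w - Z w))\<^sup>2 \<partial>\<Gamma>)"
      unfolding norm_convex_combination_diff_sq using diff by (simp add: i)
    also have "\<dots> \<le> (1 - t) * (W 2 \<nu> \<mu>0)\<^sup>2 + t * (W 2 \<nu> \<mu>1)\<^sup>2 - t * (1 - t) * (W 2 \<mu>0 \<mu>1)\<^sup>2"
      using W2_sq_le[OF \<Gamma> m(2,3) d(2,3) diff(3)] t by (intro diff_left_mono mult_left_mono) auto
    finally show ?thesis .
  qed
  ultimately show ?thesis by (rule that)
qed

text \<open>A Cauchy sequence has bounded moments from some index on, hence a narrowly convergent
  subsequence. Lower semicontinuity of the distance to a fixed late member turns the narrow limit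
  into the W_2 limit of the whole sequence.\<close>

lemma W2_complete:
  fixes \<mu> :: "nat \<Rightarrow> 'a measure"
  assumes P: "\<And>n. \<mu> n \<in> P2"
    and Cauchy: "\<And>e. 0 < e \<Longrightarrow> \<exists>N. \<forall>m\<ge>N. \<forall>n\<ge>N. W 2 (\<mu> m) (\<mu> n) \<le> e"
  obtains \<nu> where "\<nu> \<in> P2" "(\<lambda>n. W 2 (\<mu> n) \<nu>) \<longlonglongrightarrow> 0"
proof -
  obtain N where N: "\<And>m n. m \<ge> N \<Longrightarrow> n \<ge> N \<Longrightarrow> W 2 (\<mu> m) (\<mu> n) \<le> 1" using Cauchy[of 1] by auto
  have C: "moment2 (\<mu> (n + N)) \<le> 2 * 1\<^sup>2 + 2 * moment2 (\<mu> N)" for n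
  proof -
    have "moment2 (\<mu> (n + N)) \<le> 2 * (W 2 (\<mu> (n + N)) (\<mu> N))\<^sup>2 + 2 * moment2 (\<mu> N)"
      by (intro moment2_le P)
    also have "\<dots> \<le> 2 * 1\<^sup>2 + 2 * moment2 (\<mu> N)"
      using N[of "n + N" N] W_nonneg by (intro add_right_mono mult_left_mono power_mono) auto
    finally show ?thesis .
  qed
  obtain r \<nu> and \<Omega> :: "real measure" and X Y where r: "strict_mono r"
    and rep: "as_conv_rep \<Omega> X Y (\<lambda>n. \<mu> (r n + N)) \<nu>" and \<nu>: "\<nu> \<in> P2"
    by (rule P2_bounded_subseq[of "\<lambda>n. \<mu> (n + N)", OF P C]) (rule that)
  have "(\<lambda>n. W 2 (\<mu> n) \<nu>) \<longlonglongrightarrow> 0"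
  proof (rule LIMSEQ_I)
    fix e :: real assume "0 < e"
    then obtain M where M: "\<And>m n. m \<ge> M \<Longrightarrow> n \<ge> M \<Longrightarrow> W 2 (\<mu> m) (\<mu> n) \<le> e / 2"
      using Cauchy[of "e/2"] by auto
    have "norm (W 2 (\<mu> n) \<nu> - 0) < e" if n: "M \<le> n" for n
    proof -
      \<comment> \<open>The shift puts every index \<open>r (k + M) + N\<close> beyond M, where the
        Cauchy bound e/2 is available.\<close>
      have "strict_mono (\<lambda>k. k + M)" by (simp add: strict_mono_def)
      note rep' = as_conv_rep_subseq[OF rep this]
      have "W 2 \<nu> (\<mu> n) \<le> e / 2"
      proof (rule W2_lower_semicontinuous[OF P P C rep'])
        fix k
        have "k + M \<le> r (k + M)" using r by (rule seq_suble)
        then show "W 2 (\<mu> (r (k + M) + N)) (\<mu> n) \<le> e / 2" using n by (intro M) auto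
      qed
      then show ?thesis using W2_sym[OF P \<nu>, of n] W_nonneg[of 2 "\<mu> n" \<nu>] \<open>0 < e\<close> by simp
    qed
    then show "\<exists>no. \<forall>n\<ge>no. norm (W 2 (\<mu> n) \<nu> - 0) < e" by blast
  qed
  with \<nu> show ?thesis by (rule that)
qed

lemma W2_tendsto:
  fixes \<mu> :: "nat \<Rightarrow> 'a measure" and \<nu> \<rho> :: "'a measure"
  assumes P: "\<And>n. \<mu> n \<in> P2" "\<nu> \<in> P2" "\<rho> \<in> P2" and lim: "(\<lambda>n. W 2 (\<mu> n) \<nu>) \<longlonglongrightarrow> 0"
  shows "(\<lambda>n. W 2 (\<mu> n) \<rho>) \<longlonglongrightarrow> W 2 \<nu> \<rho>"
proof (rule LIM_zero_cancel, rule Lim_null_comparison[OF _ lim], rule always_eventually, rule allI)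
  fix n
  show "norm (W 2 (\<mu> n) \<rho> - W 2 \<nu> \<rho>) \<le> W 2 (\<mu> n) \<nu>"
    using W2_triangle[OF P(1,3,2), of n] W2_triangle[OF P(2,3,1), of n] W2_sym[OF P(1,2), of n]
    by (simp add: abs_le_iff)
qed

section \<open>Existence, uniqueness and variational inequality of the resolvent\<close>

definition prox_objective :: "real \<Rightarrow> 'a measure \<Rightarrow> 'a measure \<Rightarrow> ereal" where
  "prox_objective \<tau> \<mu> \<nu> = G \<nu> + ereal (1 / (2 * \<tau>) * (W 2 \<nu> \<mu>)\<^sup>2)"

text \<open>The objective is uniformly convex along generalized geodesics with base \<open>\<mu>\<close>.\<close>

lemma prox_objective_parallelogram:
  assumes \<tau>: "0 < \<tau>" and P: "\<mu> \<in> P2" "\<mu>0 \<in> P2" "\<mu>1 \<in> P2"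
    and i: "\<And>\<nu>. \<nu> \<in> P2 \<Longrightarrow> ereal i \<le> prox_objective \<tau> \<mu> \<nu>"
    and le: "prox_objective \<tau> \<mu> \<mu>0 \<le> ereal (i + a)" "prox_objective \<tau> \<mu> \<mu>1 \<le> ereal (i + b)"
  shows "(W 2 \<mu>0 \<mu>1)\<^sup>2 \<le> 4 * \<tau> * (a + b)"
proof -
  have fin: "\<exists>g. G \<nu> = ereal g" if "\<nu> \<in> P2" "prox_objective \<tau> \<mu> \<nu> \<le> ereal c" for \<nu> c
    using that G_not_MInf[OF that(1)] by (cases "G \<nu>") (auto simp: prox_objective_def)
  obtain g0 g1 where g: "G \<mu>0 = ereal g0" "G \<mu>1 = ereal g1"
    using fin[OF P(2) le(1)] fin[OF P(3) le(2)] by auto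
  define D0 D1 R where "D0 = (W 2 \<mu> \<mu>0)\<^sup>2" "D1 = (W 2 \<mu> \<mu>1)\<^sup>2" "R = (W 2 \<mu>0 \<mu>1)\<^sup>2"
  have D: "(W 2 \<mu>0 \<mu>)\<^sup>2 = D0" "(W 2 \<mu>1 \<mu>)\<^sup>2 = D1"
    using P W2_sym by (simp_all add: D0_D1_R_def)
  have le': "g0 + D0 / (2 * \<tau>) \<le> i + a" "g1 + D1 / (2 * \<tau>) \<le> i + b"
    using le by (simp_all add: prox_objective_def g D)
  \<comment> \<open>At the midpoint the squared distance to \<mu> falls short of the average by at
    least R/4, hence the objective by at least R/(8\<tau>). As its value is still at least i,
    R/(8\<tau>) is at most (a + b)/2.\<close>
  have half: "1/2 \<in> {0..1::real}" by simp
  obtain \<sigma> where \<sigma>: "\<sigma> \<in> P2" "G \<sigma> \<le> ereal ((1 - 1/2) * g0 + 1/2 * g1)"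
      "(W 2 \<sigma> \<mu>)\<^sup>2 \<le> (1 - 1/2) * (W 2 \<mu> \<mu>0)\<^sup>2 + 1/2 * (W 2 \<mu> \<mu>1)\<^sup>2 - 1/2 * (1 - 1/2) * (W 2 \<mu>0 \<mu>1)\<^sup>2"
    using geodesic_point[OF P(2,3,1) g half] .
  then have \<sigma>D: "(W 2 \<sigma> \<mu>)\<^sup>2 \<le> D0 / 2 + D1 / 2 - R / 4" by (simp add: D0_D1_R_def)
  have "ereal i \<le> ereal ((1 - 1/2) * g0 + 1/2 * g1) + ereal (1 / (2 * \<tau>) * (W 2 \<sigma> \<mu>)\<^sup>2)"
    using i[OF \<sigma>(1)] \<sigma>(2) unfolding prox_objective_def by (meson add_right_mono order_trans)
  then have "i \<le> g0 / 2 + g1 / 2 + (W 2 \<sigma> \<mu>)\<^sup>2 / (2 * \<tau>)" by simp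
  also have "\<dots> \<le> g0 / 2 + g1 / 2 + (D0 / 2 + D1 / 2 - R / 4) / (2 * \<tau>)"
    using \<sigma>D \<tau> by (intro add_left_mono divide_right_mono) auto
  also have "\<dots> = (g0 + D0 / (2 * \<tau>)) / 2 + (g1 + D1 / (2 * \<tau>)) / 2 - R / (8 * \<tau>)"
    using \<tau> by (simp add: field_simps)
  finally have "i \<le> (g0 + D0 / (2 * \<tau>)) / 2 + (g1 + D1 / (2 * \<tau>)) / 2 - R / (8 * \<tau>)" .
  moreover have "w \<le> (a + b) / 2" if "i \<le> u / 2 + v / 2 - w" "u \<le> i + a" "v \<le> i + b" for u v w :: real
    using that by (simp add: field_simps)
  ultimately have "R / (8 * \<tau>) \<le> (a + b) / 2" using le' by blast
  then show ?thesis using \<tau> by (simp add: field_simps D0_D1_R_def)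
qed

text \<open>The direct method in the metric space: uniform convexity makes a minimizing sequence
  Cauchy, so it converges in W_2, the topology in which G is lower semicontinuous. A minimizer of G
  keeps the infimum finite.\<close>

lemma prox_exists:
  assumes \<tau>: "0 < \<tau>" and \<mu>: "\<mu> \<in> P2"
  shows "argmin_P2 (prox_objective \<tau> \<mu>) \<noteq> {}"
proof -
  define I where "I = (INF \<nu>\<in>P2. prox_objective \<tau> \<mu> \<nu>)"
  obtain m where m: "m \<in> P2" "G m = ereal Gmin" using argmin argmin_G by blast
  have "ereal Gmin \<le> I"
    unfolding I_def
  proof (rule INF_greatest)
    fix \<nu> :: "'a measure" assume "\<nu> \<in> P2"
    moreover have "0 \<le> ereal (1 / (2 * \<tau>) * (W 2 \<nu> \<mu>)\<^sup>2)" using \<tau> by simp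
    ultimately show "ereal Gmin \<le> prox_objective \<tau> \<mu> \<nu>"
      unfolding prox_objective_def using add_mono[OF Gmin_le] by fastforce
  qed
  moreover have "I \<le> prox_objective \<tau> \<mu> m" unfolding I_def using m(1) by (rule INF_lower)
  ultimately obtain i where i: "I = ereal i"
    by (cases I) (auto simp: prox_objective_def m)
  have lower: "ereal i \<le> prox_objective \<tau> \<mu> \<nu>" if "\<nu> \<in> P2" for \<nu>
    using that unfolding i[symmetric] I_def by (rule INF_lower)
  have "\<exists>\<nu>\<in>P2. prox_objective \<tau> \<mu> \<nu> < ereal (i + inverse (real (Suc n)))" for n
  proof -
    have "I < ereal (i + inverse (real (Suc n)))" by (simp add: i)
    then show ?thesis unfolding I_def INF_less_iff .
  qed
  then obtain \<nu> where \<nu>: "\<And>n. \<nu> n \<in> P2" "\<And>n. prox_objective \<tau> \<mu> (\<nu> n) < ereal (i + inverse (real (Suc n)))"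
    by metis
  have dist: "(W 2 (\<nu> n) (\<nu> k))\<^sup>2 \<le> 4 * \<tau> * (inverse (real (Suc n)) + inverse (real (Suc k)))" for n k
    using \<nu> by (intro prox_objective_parallelogram[OF \<tau> \<mu> _ _ lower]) (auto intro: less_imp_le)
  obtain \<rho> where \<rho>: "\<rho> \<in> P2" and lim: "(\<lambda>n. W 2 (\<nu> n) \<rho>) \<longlonglongrightarrow> 0"
  proof (rule W2_complete[of \<nu>, OF \<nu>(1)])
    fix e :: real assume e: "0 < e"
    \<comment> \<open>If both errors are below this number, the squared distance is at most 4\<tau>
      times twice e^2/(8\<tau>), which is e^2.\<close>
    then have "0 < e\<^sup>2 / (8 * \<tau>)" using \<tau> by simp
    then obtain N where N: "inverse (real (Suc N)) < e\<^sup>2 / (8 * \<tau>)" using reals_Archimedean by blast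
    have "W 2 (\<nu> n) (\<nu> k) \<le> e" if "N \<le> n" "N \<le> k" for n k
    proof (rule power2_le_imp_le)
      have "inverse (real (Suc n)) \<le> inverse (real (Suc N))" "inverse (real (Suc k)) \<le> inverse (real (Suc N))"
        using that by (auto intro!: le_imp_inverse_le)
      then have "inverse (real (Suc n)) + inverse (real (Suc k)) \<le> 2 * (e\<^sup>2 / (8 * \<tau>))" using N by linarith
      then have "4 * \<tau> * (inverse (real (Suc n)) + inverse (real (Suc k))) \<le> 4 * \<tau> * (2 * (e\<^sup>2 / (8 * \<tau>)))"
        using \<tau> by (intro mult_left_mono) auto
      also have "\<dots> = e\<^sup>2" using \<tau> by simp
      finally show "(W 2 (\<nu> n) (\<nu> k))\<^sup>2 \<le> e\<^sup>2" using dist[of n k] by linarith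
    qed (use e in simp)
    then show "\<exists>N. \<forall>n\<ge>N. \<forall>k\<ge>N. W 2 (\<nu> n) (\<nu> k) \<le> e" by blast
  qed
  have Wlim: "(\<lambda>n. W 2 (\<nu> n) \<mu>) \<longlonglongrightarrow> W 2 \<rho> \<mu>" by (rule W2_tendsto[OF \<nu>(1) \<rho> \<mu> lim])
  have "G \<rho> \<le> ereal (i - 1 / (2 * \<tau>) * (W 2 \<rho> \<mu>)\<^sup>2)"
  proof (rule ccontr)
    assume "\<not> ?thesis"
    then have "ereal (i - 1 / (2 * \<tau>) * (W 2 \<rho> \<mu>)\<^sup>2) < G \<rho>" by (simp only: not_le)
    \<comment> \<open>Lower semicontinuity keeps \<open>G (\<nu> n)\<close> above b eventually,
      whereas the minimizing property bounds it by numbers whose limit lies below b.\<close>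
    then obtain b where b: "ereal (i - 1 / (2 * \<tau>) * (W 2 \<rho> \<mu>)\<^sup>2) < ereal b" "ereal b < G \<rho>"
      using ereal_dense2 by blast
    obtain d where d: "0 < d" "\<And>\<nu>. \<nu> \<in> P2 \<Longrightarrow> W 2 \<nu> \<rho> < d \<Longrightarrow> ereal b < G \<nu>"
      using lsc \<rho> b(2) unfolding lsc_W2_def by blast
    have "\<forall>\<^sub>F n in sequentially. W 2 (\<nu> n) \<rho> < d" using order_tendstoD(2)[OF lim d(1)] .
    then have "\<forall>\<^sub>F n in sequentially. b \<le> i + inverse (real (Suc n)) - 1 / (2 * \<tau>) * (W 2 (\<nu> n) \<mu>)\<^sup>2"
    proof eventually_elim
      case (elim n)
      then have "ereal b < G (\<nu> n)" using d(2) \<nu>(1) by blast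
      then show ?case using \<nu>(2)[of n] by (cases "G (\<nu> n)") (auto simp: prox_objective_def)
    qed
    moreover have "(\<lambda>n. i + inverse (real (Suc n)) - 1 / (2 * \<tau>) * (W 2 (\<nu> n) \<mu>)\<^sup>2)
        \<longlonglongrightarrow> i + 0 - 1 / (2 * \<tau>) * (W 2 \<rho> \<mu>)\<^sup>2"
      by (intro tendsto_intros Wlim LIMSEQ_inverse_real_of_nat)
    ultimately have "b \<le> i + 0 - 1 / (2 * \<tau>) * (W 2 \<rho> \<mu>)\<^sup>2"
      by (intro tendsto_lowerbound) auto
    then show False using b(1) by simp
  qed
  then have "prox_objective \<tau> \<mu> \<rho> \<le> ereal (i - 1 / (2 * \<tau>) * (W 2 \<rho> \<mu>)\<^sup>2) + ereal (1 / (2 * \<tau>) * (W 2 \<rho> \<mu>)\<^sup>2)"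
    unfolding prox_objective_def by (rule add_right_mono)
  then have "prox_objective \<tau> \<mu> \<rho> \<le> ereal i" by simp
  then have "\<rho> \<in> argmin_P2 (prox_objective \<tau> \<mu>)"
    using \<rho> lower by (auto simp: argmin_P2_iff intro: order_trans)
  then show ?thesis by blast
qed

text \<open>Two minimizers have excess a = b = 0 in the parallelogram inequality, so their distance
  vanishes. The definite description in \<open>prox\<close> therefore denotes the minimizer.\<close>

lemma prox_argmin:
  assumes \<tau>: "0 < \<tau>" and \<mu>: "\<mu> \<in> P2"
  shows "prox G \<tau> \<mu> \<in> argmin_P2 (prox_objective \<tau> \<mu>)"
proof -
  obtain \<rho> where \<rho>: "\<rho> \<in> argmin_P2 (prox_objective \<tau> \<mu>)" using prox_exists[OF \<tau> \<mu>] by blast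
  obtain m where m: "m \<in> P2" "G m = ereal Gmin" using argmin argmin_G by blast
  have "prox_objective \<tau> \<mu> \<rho> \<le> prox_objective \<tau> \<mu> m" "\<rho> \<in> P2" using \<rho> m by (auto simp: argmin_P2_iff)
  then obtain i where i: "prox_objective \<tau> \<mu> \<rho> = ereal i"
    using G_not_MInf[of \<rho>] by (cases "G \<rho>") (auto simp: prox_objective_def m)
  have lower: "ereal i \<le> prox_objective \<tau> \<mu> \<nu>" if "\<nu> \<in> P2" for \<nu>
    using that \<rho> by (simp add: i[symmetric] argmin_P2_iff)
  have "\<rho>' = \<rho>" if \<rho>': "\<rho>' \<in> argmin_P2 (prox_objective \<tau> \<mu>)" for \<rho>'
  proof (rule W2_eq_0)
    have "(W 2 \<rho>' \<rho>)\<^sup>2 \<le> 4 * \<tau> * (0 + 0)"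
      by (rule prox_objective_parallelogram[OF \<tau> \<mu> _ _ lower]) (use \<rho> \<rho>' i in \<open>auto simp: argmin_P2_iff\<close>)
    then show "W 2 \<rho>' \<rho> = 0" by simp
  qed (use \<rho> \<rho>' in \<open>auto simp: argmin_P2_iff\<close>)
  then have "(THE \<nu>. \<nu> \<in> argmin_P2 (prox_objective \<tau> \<mu>)) = \<rho>" using \<rho> by (intro the_equality)
  then show ?thesis using \<rho> unfolding prox_def prox_objective_def[abs_def] by simp
qed

lemma prox_P2: "0 < \<tau> \<Longrightarrow> \<mu> \<in> P2 \<Longrightarrow> prox G \<tau> \<mu> \<in> P2"
  using prox_argmin by (simp add: argmin_P2_iff)

text \<open>Meaningful where G is finite, as at resolvents; at an infinite value
  \<open>real_of_ereal\<close> would return 0.\<close>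

definition gap :: "'a measure \<Rightarrow> real" where
  "gap \<nu> = real_of_ereal (G \<nu>) - Gmin"

lemma G_prox:
  assumes \<tau>: "0 < \<tau>" and \<mu>: "\<mu> \<in> P2"
  shows "G (prox G \<tau> \<mu>) = ereal (Gmin + gap (prox G \<tau> \<mu>))"
proof -
  obtain m where m: "m \<in> P2" "G m = ereal Gmin" using argmin argmin_G by blast
  let ?\<rho> = "prox G \<tau> \<mu>"
  have "prox_objective \<tau> \<mu> ?\<rho> \<le> prox_objective \<tau> \<mu> m" using prox_argmin[OF \<tau> \<mu>] m by (auto simp: argmin_P2_iff)
  then show ?thesis
    using G_not_MInf[OF prox_P2[OF \<tau> \<mu>]] by (cases "G ?\<rho>") (auto simp: prox_objective_def m gap_def)
qed

lemma gap_prox_nonneg: "0 < \<tau> \<Longrightarrow> \<mu> \<in> P2 \<Longrightarrow> 0 \<le> gap (prox G \<tau> \<mu>)"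
  using G_prox[of \<tau> \<mu>] Gmin_le[OF prox_P2, of \<tau> \<mu>] by simp

text \<open>The first-order condition of the minimizer: moving a fraction t towards \<nu> along the
  geodesic based at \<mu> cannot lower the objective. Every \<nu> of finite value may be tested, so
  exact steps can serve as test points as well as minimizers.\<close>

lemma prox_EVI:
  assumes \<tau>: "0 < \<tau>" and \<mu>: "\<mu> \<in> P2" and \<nu>: "\<nu> \<in> P2" and h: "G \<nu> = ereal (Gmin + h)"
  shows "(W 2 (prox G \<tau> \<mu>) \<nu>)\<^sup>2 \<le> (W 2 \<mu> \<nu>)\<^sup>2 - (W 2 (prox G \<tau> \<mu>) \<mu>)\<^sup>2 - 2 * \<tau> * (gap (prox G \<tau> \<mu>) - h)"
proof -
  let ?\<rho> = "prox G \<tau> \<mu>"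
  define g where "g = gap ?\<rho>"
  have \<rho>: "?\<rho> \<in> P2" using prox_P2[OF \<tau> \<mu>] .
  have g: "G ?\<rho> = ereal (Gmin + g)" using G_prox[OF \<tau> \<mu>] by (simp add: g_def)
  define P Q R where "P = (W 2 ?\<rho> \<mu>)\<^sup>2" "Q = (W 2 \<mu> \<nu>)\<^sup>2" "R = (W 2 ?\<rho> \<nu>)\<^sup>2"
  have P: "(W 2 \<mu> ?\<rho>)\<^sup>2 = P" using W2_sym[OF \<mu> \<rho>] by (simp add: P_Q_R_def)
  \<comment> \<open>After division by t the factor 1 - t is still in front of R. Writing it as s
    gives a bound on \<open>s * R\<close> for all s in (0, 1), and the limit at s = 1 removes
    it.\<close>
  have "R \<le> Q - P - 2 * \<tau> * (g - h)"
  proof (rule field_le_mult_one_interval)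
    fix s :: real assume s: "0 < s" "s < 1"
    define t where "t = 1 - s"
    have t: "t \<in> {0..1}" "0 < t" "s = 1 - t" using s by (auto simp: t_def)
    obtain \<sigma> where \<sigma>: "\<sigma> \<in> P2" "G \<sigma> \<le> ereal ((1 - t) * (Gmin + g) + t * (Gmin + h))"
        "(W 2 \<sigma> \<mu>)\<^sup>2 \<le> (1 - t) * (W 2 \<mu> ?\<rho>)\<^sup>2 + t * (W 2 \<mu> \<nu>)\<^sup>2 - t * (1 - t) * (W 2 ?\<rho> \<nu>)\<^sup>2"
      using geodesic_point[OF \<rho> \<nu> \<mu> g h t(1)] .
    have \<sigma>3: "(W 2 \<sigma> \<mu>)\<^sup>2 \<le> (1 - t) * P + t * Q - t * (1 - t) * R"
      using \<sigma>(3) unfolding P by (simp add: P_Q_R_def)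
    have "prox_objective \<tau> \<mu> ?\<rho> \<le> prox_objective \<tau> \<mu> \<sigma>"
      using prox_argmin[OF \<tau> \<mu>] \<sigma>(1) by (simp add: argmin_P2_iff)
    also have "\<dots> \<le> ereal ((1 - t) * (Gmin + g) + t * (Gmin + h)) + ereal (1 / (2 * \<tau>) * (W 2 \<sigma> \<mu>)\<^sup>2)"
      unfolding prox_objective_def using \<sigma>(2) by (rule add_right_mono)
    finally have "Gmin + g + P / (2 * \<tau>) \<le> (1 - t) * (Gmin + g) + t * (Gmin + h) + (W 2 \<sigma> \<mu>)\<^sup>2 / (2 * \<tau>)"
      by (simp add: prox_objective_def g P_Q_R_def)
    then have "2 * \<tau> * (Gmin + g + P / (2 * \<tau>)) \<le> 2 * \<tau> * ((1 - t) * (Gmin + g) + t * (Gmin + h) + (W 2 \<sigma> \<mu>)\<^sup>2 / (2 * \<tau>))"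
      using \<tau> by (intro mult_left_mono) auto
    then have "2 * \<tau> * (Gmin + g) + P \<le> 2 * \<tau> * ((1 - t) * (Gmin + g) + t * (Gmin + h)) + (W 2 \<sigma> \<mu>)\<^sup>2"
      using \<tau> by (simp add: distrib_left)
    then have "2 * \<tau> * (Gmin + g) + P \<le> 2 * \<tau> * ((1 - t) * (Gmin + g) + t * (Gmin + h)) + ((1 - t) * P + t * Q - t * (1 - t) * R)"
      using \<sigma>3 by linarith
    then have "t * ((1 - t) * R) \<le> t * (Q - P - 2 * \<tau> * (g - h))"
      by (simp add: algebra_simps)
    then show "s * R \<le> Q - P - 2 * \<tau> * (g - h)" using t by simp
  qed
  then show ?thesis by (simp add: P_Q_R_def g_def)
qed

end

section \<open>Convergence of the iterates and of the values\<close>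

lemma LIMSEQ_by_subsubseq:
  fixes x :: "nat \<Rightarrow> 'a::metric_space"
  assumes "\<And>s. strict_mono (s :: nat \<Rightarrow> nat) \<Longrightarrow> \<exists>r. strict_mono (r :: nat \<Rightarrow> nat) \<and> (\<lambda>n. x (s (r n))) \<longlonglongrightarrow> l"
  shows "x \<longlonglongrightarrow> l"
proof (rule ccontr)
  assume "\<not> x \<longlonglongrightarrow> l"
  then obtain e where e: "0 < e" "\<not> (\<forall>\<^sub>F n in sequentially. dist (x n) l < e)"
    unfolding tendsto_iff by blast
  obtain s :: "nat \<Rightarrow> nat" where s: "strict_mono s" "\<And>n. \<not> dist (x (s n)) l < e"
    using not_eventually_sequentiallyD[OF e(2)] by blast
  obtain r :: "nat \<Rightarrow> nat" where r: "(\<lambda>n. x (s (r n))) \<longlonglongrightarrow> l" using assms[OF s(1)] by blast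
  then have "\<forall>\<^sub>F n in sequentially. dist (x (s (r n))) l < e" using e(1) by (rule tendstoD)
  then show False using s(2) by simp
qed

text \<open>Fatou's lemma yields lower bounds only. The sign s applies them to x and to -x, which
  gives both sides.\<close>

lemma LIMSEQ_by_lower_bounds:
  fixes x :: "nat \<Rightarrow> real"
  assumes "\<And>s e. \<bar>s\<bar> = 1 \<Longrightarrow> 0 < e \<Longrightarrow> \<forall>\<^sub>F n in sequentially. s * l - e < s * x n"
  shows "x \<longlonglongrightarrow> l"
proof (rule order_tendstoI)
  show "\<forall>\<^sub>F n in sequentially. a < x n" if "a < l" for a
    using assms[of 1 "l - a"] that by simp
  show "\<forall>\<^sub>F n in sequentially. x n < a" if "l < a" for a
    using assms[of "-1" "a - l"] that by simp
qed

text \<open>The decay of the quotient gives the bound outside a ball, and compactness gives it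
  inside. The factor \<eta> can be made as small as the bound on the moments demands.\<close>

lemma C2w_bound:
  fixes f :: "'a::euclidean_space \<Rightarrow> real"
  assumes f: "f \<in> C2w" and "0 < \<eta>"
  obtains B where "\<And>x. \<bar>f x\<bar> \<le> \<eta> * (norm x)\<^sup>2 + B"
proof -
  have "\<forall>\<^sub>F x in at_infinity. dist (f x / (1 + (norm x)\<^sup>2)) 0 < \<eta>"
    using f \<open>0 < \<eta>\<close> unfolding C2w_def by (intro tendstoD) auto
  then obtain b where b: "\<And>x. b \<le> norm x \<Longrightarrow> \<bar>f x / (1 + (norm x)\<^sup>2)\<bar> < \<eta>"
    unfolding eventually_at_infinity by auto
  have "continuous_on (cball 0 b) f" using f by (auto simp: C2w_def intro: continuous_on_subset)
  then have "bounded (f ` cball 0 b)" by (intro compact_imp_bounded compact_continuous_image) auto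
  then obtain K where K: "\<And>x. x \<in> cball 0 b \<Longrightarrow> \<bar>f x\<bar> \<le> K" unfolding bounded_iff image_iff real_norm_def by blast
  show ?thesis
  proof
    fix x :: 'a
    have nn: "0 \<le> \<eta> * (norm x)\<^sup>2" using \<open>0 < \<eta>\<close> by simp
    show "\<bar>f x\<bar> \<le> \<eta> * (norm x)\<^sup>2 + (\<eta> + \<bar>K\<bar>)"
    proof (cases "b \<le> norm x")
      case True
      have pos: "0 < 1 + (norm x)\<^sup>2" by (simp add: add_pos_nonneg)
      have "\<bar>f x\<bar> / (1 + (norm x)\<^sup>2) < \<eta>" using b[OF True] pos by (simp add: abs_divide)
      then have "\<bar>f x\<bar> < \<eta> * (1 + (norm x)\<^sup>2)" using pos by (simp add: pos_divide_less_eq)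
      then show ?thesis by (simp add: distrib_left)
    next
      case False
      then have "\<bar>f x\<bar> \<le> K" by (intro K) simp
      then show ?thesis using nn \<open>0 < \<eta>\<close> by linarith
    qed
  qed
qed

lemma powr_le_square_plus:
  fixes p \<eta> :: real
  assumes p: "0 < p" "p < 2" and "0 < \<eta>"
  obtains B where "\<And>t. 0 \<le> t \<Longrightarrow> t powr p \<le> \<eta> * t\<^sup>2 + B"
proof -
  \<comment> \<open>Beyond \<eta> to the power 1/(p - 2) the decreasing function t^(p - 2) is at
    most \<eta>. The maximum with 1 makes t positive in the second case.\<close>
  define T where "T = max 1 (\<eta> powr (1 / (p - 2)))"
  show ?thesis
  proof
    fix t :: real assume t: "0 \<le> t"
    show "t powr p \<le> \<eta> * t\<^sup>2 + T powr p"
    proof (cases "t \<le> T")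
      case True
      then have "t powr p \<le> T powr p" using t p by (intro powr_mono2) auto
      moreover have "0 \<le> \<eta> * t\<^sup>2" using \<open>0 < \<eta>\<close> by simp
      ultimately show ?thesis by linarith
    next
      case False
      then have t0: "0 < t" "\<eta> powr (1 / (p - 2)) \<le> t" by (auto simp: T_def)
      have "t powr (p - 2) \<le> (\<eta> powr (1 / (p - 2))) powr (p - 2)"
        using t0 p \<open>0 < \<eta>\<close> by (intro powr_mono2') auto
      also have "\<dots> = \<eta>" using p \<open>0 < \<eta>\<close> by (simp add: powr_powr)
      finally have "t powr (p - 2) * t powr 2 \<le> \<eta> * t powr 2" by (intro mult_right_mono) auto
      moreover have "t powr (p - 2) * t powr 2 = t powr p" unfolding powr_add[symmetric] by simp
      moreover have "t powr 2 = t\<^sup>2" using t0 by (intro powr_numeral) simp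
      ultimately have "t powr p \<le> \<eta> * t\<^sup>2" by simp
      then show ?thesis by (smt (verit) powr_ge_zero)
    qed
  qed
qed

text \<open>The growth of f is strictly below quadratic, so the escaping second moment is invisible
  to it: up to a constant, f is dominated by a multiple of the squared norm whose integral is at
  most \<eta>.\<close>

lemma as_conv_rep_C2w:
  fixes \<nu> :: "'a::euclidean_space measure"
  assumes rep: "as_conv_rep \<Omega> X Y \<mu> \<nu>" and P: "\<And>n. \<mu> n \<in> P2" "\<nu> \<in> P2" and C: "\<And>n. moment2 (\<mu> n) \<le> C"
    and f: "f \<in> C2w"
  shows "(\<lambda>n. integral\<^sup>L (\<mu> n) f) \<longlonglongrightarrow> integral\<^sup>L \<nu> f"
proof (rule LIMSEQ_by_lower_bounds)
  fix s e :: real assume s: "\<bar>s\<bar> = 1" and e: "0 < e"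
  interpret prob_space \<Omega> using as_conv_rep_D(1)[OF rep] .
  note m [measurable] = as_conv_rep_D(2,3)[OF rep]
  note sq = as_conv_rep_integrable_sq[OF rep]
  note mom = as_conv_rep_moment2[OF rep]
  have cont: "continuous_on UNIV f" using f by (simp add: C2w_def)
  then have [measurable]: "f \<in> borel_measurable borel" by (rule borel_measurable_continuous_onI)
  obtain B1 where B1: "\<And>x. \<bar>f x\<bar> \<le> 1 * (norm x)\<^sup>2 + B1" using C2w_bound[OF f, of 1] by auto
  have int: "integrable \<Omega> (\<lambda>w. f (Z w))" if [measurable]: "Z \<in> borel_measurable \<Omega>" and Z: "integrable \<Omega> (\<lambda>w. (norm (Z w))\<^sup>2)" for Z
  proof (rule Bochner_Integration.integrable_bound)
    show "integrable \<Omega> (\<lambda>w. (norm (Z w))\<^sup>2 + B1)" using Z by simp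
    show "AE w in \<Omega>. norm (f (Z w)) \<le> norm ((norm (Z w))\<^sup>2 + B1)"
      using B1 by (intro AE_I2) (smt (verit) real_norm_def)
  qed simp
  have "\<forall>\<^sub>F n in sequentially. (\<integral>w. s * f (Y w) \<partial>\<Omega>) - e < (\<integral>w. s * f (X n w) \<partial>\<Omega>)"
  proof (rule fatou_eventually_dominated)
    show "integrable \<Omega> (\<lambda>w. s * f (X n w))" "integrable \<Omega> (\<lambda>w. s * f (Y w))" for n
      by (intro integrable_mult_right int m sq P)+
    show "AE w in \<Omega>. (\<lambda>n. s * f (X n w)) \<longlonglongrightarrow> s * f (Y w)"
      using as_conv_rep_D(6)[OF rep]
      by eventually_elim (intro tendsto_intros continuous_on_tendsto_compose[OF cont], auto)
    fix \<eta> :: real assume "0 < \<eta>"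
    define l where "l = \<eta> / (\<bar>C\<bar> + 1)"
    have l: "0 < l" using \<open>0 < \<eta>\<close> by (simp add: l_def)
    have lC: "l * c \<le> \<eta>" if "c \<le> C" for c
    proof -
      have "l * c \<le> l * (\<bar>C\<bar> + 1)" using l that by (intro mult_left_mono) auto
      then show ?thesis by (simp add: l_def)
    qed
    obtain B where B: "\<And>x. \<bar>f x\<bar> \<le> l * (norm x)\<^sup>2 + B" using C2w_bound[OF f l] by auto
    show "\<exists>h k. (\<forall>n. integrable \<Omega> (h n)) \<and> integrable \<Omega> k \<and>
      (AE w in \<Omega>. (\<lambda>n. h n w) \<longlonglongrightarrow> k w) \<and> (\<forall>n. AE w in \<Omega>. 0 \<le> s * f (X n w) + h n w) \<and>
      (\<forall>n. integral\<^sup>L \<Omega> (h n) \<le> integral\<^sup>L \<Omega> k + \<eta>)"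
    proof (intro exI conjI allI)
      let ?h = "\<lambda>n w. l * (norm (X n w))\<^sup>2 + B"
      let ?k = "\<lambda>w. l * (norm (Y w))\<^sup>2 + B"
      show "integrable \<Omega> (?h n)" "integrable \<Omega> ?k" for n using sq P by simp_all
      show "AE w in \<Omega>. (\<lambda>n. ?h n w) \<longlonglongrightarrow> ?k w"
        using as_conv_rep_D(6)[OF rep] by eventually_elim (intro tendsto_intros)
      show "AE w in \<Omega>. 0 \<le> s * f (X n w) + ?h n w" for n
      proof (rule AE_I2)
        fix w
        have "\<bar>s * f (X n w)\<bar> \<le> ?h n w" using B[of "X n w"] s by (simp add: abs_mult)
        then show "0 \<le> s * f (X n w) + ?h n w" by linarith
      qed
      show "integral\<^sup>L \<Omega> (?h n) \<le> integral\<^sup>L \<Omega> ?k + \<eta>" for n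
      proof -
        have "integral\<^sup>L \<Omega> (?h n) = l * moment2 (\<mu> n) + B" "integral\<^sup>L \<Omega> ?k = l * moment2 \<nu> + B"
          using sq P by (simp_all add: mom prob_space)
        moreover have "0 \<le> l * moment2 \<nu>" using l moment2_nonneg[of \<nu>] by simp
        ultimately show ?thesis using lC[OF C[of n]] by linarith
      qed
    qed
  qed (use e in auto)
  moreover have "integral\<^sup>L (\<mu> n) f = (\<integral>w. f (X n w) \<partial>\<Omega>)" "integral\<^sup>L \<nu> f = (\<integral>w. f (Y w) \<partial>\<Omega>)" for n
    by (simp_all add: as_conv_rep_D(4,5)[OF rep, symmetric] integral_distr)
  ultimately show "\<forall>\<^sub>F n in sequentially. s * integral\<^sup>L \<nu> f - e < s * integral\<^sup>L (\<mu> n) f" by simp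
qed

text \<open>\<open>X n\<close> and Y form a coupling whose distance tends to 0 almost surely. Its
  second moments are bounded, so for p < 2 its p-th powers are uniformly integrable.\<close>

lemma as_conv_rep_W_tendsto:
  fixes \<nu> :: "'a::euclidean_space measure"
  assumes rep: "as_conv_rep \<Omega> X Y \<mu> \<nu>" and P: "\<And>n. \<mu> n \<in> P2" "\<nu> \<in> P2" and C: "\<And>n. moment2 (\<mu> n) \<le> C"
    and p: "0 < p" "p < 2"
  shows "(\<lambda>n. W p (\<mu> n) \<nu>) \<longlonglongrightarrow> 0"
proof -
  interpret prob_space \<Omega> using as_conv_rep_D(1)[OF rep] .
  note m [measurable] = as_conv_rep_D(2,3)[OF rep]
  note sq = as_conv_rep_integrable_sq[OF rep]
  note mom = as_conv_rep_moment2[OF rep]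
  define D where "D n w = norm (X n w - Y w)" for n w
  have [measurable]: "D n \<in> borel_measurable \<Omega>" for n unfolding D_def by measurable
  have D0: "0 \<le> D n w" for n w by (simp add: D_def)
  have Dsq: "integrable \<Omega> (\<lambda>w. (D n w)\<^sup>2)" for n
    unfolding D_def by (intro integrable_norm_diff_sq m sq P)
  define C' where "C' = 2 * C + 2 * moment2 \<nu>"
  have DC: "(\<integral>w. (D n w)\<^sup>2 \<partial>\<Omega>) \<le> C'" for n
  proof -
    have "(\<integral>w. (D n w)\<^sup>2 \<partial>\<Omega>) \<le> (\<integral>w. 2 * (norm (X n w))\<^sup>2 + 2 * (norm (Y w))\<^sup>2 \<partial>\<Omega>)"
      using Dsq sq P norm_diff_sq_le unfolding D_def by (intro integral_mono) auto
    also have "\<dots> = 2 * moment2 (\<mu> n) + 2 * moment2 \<nu>" using sq P by (simp add: mom)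
    finally show ?thesis using C[of n] by (simp add: C'_def)
  qed
  have Dlim: "AE w in \<Omega>. (\<lambda>n. D n w) \<longlonglongrightarrow> 0"
    using as_conv_rep_D(6)[OF rep]
  proof eventually_elim
    case (elim w)
    have "(\<lambda>n. norm (X n w - Y w)) \<longlonglongrightarrow> norm (Y w - Y w)" by (intro tendsto_intros elim)
    then show ?case by (simp add: D_def)
  qed
  obtain B1 where B1: "\<And>t. 0 \<le> t \<Longrightarrow> t powr p \<le> 1 * t\<^sup>2 + B1"
    using powr_le_square_plus[OF p, of 1] by auto
  have int: "integrable \<Omega> (\<lambda>w. D n w powr p)" for n
  proof (rule Bochner_Integration.integrable_bound)
    show "integrable \<Omega> (\<lambda>w. (D n w)\<^sup>2 + B1)" using Dsq by simp
    show "AE w in \<Omega>. norm (D n w powr p) \<le> norm ((D n w)\<^sup>2 + B1)"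
    proof (rule AE_I2)
      fix w
      show "norm (D n w powr p) \<le> norm ((D n w)\<^sup>2 + B1)" using B1[OF D0[of n w]] by simp
    qed
  qed simp
  show ?thesis
  proof (rule order_tendstoI)
    fix a :: real assume "0 < a"
    \<comment> \<open>An upper bound is wanted, so Fatou's lemma is applied to the negative of the
      p-th power. The error is \<open>a powr p\<close> because it bounds the p-th power of the
      distance.\<close>
    have "\<forall>\<^sub>F n in sequentially. (\<integral>w. - (0::real) \<partial>\<Omega>) - a powr p < (\<integral>w. - (D n w powr p) \<partial>\<Omega>)"
    proof (rule fatou_eventually_dominated)
      show "integrable \<Omega> (\<lambda>w. - (D n w powr p))" for n using int by simp
      show "AE w in \<Omega>. (\<lambda>n. - (D n w powr p)) \<longlonglongrightarrow> - 0"
        using Dlim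
      proof eventually_elim
        case (elim w)
        have "(\<lambda>n. D n w powr p) \<longlonglongrightarrow> 0"
          using elim D0 p by (intro tendsto_zero_powrI[where b = p]) auto
        then show ?case by (rule tendsto_minus)
      qed
      fix \<eta> :: real assume "0 < \<eta>"
      define l where "l = \<eta> / (\<bar>C'\<bar> + 1)"
      have l: "0 < l" using \<open>0 < \<eta>\<close> by (simp add: l_def)
      have lC: "l * c \<le> \<eta>" if "c \<le> C'" for c
      proof -
        have "l * c \<le> l * (\<bar>C'\<bar> + 1)" using l that by (intro mult_left_mono) auto
        then show ?thesis by (simp add: l_def)
      qed
      obtain B where B: "\<And>t. 0 \<le> t \<Longrightarrow> t powr p \<le> l * t\<^sup>2 + B" using powr_le_square_plus[OF p l] by auto
      show "\<exists>h k. (\<forall>n. integrable \<Omega> (h n)) \<and> integrable \<Omega> k \<and>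
        (AE w in \<Omega>. (\<lambda>n. h n w) \<longlonglongrightarrow> k w) \<and> (\<forall>n. AE w in \<Omega>. 0 \<le> - (D n w powr p) + h n w) \<and>
        (\<forall>n. integral\<^sup>L \<Omega> (h n) \<le> integral\<^sup>L \<Omega> k + \<eta>)"
      proof (intro exI conjI allI)
        let ?h = "\<lambda>n w. l * (D n w)\<^sup>2 + B"
        let ?k = "\<lambda>w. l * 0\<^sup>2 + B"
        show "integrable \<Omega> (?h n)" "integrable \<Omega> ?k" for n using Dsq by simp_all
        show "AE w in \<Omega>. (\<lambda>n. ?h n w) \<longlonglongrightarrow> ?k w"
          using Dlim by eventually_elim (intro tendsto_intros)
        show "AE w in \<Omega>. 0 \<le> - (D n w powr p) + ?h n w" for n
          using B[OF D0] by (intro AE_I2) simp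
        show "integral\<^sup>L \<Omega> (?h n) \<le> integral\<^sup>L \<Omega> ?k + \<eta>" for n
          using lC[OF DC[of n]] Dsq by (simp add: prob_space)
      qed
    qed (use \<open>0 < a\<close> in auto)
    then show "\<forall>\<^sub>F n in sequentially. W p (\<mu> n) \<nu> < a"
    proof (rule eventually_mono)
      fix n assume "(\<integral>w. - (0::real) \<partial>\<Omega>) - a powr p < (\<integral>w. - (D n w powr p) \<partial>\<Omega>)"
      then have "(\<integral>w. D n w powr p \<partial>\<Omega>) < a powr p" by simp
      moreover have "W p (\<mu> n) \<nu> powr p \<le> (\<integral>w. D n w powr p \<partial>\<Omega>)"
        using as_conv_rep_D[OF rep] int p unfolding D_def by (intro W_powr_le) auto
      ultimately have "W p (\<mu> n) \<nu> powr p < a powr p" by simp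
      then show "W p (\<mu> n) \<nu> < a"
        using powr_mono2[of p a "W p (\<mu> n) \<nu>"] p \<open>0 < a\<close> by (meson less_imp_le not_le)
    qed
  next
    fix a :: real assume "a < 0"
    then show "\<forall>\<^sub>F n in sequentially. a < W p (\<mu> n) \<nu>"
      using W_nonneg by (intro always_eventually allI) (rule less_le_trans)
  qed
qed

section \<open>Real sequences and asymptotic bounds\<close>

lemma quasi_fejer_convergent:
  fixes a e :: "nat \<Rightarrow> real"
  assumes step: "\<And>n. a (Suc n) \<le> a n + e n" and "\<And>n. 0 \<le> a n" and e: "\<And>n. 0 \<le> e n" "summable e"
  shows "convergent a"
proof -
  \<comment> \<open>Subtracting the accumulated errors makes the sequence decreasing, and their
    total bounds it from below.\<close>
  define b where "b n = a n - (\<Sum>i<n. e i)" for n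
  have "decseq b" using step by (intro decseq_SucI) (simp add: b_def algebra_simps)
  moreover have "- suminf e \<le> b n" for n
    using sum_le_suminf[OF e(2), of "{..<n}"] e(1) assms(2)[of n] by (simp add: b_def)
  ultimately obtain L where "b \<longlonglongrightarrow> L" using decseq_convergent by blast
  then have "(\<lambda>n. b n + (\<Sum>i<n. e i)) \<longlonglongrightarrow> L + suminf e"
    by (intro tendsto_add summable_LIMSEQ e)
  then show ?thesis by (auto simp: b_def convergent_def)
qed

lemma filterlim_sum_at_top:
  fixes t :: "nat \<Rightarrow> real"
  assumes "\<And>n. 0 \<le> t n" "\<not> summable t"
  shows "filterlim (\<lambda>n. \<Sum>i<n. t i) at_top sequentially"
proof (rule ccontr)
  assume "\<not> ?thesis"
  then obtain Z where Z: "\<not> (\<forall>\<^sub>F n in sequentially. Z \<le> (\<Sum>i<n. t i))" unfolding filterlim_at_top by blast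
  have "(\<Sum>i<n. t i) \<le> Z" for n
  proof (rule ccontr)
    assume n: "\<not> (\<Sum>i<n. t i) \<le> Z"
    have "\<forall>\<^sub>F k in sequentially. Z \<le> (\<Sum>i<k. t i)"
      using eventually_ge_at_top[of n]
    proof (rule eventually_mono)
      fix k assume "n \<le> k"
      then have "(\<Sum>i<n. t i) \<le> (\<Sum>i<k. t i)" using assms(1) by (intro sum_mono2) auto
      with n show "Z \<le> (\<Sum>i<k. t i)" by simp
    qed
    with Z show False by simp
  qed
  then have "summable t" using assms(1) by (intro bounded_imp_summable[of t Z])
    (metis lessThan_Suc_atMost)+
  with assms(2) show False by simp
qed

text \<open>Indices start at 1: the sum of the first 0 step sizes is 0, and the comparison function
  1/0 = 0 says nothing useful there.\<close>

lemma ereal_bigo_of_real: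
  assumes "\<And>n. 1 \<le> n \<Longrightarrow> f n = ereal (x n)" "\<And>n. 1 \<le> n \<Longrightarrow> 0 \<le> x n"
    and "\<And>n. 1 \<le> n \<Longrightarrow> 0 < s n" "\<And>n. 1 \<le> n \<Longrightarrow> s n * x n \<le> K"
  shows "ereal_bigo f (\<lambda>n. 1 / s n)"
  unfolding ereal_bigo_def
proof
  show "\<forall>\<^sub>F n in sequentially. \<bar>f n\<bar> \<noteq> \<infinity>"
    using eventually_ge_at_top[of 1] by (rule eventually_mono) (simp add: assms(1))
  show "(\<lambda>n. real_of_ereal (f n)) \<in> O(\<lambda>n. 1 / s n)"
  proof (rule bigoI)
    show "\<forall>\<^sub>F n in sequentially. norm (real_of_ereal (f n)) \<le> K * norm (1 / s n)"
      using eventually_ge_at_top[of 1]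
    proof (rule eventually_mono)
      fix n :: nat assume n: "1 \<le> n"
      have "x n \<le> K / s n" using assms(3,4)[OF n] by (simp add: pos_le_divide_eq mult.commute)
      then show "norm (real_of_ereal (f n)) \<le> K * norm (1 / s n)"
        using assms(1-3)[OF n] by simp
    qed
  qed
qed

lemma argmin_P2_is_P2: "m \<in> argmin_P2 H \<Longrightarrow> m \<in> P2"
  by (simp add: argmin_P2_iff)

section \<open>The inexact proximal point iteration and its rates\<close>

locale inexact_proximal_point = convex_functional G for G :: "'a::euclidean_space measure \<Rightarrow> ereal" +
  fixes \<epsilon> \<tau> :: "nat \<Rightarrow> real" and \<mu> :: "nat \<Rightarrow> 'a measure"
  assumes eps_nonneg: "\<And>n. 0 \<le> \<epsilon> n" and eps_summable: "summable \<epsilon>"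
    and tau_pos: "\<And>n. 0 < \<tau> n" and tau_diverges: "\<not> summable \<tau>"
    and iterate_P2: "\<And>n. \<mu> n \<in> P2"
    and step: "\<And>n. W 2 (\<mu> (Suc n)) (prox G (\<tau> n) (\<mu> n)) \<le> \<epsilon> n"
begin

definition exact :: "nat \<Rightarrow> 'a measure" where
  "exact n = prox G (\<tau> n) (\<mu> n)"

definition total_time :: "nat \<Rightarrow> real" where
  "total_time n = (\<Sum>i<n. \<tau> i)"

lemma exact_P2: "exact n \<in> P2"
  unfolding exact_def by (intro prox_P2 tau_pos iterate_P2)

lemma G_exact: "G (exact n) = ereal (Gmin + gap (exact n))"
  unfolding exact_def by (intro G_prox tau_pos iterate_P2)

lemma gap_exact_nonneg: "0 \<le> gap (exact n)"
  unfolding exact_def by (intro gap_prox_nonneg tau_pos iterate_P2)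

lemma total_time_pos: "1 \<le> n \<Longrightarrow> 0 < total_time n"
  unfolding total_time_def using tau_pos by (intro sum_pos) (auto simp: lessThan_empty_iff)

lemma exact_EVI:
  assumes m: "m \<in> argmin_P2 G"
  shows "(W 2 (exact n) m)\<^sup>2 \<le> (W 2 (\<mu> n) m)\<^sup>2 - (W 2 (exact n) (\<mu> n))\<^sup>2 - 2 * \<tau> n * gap (exact n)"
  using prox_EVI[OF tau_pos[of n] iterate_P2[of n], of m 0] m
  by (simp add: argmin_G exact_def)

lemma exact_W2_le:
  assumes m: "m \<in> argmin_P2 G"
  shows "W 2 (exact n) m \<le> W 2 (\<mu> n) m"
proof (rule power2_le_imp_le[OF _ W_nonneg])
  have "0 \<le> 2 * \<tau> n * gap (exact n)" using tau_pos[of n] gap_exact_nonneg[of n] by simp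
  then show "(W 2 (exact n) m)\<^sup>2 \<le> (W 2 (\<mu> n) m)\<^sup>2"
    using exact_EVI[OF m, of n] zero_le_power2[of "W 2 (exact n) (\<mu> n)"] by linarith
qed

lemma W2_next_le:
  assumes "m \<in> P2"
  shows "W 2 (\<mu> (Suc n)) m \<le> W 2 (exact n) m + \<epsilon> n"
  using W2_triangle[OF iterate_P2 assms exact_P2, of "Suc n" n] step[of n] by (simp add: exact_def)

text \<open>The exact step does not increase the distance to a minimizer and the perturbation adds
  at most \<open>\<epsilon> n\<close>, which is summable.\<close>

lemma W2_argmin_convergent:
  assumes m: "m \<in> argmin_P2 G"
  shows "convergent (\<lambda>n. W 2 (\<mu> n) m)"
proof (rule quasi_fejer_convergent[OF _ W_nonneg eps_nonneg eps_summable])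
  show "W 2 (\<mu> (Suc n)) m \<le> W 2 (\<mu> n) m + \<epsilon> n" for n
    using W2_next_le[OF argmin_P2_is_P2[OF m], of n] exact_W2_le[OF m, of n] by simp
qed

lemma W2_bounded:
  assumes "\<nu> \<in> P2"
  obtains B where "\<And>n. W 2 (\<mu> n) \<nu> \<le> B" "\<And>n. W 2 (exact n) \<nu> \<le> B"
proof -
  obtain m where m: "m \<in> argmin_P2 G" using argmin by blast
  note mP = argmin_P2_is_P2[OF m]
  obtain R where R: "\<And>n. \<bar>W 2 (\<mu> n) m\<bar> \<le> R"
    using convergent_imp_Bseq[OF W2_argmin_convergent[OF m]] by (auto simp: Bseq_def)
  have "W 2 (\<mu> n) \<nu> \<le> R + W 2 m \<nu>" for n
    using W2_triangle[OF iterate_P2 assms mP, of n] R[of n] by simp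
  moreover have "W 2 (exact n) \<nu> \<le> R + W 2 m \<nu>" for n
    using W2_triangle[OF exact_P2 assms mP, of n] exact_W2_le[OF m, of n] R[of n] by simp
  ultimately show ?thesis by (rule that)
qed

lemma moments_bounded:
  obtains C where "\<And>n. moment2 (\<mu> n) \<le> C"
proof -
  obtain m where "m \<in> argmin_P2 G" using argmin by blast
  then have m: "m \<in> P2" by (rule argmin_P2_is_P2)
  obtain B where B: "\<And>n. W 2 (\<mu> n) m \<le> B" using W2_bounded[OF m] by metis
  have "moment2 (\<mu> n) \<le> 2 * B\<^sup>2 + 2 * moment2 m" for n
  proof -
    have "(W 2 (\<mu> n) m)\<^sup>2 \<le> B\<^sup>2" using B W_nonneg by (intro power_mono)
    then show ?thesis using moment2_le[OF iterate_P2 m, of n] by linarith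
  qed
  then show ?thesis by (rule that)
qed

text \<open>The variational inequality telescopes once the square of the perturbed distance is
  expanded. The cross term is a summable error because the distances to a minimizer are
  bounded.\<close>

lemma energy_bounded:
  obtains K where "\<And>n. (\<Sum>i<n. (W 2 (exact i) (\<mu> i))\<^sup>2) \<le> K" "\<And>n. (\<Sum>i<n. \<tau> i * gap (exact i)) \<le> K"
proof -
  obtain m where m: "m \<in> argmin_P2 G" using argmin by blast
  note mP = argmin_P2_is_P2[OF m]
  obtain R where R: "\<And>n. W 2 (\<mu> n) m \<le> R" "\<And>n. W 2 (exact n) m \<le> R"
    using W2_bounded[OF mP] by metis
  obtain E where E: "\<And>n. \<bar>\<epsilon> n\<bar> \<le> E"
    using convergent_imp_Bseq[OF summable_LIMSEQ_zero[OF eps_summable, THEN convergentI]] by (auto simp: Bseq_def)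
  \<comment> \<open>(x + \<epsilon>)^2 = x^2 + (2x + \<epsilon>) \<epsilon>, where the distance x is
    at most R and the error \<epsilon> at most E.\<close>
  define e where "e n = (2 * R + E) * \<epsilon> n" for n
  have e: "summable e" unfolding e_def by (intro summable_mult eps_summable)
  have RE: "0 \<le> 2 * R + E" using R(1)[of 0] E[of 0] W_nonneg[of 2 "\<mu> 0" m] by linarith
  have e0: "0 \<le> e n" for n unfolding e_def using RE eps_nonneg by simp
  \<comment> \<open>Both dissipation terms are nonnegative and go into one sum, so that a single
    constant bounds each of them.\<close>
  define d where "d i = (W 2 (exact i) (\<mu> i))\<^sup>2 + 2 * (\<tau> i * gap (exact i))" for i
  have one: "(W 2 (\<mu> (Suc n)) m)\<^sup>2 + d n \<le> (W 2 (\<mu> n) m)\<^sup>2 + e n" for n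
  proof -
    have "(W 2 (\<mu> (Suc n)) m)\<^sup>2 \<le> (W 2 (exact n) m + \<epsilon> n)\<^sup>2"
      using W2_next_le[OF mP] W_nonneg by (intro power_mono)
    also have "\<dots> = (W 2 (exact n) m)\<^sup>2 + (2 * W 2 (exact n) m + \<epsilon> n) * \<epsilon> n"
      by (simp add: power2_eq_square algebra_simps)
    also have "(2 * W 2 (exact n) m + \<epsilon> n) * \<epsilon> n \<le> e n"
    proof -
      have "2 * W 2 (exact n) m + \<epsilon> n \<le> 2 * R + E" using R(2)[of n] E[of n] by linarith
      then show ?thesis unfolding e_def using eps_nonneg by (intro mult_right_mono)
    qed
    finally show ?thesis using exact_EVI[OF m, of n] by (simp add: d_def)
  qed
  have "(W 2 (\<mu> n) m)\<^sup>2 + (\<Sum>i<n. d i) \<le> (W 2 (\<mu> 0) m)\<^sup>2 + (\<Sum>i<n. e i)" for n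
  proof (induction n)
    case (Suc n)
    then show ?case using one[of n] by simp
  qed simp
  moreover have "(\<Sum>i<n. e i) \<le> suminf e" for n
    by (rule sum_le_suminf[OF e]) (use e0 in auto)
  ultimately have sum_d: "(\<Sum>i<n. d i) \<le> (W 2 (\<mu> 0) m)\<^sup>2 + suminf e" for n
    using zero_le_power2[of "W 2 (\<mu> n) m"] by (meson add_increasing add_left_mono order_trans order_refl)
  have nn: "0 \<le> \<tau> i * gap (exact i)" for i using tau_pos[of i] gap_exact_nonneg[of i] by simp
  have le: "(W 2 (exact i) (\<mu> i))\<^sup>2 \<le> d i" "\<tau> i * gap (exact i) \<le> d i" for i
    using nn[of i] zero_le_power2[of "W 2 (exact i) (\<mu> i)"] unfolding d_def by linarith+
  show ?thesis
    by (rule that; rule order_trans[OF sum_mono sum_d]; rule le)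
qed

text \<open>The average of the gaps with weights \<open>\<tau> i\<close> is at most K divided by
  \<open>total_time n\<close>, and the best iterate does not exceed the average.\<close>

theorem best_iterate_rate:
  assumes j: "\<forall>n\<ge>1. is_arg_min (\<lambda>i. G (exact i)) (\<lambda>i. i < n) (j n)"
  shows "ereal_bigo (\<lambda>n. G (exact (j n)) - (INF \<nu>\<in>P2. G \<nu>)) (\<lambda>n. 1 / total_time n)"
proof -
  obtain K where K: "\<And>n. (\<Sum>i<n. \<tau> i * gap (exact i)) \<le> K" using energy_bounded by metis
  show ?thesis
  proof (rule ereal_bigo_of_real[where K = K])
    show "G (exact (j n)) - (INF \<nu>\<in>P2. G \<nu>) = ereal (gap (exact (j n)))" for n
      unfolding INF_G G_exact by simp
    fix n :: nat assume n: "1 \<le> n"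
    have "gap (exact (j n)) \<le> gap (exact i)" if "i < n" for i
    proof -
      have "G (exact (j n)) \<le> G (exact i)" using j n that by (simp add: is_arg_min_linorder)
      then show ?thesis by (simp add: G_exact)
    qed
    then have "(\<Sum>i<n. \<tau> i * gap (exact (j n))) \<le> (\<Sum>i<n. \<tau> i * gap (exact i))"
      using tau_pos by (intro sum_mono mult_left_mono) (auto intro: less_imp_le)
    then show "total_time n * gap (exact (j n)) \<le> K"
      using K[of n] by (simp add: total_time_def sum_distrib_right)
  qed (use gap_exact_nonneg total_time_pos in auto)
qed

text \<open>The previous exact point is tested against the new base \<open>\<mu> (Suc n)\<close>,
  from which it has distance at most \<open>\<epsilon> n\<close>.\<close>

lemma gap_step:
  "2 * \<tau> (Suc n) * (gap (exact (Suc n)) - gap (exact n)) \<le> (\<epsilon> n)\<^sup>2"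
proof -
  have "(W 2 (exact (Suc n)) (exact n))\<^sup>2 \<le> (W 2 (\<mu> (Suc n)) (exact n))\<^sup>2
      - (W 2 (exact (Suc n)) (\<mu> (Suc n)))\<^sup>2 - 2 * \<tau> (Suc n) * (gap (exact (Suc n)) - gap (exact n))"
    unfolding exact_def[of "Suc n"] by (intro prox_EVI tau_pos iterate_P2 exact_P2 G_exact)
  moreover have "(W 2 (\<mu> (Suc n)) (exact n))\<^sup>2 \<le> (\<epsilon> n)\<^sup>2"
    using step[of n] W_nonneg by (intro power_mono) (auto simp: exact_def)
  ultimately show ?thesis
    using zero_le_power2[of "W 2 (exact (Suc n)) (exact n)"]
      zero_le_power2[of "W 2 (exact (Suc n)) (\<mu> (Suc n))"] by linarith
qed

text \<open>The product of elapsed time and gap grows in one step by at most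
  \<open>\<tau> n * gap (exact n)\<close>, which is controlled by the energy, plus elapsed time
  multiplied by the possible increase of the gap. The latter is the origin of the summability
  condition.\<close>

lemma last_iterate_bound:
  assumes s: "summable (\<lambda>n. total_time (Suc n) / \<tau> (Suc n) * (\<epsilon> n)\<^sup>2)"
  obtains K where "\<And>n. total_time n * gap (exact n) \<le> K"
proof -
  let ?s = "\<lambda>n. total_time (Suc n) / \<tau> (Suc n) * (\<epsilon> n)\<^sup>2"
  obtain K where K: "\<And>n. (\<Sum>i<n. \<tau> i * gap (exact i)) \<le> K" using energy_bounded by metis
  have s0: "0 \<le> ?s n" for n
    using tau_pos[of "Suc n"] total_time_pos[of "Suc n"] by simp
  have one: "total_time (Suc n) * gap (exact (Suc n)) \<le> total_time n * gap (exact n) + \<tau> n * gap (exact n) + ?s n" for n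
  proof -
    have t: "0 < \<tau> (Suc n)" "0 < total_time (Suc n)" using tau_pos total_time_pos by auto
    have "gap (exact (Suc n)) - gap (exact n) \<le> (\<epsilon> n)\<^sup>2 / (2 * \<tau> (Suc n))"
      using gap_step[of n] t by (simp add: pos_le_divide_eq mult.commute)
    \<comment> \<open>The factor 1/2 is given up to match the terms of the assumed series.\<close>
    also have "\<dots> \<le> (\<epsilon> n)\<^sup>2 / \<tau> (Suc n)" using t by (intro divide_left_mono) auto
    finally have "total_time (Suc n) * (gap (exact (Suc n)) - gap (exact n)) \<le> total_time (Suc n) * ((\<epsilon> n)\<^sup>2 / \<tau> (Suc n))"
      using t by (intro mult_left_mono) auto
    moreover have "total_time (Suc n) * gap (exact n) = total_time n * gap (exact n) + \<tau> n * gap (exact n)"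
      by (simp add: total_time_def distrib_right)
    ultimately show ?thesis by (simp add: right_diff_distrib)
  qed
  have "total_time n * gap (exact n) \<le> (\<Sum>i<n. \<tau> i * gap (exact i)) + (\<Sum>i<n. ?s i)" for n
  proof (induction n)
    case (Suc n)
    then show ?case using one[of n] by simp
  qed (simp add: total_time_def)
  moreover have "(\<Sum>i<n. ?s i) \<le> suminf ?s" for n
    by (rule sum_le_suminf[OF s]) (use s0 in auto)
  ultimately have "total_time n * gap (exact n) \<le> K + suminf ?s" for n
    by (rule order_trans[OF _ add_mono[OF K]])
  then show ?thesis by (rule that)
qed

theorem last_iterate_rate:
  assumes s: "summable (\<lambda>n. total_time (Suc n) / \<tau> (Suc n) * (\<epsilon> n)\<^sup>2)"
  shows "ereal_bigo (\<lambda>n. G (exact n) - (INF \<nu>\<in>P2. G \<nu>)) (\<lambda>n. 1 / total_time n)"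
proof -
  obtain K where K: "\<And>n. total_time n * gap (exact n) \<le> K" using last_iterate_bound[OF s] by blast
  show ?thesis
  proof (rule ereal_bigo_of_real[where K = K])
    show "G (exact n) - (INF \<nu>\<in>P2. G \<nu>) = ereal (gap (exact n))" for n
      unfolding INF_G G_exact by simp
  qed (use gap_exact_nonneg total_time_pos K in auto)
qed

section \<open>Cluster points and convergence of the iterates\<close>

lemma gap_tendsto_0:
  assumes s: "summable (\<lambda>n. total_time (Suc n) / \<tau> (Suc n) * (\<epsilon> n)\<^sup>2)"
  shows "(\<lambda>n. gap (exact n)) \<longlonglongrightarrow> 0"
proof -
  obtain K where K: "\<And>n. total_time n * gap (exact n) \<le> K" using last_iterate_bound[OF s] by blast
  have "filterlim total_time at_top sequentially"
    unfolding total_time_def[abs_def] using tau_pos tau_diverges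
    by (intro filterlim_sum_at_top) (auto intro: less_imp_le)
  then have "(\<lambda>n. K / total_time n) \<longlonglongrightarrow> 0"
    by (rule real_tendsto_divide_at_top[OF tendsto_const])
  then show ?thesis
  proof (rule Lim_null_comparison[rotated])
    show "\<forall>\<^sub>F n in sequentially. norm (gap (exact n)) \<le> K / total_time n"
      using eventually_ge_at_top[of 1]
    proof (rule eventually_mono)
      fix n :: nat assume "1 \<le> n"
      then show "norm (gap (exact n)) \<le> K / total_time n"
        using K[of n] gap_exact_nonneg[of n] total_time_pos[of n] by (simp add: pos_le_divide_eq mult.commute)
    qed
  qed
qed

lemma W2_exact_iterate_tendsto_0: "(\<lambda>n. W 2 (exact n) (\<mu> n)) \<longlonglongrightarrow> 0"
proof -
  obtain K where K: "\<And>n. (\<Sum>i<n. (W 2 (exact i) (\<mu> i))\<^sup>2) \<le> K" using energy_bounded by metis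
  have "summable (\<lambda>i. (W 2 (exact i) (\<mu> i))\<^sup>2)"
  proof (rule bounded_imp_summable[of _ K])
    show "(\<Sum>k\<le>n. (W 2 (exact k) (\<mu> k))\<^sup>2) \<le> K" for n
      using K[of "Suc n"] by (simp only: lessThan_Suc_atMost)
  qed simp
  then have "(\<lambda>n. sqrt ((W 2 (exact n) (\<mu> n))\<^sup>2)) \<longlonglongrightarrow> sqrt 0"
    by (intro tendsto_real_sqrt summable_LIMSEQ_zero)
  then show ?thesis by (simp add: W_nonneg)
qed

text \<open>The cluster point \<open>\<nu>\<close> is a fixed point of \<open>prox G 1\<close>, since otherwise the variational
  inequality at \<open>\<nu>\<close> tested with the iterates contradicts Opial's property. No lower
  semicontinuity of \<open>G\<close> under narrow convergence is needed.\<close>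

lemma cluster_point_argmin:
  assumes gap0: "(\<lambda>n. gap (exact n)) \<longlonglongrightarrow> 0" and r: "strict_mono r"
    and rep: "as_conv_rep \<Omega> X Y (\<lambda>n. \<mu> (r n)) \<nu>"
  shows "\<nu> \<in> argmin_P2 G"
proof -
  obtain C where C: "\<And>n. moment2 (\<mu> n) \<le> C" using moments_bounded by blast
  have \<nu>: "\<nu> \<in> P2" using as_conv_rep_limit_P2[OF rep iterate_P2 C] .
  define \<rho> where "\<rho> = prox G 1 \<nu>"
  have \<rho>: "\<rho> \<in> P2" unfolding \<rho>_def by (intro prox_P2 \<nu>) simp
  have gap\<rho>: "0 \<le> gap \<rho>" unfolding \<rho>_def by (intro gap_prox_nonneg \<nu>) simp
  obtain B1 where B1: "\<And>n. W 2 (exact n) \<rho> \<le> B1" using W2_bounded[OF \<rho>] by metis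
  obtain B2 where B2: "\<And>n. W 2 (\<mu> n) \<nu> \<le> B2" using W2_bounded[OF \<nu>] by metis
  define w where "w n = W 2 (exact n) (\<mu> n)" for n
  have w0: "0 \<le> w n" for n by (simp add: w_def W_nonneg)
  \<comment> \<open>The variational inequality at \<nu>, tested with \<open>exact n\<close>,
    controls the difference of squared distances from \<open>exact n\<close>. Passing to
    \<open>\<mu> n\<close> adds at most the two products with \<open>w n\<close>, and these vanish
    in the limit.\<close>
  define a where "a n = - (W 2 \<rho> \<nu>)\<^sup>2 + 2 * gap (exact n) + (2 * B1 + w n) * w n + (2 * B2 + w n) * w n" for n
  have main: "(W 2 (\<mu> n) \<rho>)\<^sup>2 - (W 2 (\<mu> n) \<nu>)\<^sup>2 \<le> a n" for n
  proof -
    have EVI: "(W 2 \<rho> (exact n))\<^sup>2 \<le> (W 2 \<nu> (exact n))\<^sup>2 - (W 2 \<rho> \<nu>)\<^sup>2 - 2 * 1 * (gap \<rho> - gap (exact n))"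
      unfolding \<rho>_def by (intro prox_EVI \<nu> exact_P2 G_exact) simp
    have sq: "x\<^sup>2 \<le> y\<^sup>2 + (2 * B + w n) * w n" if "x \<le> y + w n" "0 \<le> x" "y \<le> B" for x y B
    proof -
      have "x\<^sup>2 \<le> (y + w n)\<^sup>2" using that by (intro power_mono)
      also have "\<dots> = y\<^sup>2 + (2 * y + w n) * w n" by (simp add: power2_eq_square algebra_simps)
      also have "\<dots> \<le> y\<^sup>2 + (2 * B + w n) * w n" using that w0 by (intro add_left_mono mult_right_mono) auto
      finally show ?thesis .
    qed
    have "(W 2 (\<mu> n) \<rho>)\<^sup>2 \<le> (W 2 (exact n) \<rho>)\<^sup>2 + (2 * B1 + w n) * w n"
      using W2_triangle_base[OF iterate_P2 \<rho> exact_P2, of n n] B1[of n]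
      by (intro sq W_nonneg) (auto simp: w_def add.commute)
    moreover have "(W 2 (exact n) \<nu>)\<^sup>2 \<le> (W 2 (\<mu> n) \<nu>)\<^sup>2 + (2 * B2 + w n) * w n"
      using W2_triangle[OF exact_P2 \<nu> iterate_P2, of n n] B2[of n]
      by (intro sq W_nonneg) (auto simp: w_def add.commute)
    moreover have "x - c \<le> - d + 2 * h + u + v"
      if "x \<le> a + u" "b \<le> c + v" "a \<le> b - d - 2 * 1 * (g - h)" "0 \<le> g" for a b c d g h u v x :: real
      using that by argo
    ultimately show ?thesis
      using EVI gap\<rho> unfolding a_def W2_sym[OF \<rho> exact_P2] W2_sym[OF \<nu> exact_P2] by blast
  qed
  have "a \<longlonglongrightarrow> - (W 2 \<rho> \<nu>)\<^sup>2 + 2 * 0 + (2 * B1 + 0) * 0 + (2 * B2 + 0) * 0"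
    unfolding a_def[abs_def] w_def by (intro tendsto_intros gap0 W2_exact_iterate_tendsto_0)
  then have lim: "(\<lambda>n. a (r n)) \<longlonglongrightarrow> - (W 2 \<rho> \<nu>)\<^sup>2"
    using LIMSEQ_subseq_LIMSEQ[OF _ r, of a] by (simp add: o_def)
  \<comment> \<open>Opial's lower bound and the variational upper bound have opposite signs, so both
    squares are 0.\<close>
  have "(W 2 \<nu> \<rho>)\<^sup>2 \<le> - (W 2 \<rho> \<nu>)\<^sup>2"
    by (rule W2_opial[OF iterate_P2 \<rho> C rep main lim])
  then have "(W 2 \<nu> \<rho>)\<^sup>2 \<le> 0" using zero_le_power2[of "W 2 \<rho> \<nu>"] by linarith
  then have "W 2 \<nu> \<rho> = 0" by simp
  then have eq: "\<rho> = \<nu>" using W2_eq_0[OF \<nu> \<rho>] by simp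
  obtain m where m: "m \<in> P2" "G m = ereal (Gmin + 0)" using argmin argmin_G by auto
  \<comment> \<open>At the fixed point the two distances to m agree, so testing with a minimizer
    leaves a nonpositive gap.\<close>
  have "(W 2 \<rho> m)\<^sup>2 \<le> (W 2 \<nu> m)\<^sup>2 - (W 2 \<rho> \<nu>)\<^sup>2 - 2 * 1 * (gap \<rho> - 0)"
    unfolding \<rho>_def by (intro prox_EVI \<nu> m) simp
  then have "gap \<rho> \<le> 0" using W2_self[OF \<nu>] by (simp add: eq)
  then have "gap \<rho> = 0" using gap\<rho> by simp
  moreover have "G \<rho> = ereal (Gmin + gap \<rho>)" unfolding \<rho>_def by (intro G_prox \<nu>) simp
  ultimately show ?thesis using \<nu> by (simp add: argmin_G eq)
qed

text \<open>The distances to both minimizers converge along the full sequence, so the limits d and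
  d' are the same on either subsequence. Opial's property then bounds the squared distance of \<nu>
  and \<nu>' by d'^2 - d^2 and also by its negative.\<close>

lemma cluster_points_equal:
  assumes r: "strict_mono r" "strict_mono r'"
    and rep: "as_conv_rep \<Omega> X Y (\<lambda>n. \<mu> (r n)) \<nu>" "as_conv_rep \<Omega>' X' Y' (\<lambda>n. \<mu> (r' n)) \<nu>'"
    and min: "\<nu> \<in> argmin_P2 G" "\<nu>' \<in> argmin_P2 G"
  shows "\<nu> = \<nu>'"
proof -
  obtain C where C: "\<And>n. moment2 (\<mu> n) \<le> C" using moments_bounded by blast
  note P = min[THEN argmin_P2_is_P2]
  obtain d d' where d: "(\<lambda>n. W 2 (\<mu> n) \<nu>) \<longlonglongrightarrow> d" "(\<lambda>n. W 2 (\<mu> n) \<nu>') \<longlonglongrightarrow> d'"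
    using min[THEN W2_argmin_convergent] by (auto simp: convergent_def)
  have *: "(\<lambda>n. (W 2 (\<mu> (q n)) \<nu>)\<^sup>2) \<longlonglongrightarrow> d\<^sup>2" "(\<lambda>n. (W 2 (\<mu> (q n)) \<nu>')\<^sup>2) \<longlonglongrightarrow> d'\<^sup>2"
    if "strict_mono q" for q
    using LIMSEQ_subseq_LIMSEQ[OF d(1) that] LIMSEQ_subseq_LIMSEQ[OF d(2) that]
    by (auto intro: tendsto_power simp: o_def)
  have "(W 2 \<nu> \<nu>')\<^sup>2 \<le> d'\<^sup>2 - d\<^sup>2"
    by (rule W2_opial[OF iterate_P2 P(2) C rep(1) order_refl tendsto_diff[OF *(2,1)[OF r(1)]]])
  moreover have "(W 2 \<nu>' \<nu>)\<^sup>2 \<le> d\<^sup>2 - d'\<^sup>2"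
    by (rule W2_opial[OF iterate_P2 P(1) C rep(2) order_refl tendsto_diff[OF *[OF r(2)]]])
  ultimately have "(W 2 \<nu> \<nu>')\<^sup>2 \<le> 0" using zero_le_power2[of "W 2 \<nu>' \<nu>"] by linarith
  then show ?thesis using W2_eq_0[OF P] by simp
qed

theorem iterates_converge:
  assumes s: "summable (\<lambda>n. total_time (Suc n) / \<tau> (Suc n) * (\<epsilon> n)\<^sup>2)"
  obtains \<nu> where "\<nu> \<in> argmin_P2 G" "limitin tau_w2 \<mu> \<nu> sequentially"
    "\<And>p. p \<in> {1..<2} \<Longrightarrow> (\<lambda>n. W p (\<mu> n) \<nu>) \<longlonglongrightarrow> 0"
proof -
  note cluster = cluster_point_argmin[OF gap_tendsto_0[OF s]]
  obtain C where C: "\<And>n. moment2 (\<mu> n) \<le> C" using moments_bounded by blast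
  obtain r0 \<nu> and \<Omega>0 :: "real measure" and X0 Y0 where r0: "strict_mono r0" "as_conv_rep \<Omega>0 X0 Y0 (\<lambda>n. \<mu> (r0 n)) \<nu>"
    and \<nu>: "\<nu> \<in> P2"
    by (rule P2_bounded_subseq[of \<mu>, OF iterate_P2 C]) (rule that)
  have min: "\<nu> \<in> argmin_P2 G" using cluster[OF r0] .
  \<comment> \<open>Every subsequence has a further one represented with the same limit \<nu>. This
    form settles the weak-* convergence and that of W_p alike.\<close>
  have sub: "\<exists>r \<Omega> X Y. strict_mono r \<and> as_conv_rep (\<Omega> :: real measure) X Y (\<lambda>n. \<mu> (q (r n))) \<nu>"
    if q: "strict_mono (q :: nat \<Rightarrow> nat)" for q
  proof -
    obtain r \<nu>' and \<Omega> :: "real measure" and X Y where r: "strict_mono r" 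
      and rep: "as_conv_rep \<Omega> X Y (\<lambda>n. \<mu> (q (r n))) \<nu>'"
      by (rule P2_bounded_subseq[of "\<lambda>n. \<mu> (q n)", OF iterate_P2 C]) (rule that)
    have qr: "strict_mono (\<lambda>n. q (r n))" using strict_mono_o[OF q r] by (simp add: o_def)
    have "\<nu>' = \<nu>" by (rule cluster_points_equal[OF qr r0(1) rep r0(2) cluster[OF qr rep] min])
    with r rep show ?thesis by blast
  qed
  have "(\<lambda>n. integral\<^sup>L (\<mu> n) f) \<longlonglongrightarrow> integral\<^sup>L \<nu> f" if f: "f \<in> C2w" for f
  proof (rule LIMSEQ_by_subsubseq)
    fix q :: "nat \<Rightarrow> nat" assume "strict_mono q"
    then obtain r \<Omega> X Y where r: "strict_mono r" and rep: "as_conv_rep (\<Omega> :: real measure) X Y (\<lambda>n. \<mu> (q (r n))) \<nu>"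
      using sub by blast
    show "\<exists>r. strict_mono r \<and> (\<lambda>n. integral\<^sup>L (\<mu> (q (r n))) f) \<longlonglongrightarrow> integral\<^sup>L \<nu> f"
      using as_conv_rep_C2w[OF rep iterate_P2 \<nu> C f] r by blast
  qed
  then have "limitin tau_w2 \<mu> \<nu> sequentially"
    using \<nu> limitin_tau_w2_iff[of \<mu> \<nu>, OF iterate_P2] by blast
  moreover have "(\<lambda>n. W p (\<mu> n) \<nu>) \<longlonglongrightarrow> 0" if p: "p \<in> {1..<2}" for p
  proof (rule LIMSEQ_by_subsubseq)
    fix q :: "nat \<Rightarrow> nat" assume "strict_mono q"
    then obtain r \<Omega> X Y where r: "strict_mono r" and rep: "as_conv_rep (\<Omega> :: real measure) X Y (\<lambda>n. \<mu> (q (r n))) \<nu>"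
      using sub by blast
    have "0 < p" "p < 2" using p by auto
    then show "\<exists>r. strict_mono r \<and> (\<lambda>n. W p (\<mu> (q (r n))) \<nu>) \<longlonglongrightarrow> 0"
      using as_conv_rep_W_tendsto[OF rep iterate_P2 \<nu> C] r by blast
  qed
  ultimately show ?thesis using min that by blast
qed

end

text \<open>The series over n \<ge> 1 is reindexed by \<open>Suc\<close>, which turns the error of
  index n - 1 into \<open>\<epsilon> n\<close>. The choice of \<open>j n\<close> is constrained from
  n = 1 on, as there is no index below 0.\<close>

theorem theorem3p3:
  fixes G :: "'a::euclidean_space measure \<Rightarrow> ereal"
    and \<epsilon> \<tau> \<sigma> :: "nat \<Rightarrow> real"
    and \<mu> :: "nat \<Rightarrow> 'a measure"
  assumes "proper_P2 G"
    and "lsc_W2 G"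
    and "convex_along_generalized_geodesics G"
    and "argmin_P2 G \<noteq> {}"
    and "\<And>n. \<epsilon> n \<ge> 0" and "summable \<epsilon>"
    and "\<And>n. \<tau> n > 0" and "\<not> summable \<tau>"
    and "\<And>n. \<sigma> n = (\<Sum>i<n. \<tau> i)"
    and "\<And>n. \<mu> n \<in> P2"
    and "\<And>n. W 2 (\<mu> (Suc n)) (prox G (\<tau> n) (\<mu> n)) \<le> \<epsilon> n"
  shows "(\<forall>j. (\<forall>n\<ge>1. is_arg_min (\<lambda>i. G (prox G (\<tau> i) (\<mu> i))) (\<lambda>i. i < n) (j n)) \<longrightarrow>
            ereal_bigo (\<lambda>n. G (prox G (\<tau> (j n)) (\<mu> (j n))) - (INF \<nu>\<in>P2. G \<nu>)) (\<lambda>n. 1 / \<sigma> n)) \<and>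
         (summable (\<lambda>n. \<sigma> (Suc n) / \<tau> (Suc n) * (\<epsilon> n)\<^sup>2) \<longrightarrow>
            ereal_bigo (\<lambda>n. G (prox G (\<tau> n) (\<mu> n)) - (INF \<nu>\<in>P2. G \<nu>)) (\<lambda>n. 1 / \<sigma> n) \<and>
            (\<exists>\<mu>' \<in> argmin_P2 G. limitin tau_w2 \<mu> \<mu>' sequentially \<and>
               (\<forall>p\<in>{1..<2}. (\<lambda>n. W p (\<mu> n) \<mu>') \<longlonglongrightarrow> 0)))"
proof -
  interpret inexact_proximal_point G \<epsilon> \<tau> \<mu>
    by unfold_locales (use assms in auto)
  have \<sigma>: "\<sigma> = total_time" using assms(9) by (auto simp: total_time_def)
  show ?thesis
    unfolding \<sigma> exact_def[symmetric]
  proof (intro conjI allI impI)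
    show "ereal_bigo (\<lambda>n. G (exact (j n)) - (INF \<nu>\<in>P2. G \<nu>)) (\<lambda>n. 1 / total_time n)"
      if "\<forall>n\<ge>1. is_arg_min (\<lambda>i. G (exact i)) (\<lambda>i. i < n) (j n)" for j
      using that by (rule best_iterate_rate)
    assume s: "summable (\<lambda>n. total_time (Suc n) / \<tau> (Suc n) * (\<epsilon> n)\<^sup>2)"
    show "ereal_bigo (\<lambda>n. G (exact n) - (INF \<nu>\<in>P2. G \<nu>)) (\<lambda>n. 1 / total_time n)"
      using s by (rule last_iterate_rate)
    show "\<exists>\<mu>' \<in> argmin_P2 G. limitin tau_w2 \<mu> \<mu>' sequentially \<and> (\<forall>p\<in>{1..<2}. (\<lambda>n. W p (\<mu> n) \<mu>') \<longlonglongrightarrow> 0)"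
      using iterates_converge[OF s] by metis
  qed
qed

end
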